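(* Let $\Lambda=\{\mu=(\lambda_1,\lambda_2,\lambda_3,\lambda_4,\mu_1)\in\mathbb{R}^5:\lambda_i>0,\ i=1,\dots,4\}$ and let $X_\mu$, $\mu\in\Lambda$, be the vector field associated to $$\begin{aligned} \dot x&=x(x-1)\bigl(-1-(\lambda_{3}-1)x+y-(\lambda_{1}-\lambda_{3})xy+\lambda_{1}y^{2}\bigr),\\ \dot y&=y(y-1)\bigl(\lambda_{2}-(\lambda_{2}+\mu_{1})x-(\lambda_{2}-1)y+(\mu_{1}-1)x^{2}+(\lambda_{2}-\lambda_{4})xy\bigr). \end{aligned}$$ Let $\Gamma$ be the boundary of the unit square $[0,1]^2$, which is a polycycle of $X_\mu$ for every $\mu\in\Lambda$. There exist parameter values $\mu_0\in\Lambda$ such that $X_\mu$ has two limit cycles bifurcating from the polycycle $\Gamma$ for $\mu\approx\mu_0$; that is, for every $\varepsilon>0$ and $\delta>0$ there is $\mu\in\Lambda$ with $|\mu-\mu_0|<\delta$ such that $X_\mu$ has two distinct limit cycles at Hausdorff distance less than $\varepsilon$ from $\Gamma$.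
   Context: A limit cycle is an isolated periodic orbit. A polycycle is a compact invariant set formed by finitely many singular points and compatibly oriented separatrices connecting them cyclically, with a well-defined first return map on one of its sides; here the singular points are the hyperbolic saddles $(0,1),(0,0),(1,0),(1,1)$ and the return map is defined on the side inside the square. *)

theory Defs
  imports "HOL-Analysis.Analysis"
begin

section \<open>Solutions of autonomous differential equations\<close>

definition solution_on :: "('a::real_normed_vector \<Rightarrow> 'a) \<Rightarrow> real set \<Rightarrow> (real \<Rightarrow> 'a) \<Rightarrow> bool" where
  "solution_on X I \<phi> \<longleftrightarrow> (\<forall>t\<in>I. (\<phi> has_vector_derivative X (\<phi> t)) (at t within I))"

definition invariant_set :: "('a::real_normed_vector \<Rightarrow> 'a) \<Rightarrow> 'a set \<Rightarrow> bool" where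
  "invariant_set X S \<longleftrightarrow>
     (\<forall>I \<phi> t0. is_interval I \<and> solution_on X I \<phi> \<and> t0 \<in> I \<and> \<phi> t0 \<in> S \<longrightarrow> \<phi> ` I \<subseteq> S)"

section \<open>Limit cycles\<close>

definition periodic_orbit :: "('a::real_normed_vector \<Rightarrow> 'a) \<Rightarrow> 'a set \<Rightarrow> bool" where
  "periodic_orbit X C \<longleftrightarrow>
     (\<exists>\<phi> T. T > 0 \<and> solution_on X UNIV \<phi> \<and> (\<forall>t. \<phi> (t + T) = \<phi> t) \<and>
            (\<exists>t. \<phi> t \<noteq> \<phi> 0) \<and> C = range \<phi>)"

text \<open>Isolated: some neighbourhood of the orbit contains no other periodic orbit.\<close>

definition limit_cycle :: "('a::real_normed_vector \<Rightarrow> 'a) \<Rightarrow> 'a set \<Rightarrow> bool" where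
  "limit_cycle X C \<longleftrightarrow> periodic_orbit X C \<and>
     (\<exists>U. open U \<and> C \<subseteq> U \<and> (\<forall>C'. periodic_orbit X C' \<and> C' \<subseteq> U \<longrightarrow> C' = C))"

text \<open>Only meaningful for nonempty bounded sets; for other arguments the suprema
  (and \<^const>\<open>infdist\<close>) take junk values.\<close>

definition hausdorff_distance :: "'a::metric_space set \<Rightarrow> 'a set \<Rightarrow> real" where
  "hausdorff_distance A B = max (SUP a\<in>A. infdist a B) (SUP b\<in>B. infdist b A)"

section \<open>Polycycles of planar vector fields\<close>

text \<open>In the plane, the two eigenvalues below are all eigenvalues of the linear part.\<close>

definition hyperbolic_saddle :: "(real \<times> real \<Rightarrow> real \<times> real) \<Rightarrow> real \<times> real \<Rightarrow> bool" where
  "hyperbolic_saddle X p \<longleftrightarrow> X p = 0 \<and>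
     (\<exists>A. (X has_derivative A) (at p) \<and>
        (\<exists>a b u v. a < 0 \<and> 0 < b \<and> u \<noteq> 0 \<and> v \<noteq> 0 \<and> A u = a *\<^sub>R u \<and> A v = b *\<^sub>R v))"

text \<open>The range of \<open>\<phi>\<close> is a nonsingular orbit, oriented from \<open>p\<close> to \<open>q\<close>. If \<open>p\<close> and \<open>q\<close> are
  hyperbolic saddles, it is an unstable separatrix of \<open>p\<close> and a stable separatrix of \<open>q\<close>.\<close>

definition connecting_orbit ::
  "(real \<times> real \<Rightarrow> real \<times> real) \<Rightarrow> (real \<Rightarrow> real \<times> real) \<Rightarrow> real \<times> real \<Rightarrow> real \<times> real \<Rightarrow> bool" where
  "connecting_orbit X \<phi> p q \<longleftrightarrow> solution_on X UNIV \<phi> \<and> (\<forall>t. X (\<phi> t) \<noteq> 0) \<and>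
     (\<phi> \<longlongrightarrow> p) at_bot \<and> (\<phi> \<longlongrightarrow> q) at_top"

text \<open>The orbit of \<open>p\<close> meets \<open>S\<close> at positive times, and \<open>p'\<close> is the first such point.
  The point \<open>p'\<close> is determined by \<open>p\<close> if \<open>X\<close> is locally Lipschitz.\<close>

definition first_return ::
  "(real \<times> real \<Rightarrow> real \<times> real) \<Rightarrow> (real \<times> real) set \<Rightarrow> real \<times> real \<Rightarrow> real \<times> real \<Rightarrow> bool" where
  "first_return X S p p' \<longleftrightarrow> p' \<in> S \<and>
     (\<exists>\<phi> \<tau>. \<tau> > 0 \<and> solution_on X {0..\<tau>} \<phi> \<and> \<phi> 0 = p \<and> \<phi> \<tau> = p' \<and>
             (\<forall>t. 0 < t \<and> t < \<tau> \<longrightarrow> \<phi> t \<notin> S))"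

text \<open>There is a segment that starts at a point \<open>q\<close> of \<open>\<Gamma>\<close>, is transverse to \<open>X\<close> (at \<open>q\<close> too) and
  otherwise lies in the side \<open>D\<close>, and whose first return map \<open>P\<close>, in the coordinate \<open>s\<close> along the
  segment, is defined near \<open>s = 0\<close> and extends continuously by \<open>P 0 = 0\<close>.\<close>

definition has_return_map ::
  "(real \<times> real \<Rightarrow> real \<times> real) \<Rightarrow> (real \<times> real) set \<Rightarrow> (real \<times> real) set \<Rightarrow> bool" where
  "has_return_map X D \<Gamma> \<longleftrightarrow>
     (\<exists>q\<in>\<Gamma>. \<exists>v r. v \<noteq> 0 \<and> r > 0 \<and>
        (\<forall>s. 0 \<le> s \<and> s < r \<longrightarrow> X (q + s *\<^sub>R v) \<notin> span {v}) \<and>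
        (\<forall>s. 0 < s \<and> s < r \<longrightarrow> q + s *\<^sub>R v \<in> D) \<and>
        (\<exists>P. (\<forall>\<^sub>F s in at_right 0.
                first_return X ((\<lambda>s. q + s *\<^sub>R v) ` {0<..<r}) (q + s *\<^sub>R v) (q + P s *\<^sub>R v)) \<and>
             (P \<longlongrightarrow> 0) (at_right 0)))"

text \<open>Polycycles whose singular points are hyperbolic saddles, listed in \<open>ps\<close> in the cyclic order
  given by the flow. The side \<open>D\<close> of \<open>\<Gamma>\<close> is the one where the return map is defined.\<close>

definition polycycle ::
  "(real \<times> real \<Rightarrow> real \<times> real) \<Rightarrow> (real \<times> real) list \<Rightarrow>
   (real \<times> real) set \<Rightarrow> (real \<times> real) set \<Rightarrow> bool" where
  "polycycle X ps D \<Gamma> \<longleftrightarrow>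
     compact \<Gamma> \<and> invariant_set X \<Gamma> \<and>
     ps \<noteq> [] \<and> (\<forall>p\<in>set ps. hyperbolic_saddle X p) \<and>
     (\<exists>\<phi>. (\<forall>i<length ps. connecting_orbit X (\<phi> i) (ps ! i) (ps ! (Suc i mod length ps))) \<and>
          disjoint_family_on (\<lambda>i. range (\<phi> i)) {..<length ps} \<and>
          \<Gamma> = set ps \<union> (\<Union>i<length ps. range (\<phi> i))) \<and>
     D \<in> components (- \<Gamma>) \<and> has_return_map X D \<Gamma>"

section \<open>The family of vector fields\<close>

text \<open>The parameter space carries the product metric, which is the Euclidean one.\<close>

type_synonym param = "real \<times> real \<times> real \<times> real \<times> real"

definition param_set :: "param set" where
  "param_set = {(l1, l2, l3, l4, m1). l1 > 0 \<and> l2 > 0 \<and> l3 > 0 \<and> l4 > 0}"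

fun vfield :: "param \<Rightarrow> real \<times> real \<Rightarrow> real \<times> real" where
  "vfield (l1, l2, l3, l4, m1) (x, y) =
     (x * (x - 1) * (- 1 - (l3 - 1) * x + y - (l1 - l3) * x * y + l1 * y\<^sup>2),
      y * (y - 1) * (l2 - (l2 + m1) * x - (l2 - 1) * y + (m1 - 1) * x\<^sup>2 + (l2 - l4) * x * y))"

definition square_boundary :: "(real \<times> real) set" where
  "square_boundary = frontier ({0..1} \<times> {0..1})"

end

theory Submission
  imports Defs "HOL-Complex_Analysis.Conformal_Mappings"
begin

text \<open>The return map \<open>P\<close> near the boundary is a composition of four quarter turns, one around each
  corner; a quarter turn is analytic, and at distance \<open>s\<close> it behaves roughly like \<open>s powr \<rho>\<close> with
  \<open>\<rho>\<close> the hyperbolicity ratio of the corner. Hence \<open>P s > s\<close> for all small \<open>s\<close> if the product of the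
  ratios is less than one. At \<open>(1, 1, 1, 1, 1)\<close> the interior of the square is filled with closed
  orbits, the level curves of \<open>x (1 - x) y (1 - y) exp y\<close>. Perturb along a curve on which the
  product of the ratios stays \<open>1\<close>: a modified first integral that increases along orbits near the
  boundary gives \<open>P c3 > c3\<close> at a prescribed small \<open>c3\<close>, while a second one, which for the fixed
  perturbed field decreases along orbits that are close enough to the boundary, gives \<open>P c2 < c2\<close>
  for some \<open>c2 < c3\<close>. A much smaller second perturbation keeps both inequalities and makes the product
  of the ratios less than \<open>1\<close>, so that \<open>P c1 > c1\<close> for some \<open>c1 < c2\<close>. The two fixed points
  between \<open>c1\<close>, \<open>c2\<close> and \<open>c3\<close> are isolated since \<open>P\<close> is analytic and not the identity.\<close>

section \<open>Ordinary differential equations\<close>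

text \<open>The two opposite signs live in different orders of \<open>h\<close>. Put u = x (1 - x),
  w = y (1 - y), F = y^2 + y - 1. For \<open>k = 0\<close> the weights in \<open>Lf\<close> fit the
  four ratios, and a polynomial correction of order h removes the drift of order h from all edges;
  what remains is - h u w F + O(h^2). A further multiple of u w in the correction makes the part of
  order h positive in a fixed collar. On the edges this part vanishes, so there the order h^2
  decides, and it can be made negative. Thus, as h tends to 0, orbits drift inwards at a fixed
  distance from the boundary and outwards at a distance that shrinks with \<open>h\<close>. The
  obstacle is that nothing is uniform up to the boundary: logarithms are unbounded and passages take
  arbitrarily long. Hence time is replaced by an angle near the corners, the sign of a derivative is
  used only on one level curve, which lies in a compact part of the open square, and the width
  \<open>d\<close> and the domain of the return map are fixed for a whole neighbourhood of the
  parameter before any level is chosen.\<close>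

lemma gronwall_forward:
  fixes w :: "real \<Rightarrow> 'a::real_inner"
  assumes der: "\<And>t. t \<in> {a..b} \<Longrightarrow> (w has_vector_derivative w' t) (at t within {a..b})"
    and bd: "\<And>t. t \<in> {a..b} \<Longrightarrow> norm (w' t) \<le> C * norm (w t)"
    and st: "a \<le> s" "s \<le> t" "t \<le> b"
  shows "norm (w t) \<le> exp (C * (t - s)) * norm (w s)" "norm (w s) \<le> exp (C * (t - s)) * norm (w t)"
proof -
  have cw: "continuous_on {a..b} w"
    unfolding continuous_on_eq_continuous_within by (intro ballI has_vector_derivative_continuous[OF der])
  have dw: "(w has_vector_derivative w' r) (at r)" if "s < r" "r < t" for r
    using der[of r] that st by (simp add: at_within_Icc_at)
  have ip: "\<bar>w r \<bullet> w' r\<bar> \<le> C * (w r \<bullet> w r)" if "s < r" "r < t" for r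
  proof -
    have "\<bar>w r \<bullet> w' r\<bar> \<le> norm (w r) * norm (w' r)" by (rule Cauchy_Schwarz_ineq2)
    also have "\<dots> \<le> norm (w r) * (C * norm (w r))" using bd[of r] that st by (intro mult_left_mono) auto
    finally show ?thesis by (simp add: dot_square_norm power2_eq_square mult_ac)
  qed
  \<comment> \<open>The norm need not be differentiable where \<open>w\<close> vanishes, but its
    square is. With \<open>k = - 2 * C\<close> the weighted square is nonincreasing, with
    \<open>k = 2 * C\<close> nondecreasing.\<close>
  have dN: "((\<lambda>r. (w r \<bullet> w r) * exp (k * r)) has_real_derivative
      (2 * (w r \<bullet> w' r) + k * (w r \<bullet> w r)) * exp (k * r)) (at r)" if "s < r" "r < t" for r k
  proof -
    have "((\<lambda>r. w r \<bullet> w r) has_real_derivative 2 * (w r \<bullet> w' r)) (at r)"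
      using has_derivative_inner[OF dw[OF that, unfolded has_vector_derivative_def] dw[OF that, unfolded has_vector_derivative_def]]
      by (simp add: has_field_derivative_def inner_commute mult_ac)
        (auto simp: algebra_simps elim!: has_derivative_eq_rhs)
    then show ?thesis
      by (auto intro!: derivative_eq_intros simp: algebra_simps)
  qed
  have cN: "continuous_on {s..t} (\<lambda>r. (w r \<bullet> w r) * exp (k * r))" for k
    using st by (intro continuous_intros continuous_on_subset[OF cw]) auto
  have exp_trick: "p \<le> q * exp (j - i)" if "p * exp i \<le> q * exp j" for p q i j :: real
  proof -
    have "p = (p * exp i) * exp (- i)" by (simp add: mult.assoc flip: exp_add)
    also have "\<dots> \<le> (q * exp j) * exp (- i)" using that by (intro mult_right_mono) auto
    also have "\<dots> = q * exp (j - i)" by (simp add: mult.assoc flip: exp_add)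
    finally show ?thesis .
  qed
  have exp2: "(exp z)\<^sup>2 = exp (2 * z)" for z :: real by (simp add: exp_double)
  have "(w t \<bullet> w t) * exp (- (2*C) * t) \<le> (w s \<bullet> w s) * exp (- (2*C) * s)"
  proof (rule DERIV_nonpos_imp_decreasing_open[OF st(2) _ cN])
    fix r assume r: "s < r" "r < t"
    have "(2 * (w r \<bullet> w' r) + - (2*C) * (w r \<bullet> w r)) * exp (- (2*C) * r) \<le> 0"
      using ip[OF r] by (intro mult_nonpos_nonneg) auto
    then show "\<exists>y. ((\<lambda>r. (w r \<bullet> w r) * exp (- (2*C) * r)) has_real_derivative y) (at r) \<and> y \<le> 0"
      using dN[OF r] by blast
  qed
  then have "(norm (w t))\<^sup>2 \<le> (exp (C * (t - s)) * norm (w s))\<^sup>2"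
    using exp_trick[of "w t \<bullet> w t" "- (2 * C) * t" "w s \<bullet> w s" "- (2 * C) * s"]
    by (simp add: dot_square_norm power_mult_distrib exp2 algebra_simps)
  then show "norm (w t) \<le> exp (C * (t - s)) * norm (w s)"
    by (rule power2_le_imp_le) simp
  have "(w s \<bullet> w s) * exp ((2*C) * s) \<le> (w t \<bullet> w t) * exp ((2*C) * t)"
  proof (rule DERIV_nonneg_imp_increasing_open[OF st(2) _ cN])
    fix r assume r: "s < r" "r < t"
    have "(2 * (w r \<bullet> w' r) + (2*C) * (w r \<bullet> w r)) * exp ((2*C) * r) \<ge> 0"
      using ip[OF r] by (intro mult_nonneg_nonneg) auto
    then show "\<exists>y. ((\<lambda>r. (w r \<bullet> w r) * exp ((2*C) * r)) has_real_derivative y) (at r) \<and> y \<ge> 0"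
      using dN[OF r] by blast
  qed
  then have "(norm (w s))\<^sup>2 \<le> (exp (C * (t - s)) * norm (w t))\<^sup>2"
    using exp_trick[of "w s \<bullet> w s" "(2 * C) * s" "w t \<bullet> w t" "(2 * C) * t"]
    by (simp add: dot_square_norm power_mult_distrib exp2 algebra_simps)
  then show "norm (w s) \<le> exp (C * (t - s)) * norm (w t)"
    by (rule power2_le_imp_le) simp
qed

lemma gronwall:
  fixes w :: "real \<Rightarrow> 'a::real_inner"
  assumes der: "\<And>t. t \<in> {a..b} \<Longrightarrow> (w has_vector_derivative w' t) (at t within {a..b})"
    and bd: "\<And>t. t \<in> {a..b} \<Longrightarrow> norm (w' t) \<le> C * norm (w t)"
    and st: "s \<in> {a..b}" "t \<in> {a..b}"
  shows "norm (w t) \<le> exp (C * \<bar>t - s\<bar>) * norm (w s)"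
proof (cases "s \<le> t")
  case True
  then show ?thesis using gronwall_forward(1)[OF der bd, of s t] st by auto
next
  case False
  then show ?thesis using gronwall_forward(2)[OF der bd, of t s] st by auto
qed

lemma antiderivative_UNIV:
  fixes g :: "real \<Rightarrow> 'a::euclidean_space"
  assumes "continuous_on UNIV g"
  shows "\<exists>F. F 0 = 0 \<and> (\<forall>t. (F has_vector_derivative g t) (at t))"
proof -
  obtain F where F: "\<And>t. (F has_vector_derivative g t) (at t)"
    using einterval_antiderivative[of "-\<infinity>" "\<infinity>" g] assms
    by (auto simp: continuous_on_eq_continuous_at)
  have "((\<lambda>t. F t - F 0) has_vector_derivative g t) (at t)" for t
    using has_vector_derivative_diff[OF F[of t] has_vector_derivative_const[of "F 0"]] by simp
  then show ?thesis by (intro exI[of _ "\<lambda>t. F t - F 0"]) auto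
qed

text \<open>One Picard step measured with the weight exp (K |t|): integration divides the constant
  by \<open>K\<close>, in both time directions.\<close>

lemma norm_le_exp_of_derivative:
  fixes F :: "real \<Rightarrow> 'a::real_normed_vector"
  assumes F0: "F 0 = 0" and der: "\<And>t. (F has_vector_derivative F' t) (at t)"
    and bd: "\<And>t. norm (F' t) \<le> c * K * exp (K * \<bar>t\<bar>)"
  shows "norm (F t) \<le> c * (exp (K * \<bar>t\<bar>) - 1)"
proof -
  have pos: "norm (G t) \<le> c * (exp (K * t) - 1)"
    if G0: "G 0 = 0" and dG: "\<And>t. (G has_vector_derivative G' t) (at t)"
      and bG: "\<And>t. norm (G' t) \<le> c * K * exp (K * \<bar>t\<bar>)" and t: "t > 0"
    for G :: "real \<Rightarrow> 'a" and G' t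
  proof -
    have "norm (G t - G 0) \<le> c * exp (K * t) - c * exp (K * 0)"
    proof (rule differentiable_bound_general[OF t])
      show "continuous_on {0..t} G"
        using dG by (meson continuous_at_imp_continuous_on has_vector_derivative_continuous)
      show "continuous_on {0..t} (\<lambda>t. c * exp (K * t))" by (intro continuous_intros)
      show "(G has_vector_derivative G' x) (at x)" for x by (rule dG)
      show "((\<lambda>t. c * exp (K * t)) has_vector_derivative c * K * exp (K * x)) (at x)" for x
        by (auto intro!: derivative_eq_intros simp flip: has_real_derivative_iff_has_vector_derivative)
      show "norm (G' x) \<le> c * K * exp (K * x)" if "0 < x" for x
        using bG[of x] that by simp
    qed
    then show ?thesis using G0 by (simp add: algebra_simps)
  qed
  consider "t > 0" | "t = 0" | "t < 0" by linarith
  then show ?thesis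
  proof cases
    case 1 then show ?thesis using pos[OF F0 der bd] by simp
  next
    case 2 then show ?thesis using F0 by simp
  next
    case 3
    have "((\<lambda>t. F (- t)) has_vector_derivative - F' (- t)) (at t)" for t
    proof -
      have "(uminus has_vector_derivative - 1) (at t)"
        by (auto intro!: derivative_eq_intros simp flip: has_real_derivative_iff_has_vector_derivative)
      from vector_diff_chain_at[OF this der] show ?thesis by (simp add: o_def)
    qed
    from pos[of "\<lambda>t. F (- t)" "\<lambda>t. - F' (- t)" "- t", OF _ this] show ?thesis
      using bd[of "- _"] F0 3 by simp
  qed
qed

theorem picard_lindelof_global:
  fixes f :: "real \<Rightarrow> 'a::euclidean_space \<Rightarrow> 'a"
  assumes cont: "continuous_on UNIV (\<lambda>(t, x). f t x)"
    and lip: "\<And>t x y. norm (f t x - f t y) \<le> L * norm (x - y)"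
    and bd: "\<And>t x. norm (f t x) \<le> B"
  obtains x where "x t0 = x0" "\<And>t. (x has_vector_derivative f t (x t)) (at t)"
proof -
  have main: "\<exists>x. x 0 = x0 \<and> (\<forall>t. (x has_vector_derivative f t (x t)) (at t))"
    if cont: "continuous_on UNIV (\<lambda>(t, x). f t x)"
    and lip: "\<And>t x y. norm (f t x - f t y) \<le> L * norm (x - y)"
    and bd: "\<And>t x. norm (f t x) \<le> B" and L: "L > 0"
    for f :: "real \<Rightarrow> 'a \<Rightarrow> 'a" and L
  proof -
    have cfx: "continuous_on UNIV (\<lambda>t. f t (x t))" if "continuous_on UNIV x" for x
    proof -
      have "continuous_on UNIV (\<lambda>t. (t, x t))" by (intro continuous_intros that)
      from continuous_on_compose2[OF cont this] show ?thesis by simp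
    qed
    define J where "J g = (SOME F. F 0 = 0 \<and> (\<forall>t. (F has_vector_derivative g t) (at t)))"
      for g :: "real \<Rightarrow> 'a"
    have J: "J g 0 = 0 \<and> (\<forall>t. (J g has_vector_derivative g t) (at t))" if g: "continuous_on UNIV g" for g
      using someI_ex[OF antiderivative_UNIV[OF g]] unfolding J_def .
    define X where "X = rec_nat (\<lambda>t. x0) (\<lambda>n x t. x0 + J (\<lambda>s. f s (x s)) t)"
    have X0: "X 0 = (\<lambda>t. x0)" and XS: "X (Suc n) = (\<lambda>t. x0 + J (\<lambda>s. f s (X n s)) t)" for n
      by (simp_all add: X_def)
    have cX: "continuous_on UNIV (X n)" for n
    proof (induction n)
      case 0 then show ?case by (simp add: X0)
    next
      case (Suc n)
      have "continuous_on UNIV (J (\<lambda>s. f s (X n s)))"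
        using J[OF cfx[OF Suc]] by (meson continuous_at_imp_continuous_on has_vector_derivative_continuous)
      then show ?case unfolding XS by (intro continuous_intros)
    qed
    have dX: "(X (Suc n) has_vector_derivative f t (X n t)) (at t)" for n t
      using J[OF cfx[OF cX]] by (auto simp: XS intro!: derivative_eq_intros)
    have Xz: "X n 0 = x0" for n
      using J[OF cfx[OF cX]] by (cases n) (auto simp: X0 XS)
    \<comment> \<open>One iteration multiplies the weighted distance by L / K = 1/2, so the iterates
      converge on the whole line at once.\<close>
    define K where "K = 2 * L"
    have K: "K > 0" using L by (simp add: K_def)
    have B: "B \<ge> 0" using bd[of 0 0] by (meson norm_ge_zero order_trans)
    define c where "c = B / K"
    have c: "c \<ge> 0" using B K by (simp add: c_def)
    have D: "norm (X (Suc n) t - X n t) \<le> c * (1/2)^n * exp (K * \<bar>t\<bar>)" for n t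
    proof (induction n arbitrary: t)
      case 0
      have "norm (X (Suc 0) t - X 0 t) \<le> c * (exp (K * \<bar>t\<bar>) - 1)"
      proof (rule norm_le_exp_of_derivative)
        show "X (Suc 0) 0 - X 0 0 = 0" by (simp add: Xz)
        show "((\<lambda>t. X (Suc 0) t - X 0 t) has_vector_derivative f t (X 0 t)) (at t)" for t
          using has_vector_derivative_diff[OF dX[of 0 t] has_vector_derivative_const[of x0]] by (simp add: X0)
        have "B * 1 \<le> B * exp (K * \<bar>t\<bar>)" for t
          using B K by (intro mult_left_mono) auto
        then show "norm (f t (X 0 t)) \<le> c * K * exp (K * \<bar>t\<bar>)" for t
          using bd[of t "X 0 t"] K by (simp add: c_def) (meson order_trans)
      qed
      then show ?case using c by (simp add: algebra_simps)
    next
      case (Suc n)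
      have "norm (X (Suc (Suc n)) t - X (Suc n) t) \<le> (c * (1/2)^Suc n) * (exp (K * \<bar>t\<bar>) - 1)"
      proof (rule norm_le_exp_of_derivative)
        show "X (Suc (Suc n)) 0 - X (Suc n) 0 = 0" by (simp add: Xz)
        show "((\<lambda>t. X (Suc (Suc n)) t - X (Suc n) t) has_vector_derivative f t (X (Suc n) t) - f t (X n t)) (at t)" for t
          by (rule has_vector_derivative_diff[OF dX dX])
        show "norm (f t (X (Suc n) t) - f t (X n t)) \<le> (c * (1/2)^Suc n) * K * exp (K * \<bar>t\<bar>)" for t
        proof -
          have "norm (f t (X (Suc n) t) - f t (X n t)) \<le> L * norm (X (Suc n) t - X n t)" by (rule lip)
          also have "\<dots> \<le> L * (c * (1/2)^n * exp (K * \<bar>t\<bar>))" using Suc L by (intro mult_left_mono) auto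
          finally show ?thesis by (simp add: K_def mult_ac)
        qed
      qed
      also have "\<dots> \<le> (c * (1/2)^Suc n) * exp (K * \<bar>t\<bar>)"
        using c by (intro mult_left_mono) auto
      finally show ?case .
    qed
    have T: "norm (X (n + k) t - X n t) \<le> 2 * c * (1/2)^n * exp (K * \<bar>t\<bar>) * (1 - (1/2)^k)" for n k t
    proof (induction k)
      case (Suc k)
      have "norm (X (n + Suc k) t - X n t) \<le> norm (X (Suc (n + k)) t - X (n+k) t) + norm (X (n + k) t - X n t)"
        using norm_triangle_ineq[of "X (Suc (n + k)) t - X (n+k) t" "X (n + k) t - X n t"] by simp
      also have "\<dots> \<le> c * (1/2)^(n+k) * exp (K * \<bar>t\<bar>) + 2 * c * (1/2)^n * exp (K * \<bar>t\<bar>) * (1 - (1/2)^k)"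
        using Suc D[of "n+k" t] by (intro add_mono)
      also have "\<dots> = 2 * c * (1/2)^n * exp (K * \<bar>t\<bar>) * (1 - (1/2)^Suc k)"
        by (simp add: power_add algebra_simps)
      finally show ?case .
    qed simp
    have T': "norm (X (n + k) t - X n t) \<le> 2 * c * (1/2)^n * exp (K * \<bar>t\<bar>)" for n k t
    proof -
      have "2 * c * (1/2)^n * exp (K * \<bar>t\<bar>) * (1 - (1/2)^k) \<le> 2 * c * (1/2)^n * exp (K * \<bar>t\<bar>) * 1"
        using c by (intro mult_left_mono) auto
      with T[of n k t] show ?thesis by linarith
    qed
    have lim0: "(\<lambda>n. C * (1/2)^n) \<longlonglongrightarrow> (0::real)" for C
      using tendsto_mult_right_zero[OF LIMSEQ_realpow_zero[of "1/2::real"]] by simp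
    have "\<exists>l. (\<lambda>n. X n t) \<longlonglongrightarrow> l" for t
    proof -
      have "Cauchy (\<lambda>n. X n t)"
      proof (rule CauchyI')
        fix e :: real assume "e > 0"
        with lim0[of "2 * c * exp (K * \<bar>t\<bar>)"] have "\<forall>\<^sub>F n in sequentially. 2 * c * exp (K * \<bar>t\<bar>) * (1/2)^n < e"
          by (auto dest: order_tendstoD)
        then obtain M where M: "\<And>n. n \<ge> M \<Longrightarrow> 2 * c * exp (K * \<bar>t\<bar>) * (1/2)^n < e"
          by (auto simp: eventually_sequentially)
        show "\<exists>M. \<forall>m\<ge>M. \<forall>n>m. dist (X m t) (X n t) < e"
        proof (intro exI allI impI)
          fix m n assume "M \<le> m" "m < n"
          then show "dist (X m t) (X n t) < e"
            using T'[of m "n - m" t] M[of m] by (simp add: dist_norm norm_minus_commute mult_ac)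
        qed
      qed
      then show ?thesis by (auto simp: Cauchy_convergent_iff convergent_def)
    qed
    then obtain x where x: "\<And>t. (\<lambda>n. X n t) \<longlonglongrightarrow> x t" by metis
    have xX: "norm (x t - X n t) \<le> 2 * c * (1/2)^n * exp (K * \<bar>t\<bar>)" for n t
    proof -
      have "(\<lambda>k. norm (X (n + k) t - X n t)) \<longlonglongrightarrow> norm (x t - X n t)"
        by (intro tendsto_intros) (use LIMSEQ_ignore_initial_segment[OF x, of n t] in \<open>simp add: add.commute\<close>)
      then show ?thesis by (rule LIMSEQ_le_const2) (use T' in auto)
    qed
    \<comment> \<open>The Lipschitz constant common to all iterates passes to the pointwise limit
      and gives its continuity.\<close>
    have Xlip: "norm (X n t - X n s) \<le> B * norm (t - s)" for n s t
    proof (cases n)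
      case (Suc m)
      show ?thesis unfolding Suc
      proof (rule differentiable_bound[of UNIV])
        show "(X (Suc m) has_derivative (\<lambda>h. h *\<^sub>R f r (X m r))) (at r within UNIV)" for r
          using dX[of m r] by (simp add: has_vector_derivative_def)
        show "onorm (\<lambda>h. h *\<^sub>R f r (X m r)) \<le> B" for r
          using bd[of r "X m r"] by (intro onorm_le) (simp add: mult_left_mono mult.commute[of B])
      qed auto
    qed (simp add: X0 B)
    have "B-lipschitz_on UNIV x"
    proof (rule lipschitz_onI)
      show "dist (x t) (x s) \<le> B * dist t s" for t s
        unfolding dist_norm
        by (rule LIMSEQ_le_const2[of "\<lambda>n. norm (X n t - X n s)"])
          (use x Xlip in \<open>auto intro!: tendsto_intros simp: dist_norm\<close>)
    qed (rule B)
    then have cx: "continuous_on UNIV x" by (rule lipschitz_on_continuous_on)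
    define g where "g = (\<lambda>s. f s (x s))"
    have cg: "continuous_on UNIV g" unfolding g_def by (rule cfx[OF cx])
    have E: "norm (X (Suc n) t - (x0 + J g t)) \<le> c * (1/2)^n * exp (K * \<bar>t\<bar>)" for n t
    proof -
      have "norm (X (Suc n) t - (x0 + J g t)) \<le> (c * (1/2)^n) * (exp (K * \<bar>t\<bar>) - 1)"
      proof (rule norm_le_exp_of_derivative)
        show "X (Suc n) 0 - (x0 + J g 0) = 0" using J[OF cg] by (simp add: Xz)
        show "((\<lambda>t. X (Suc n) t - (x0 + J g t)) has_vector_derivative f t (X n t) - f t (x t)) (at t)" for t
          using J[OF cg] by (auto simp: g_def intro!: derivative_eq_intros dX)
        show "norm (f t (X n t) - f t (x t)) \<le> c * (1/2)^n * K * exp (K * \<bar>t\<bar>)" for t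
        proof -
          have "norm (f t (X n t) - f t (x t)) \<le> L * norm (X n t - x t)" by (rule lip)
          also have "\<dots> \<le> L * (2 * c * (1/2)^n * exp (K * \<bar>t\<bar>))"
            using xX L by (intro mult_left_mono) (auto simp: norm_minus_commute)
          finally show ?thesis by (simp add: K_def mult_ac)
        qed
      qed
      also have "\<dots> \<le> c * (1/2)^n * exp (K * \<bar>t\<bar>)"
        using c by (intro mult_left_mono) auto
      finally show ?thesis .
    qed
    have "x t = x0 + J g t" for t
    proof -
      have "(\<lambda>n. X (Suc n) t - (x0 + J g t)) \<longlonglongrightarrow> 0"
      proof (rule Lim_null_comparison)
        show "\<forall>\<^sub>F n in sequentially. norm (X (Suc n) t - (x0 + J g t)) \<le> (c * exp (K * \<bar>t\<bar>)) * (1/2)^n"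
          using E[of _ t] by (simp add: mult_ac)
      qed (rule lim0)
      moreover have "(\<lambda>n. X (Suc n) t - (x0 + J g t)) \<longlonglongrightarrow> x t - (x0 + J g t)"
        using LIMSEQ_Suc[OF x[of t]] by (intro tendsto_intros)
      ultimately show ?thesis using LIMSEQ_unique by force
    qed
    then have xe: "x = (\<lambda>t. x0 + J g t)" by auto
    have "(x has_vector_derivative g t) (at t)" for t
      using J[OF cg] by (subst xe) (auto intro!: derivative_eq_intros)
    moreover have "x 0 = x0" using J[OF cg] by (subst xe) auto
    ultimately show ?thesis unfolding g_def by blast
  qed
  define f' where "f' t x = f (t + t0) x" for t x
  have "continuous_on UNIV (\<lambda>(t, x). f' t x)"
  proof -
    have "continuous_on UNIV (\<lambda>z::real \<times> 'a. (fst z + t0, snd z))" by (intro continuous_intros)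
    from continuous_on_compose2[OF cont this] show ?thesis by (simp add: f'_def case_prod_beta)
  qed
  moreover have "norm (f' t x - f' t y) \<le> max L 1 * norm (x - y)" for t x y
    using lip[of "t + t0" x y] mult_right_mono[of L "max L 1" "norm (x - y)"] by (auto simp: f'_def)
  ultimately obtain y where y: "y 0 = x0" "\<And>t. (y has_vector_derivative f' t (y t)) (at t)"
    using main[of f' "max L 1"] bd by (auto simp: f'_def less_max_iff_disj)
  have "((\<lambda>t. y (t - t0)) has_vector_derivative f t (y (t - t0))) (at t)" for t
  proof -
    have "((\<lambda>t. t - t0) has_vector_derivative 1) (at t)"
      by (auto intro!: derivative_eq_intros simp flip: has_real_derivative_iff_has_vector_derivative)
    from vector_diff_chain_at[OF this y(2)] show ?thesis by (simp add: o_def f'_def)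
  qed
  then show ?thesis using that[of "\<lambda>t. y (t - t0)"] y by simp
qed

section \<open>Kolmogorov fields on the square\<close>

text \<open>Coefficients as points of a metric space, so that statements about nearby fields become
  eventualities in \<open>nhds c0\<close>.\<close>

type_synonym quad = "real \<times> real \<times> real \<times> real \<times> real \<times> real"

text \<open>The scalars are left general because the same polynomial is evaluated at complex points
  when the corner passage is continued analytically.\<close>

definition qv :: "quad \<Rightarrow> 'a::real_normed_field \<Rightarrow> 'a \<Rightarrow> 'a" where
  "qv c x y = of_real (fst c) + of_real (fst (snd c)) * x + of_real (fst (snd (snd c))) * y +
     of_real (fst (snd (snd (snd c)))) * (x * x) + of_real (fst (snd (snd (snd (snd c))))) * (x * y) +
     of_real (snd (snd (snd (snd (snd c))))) * (y * y)"

definition kf :: "quad \<times> quad \<Rightarrow> real \<times> real \<Rightarrow> real \<times> real" where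
  "kf c z = (fst z * (fst z - 1) * qv (fst c) (fst z) (snd z),
             snd z * (snd z - 1) * qv (snd c) (fst z) (snd z))"

text \<open>Rotating the square by a quarter turn maps the family of fields to itself, so that it suffices
  to study the corner \<open>(0, 0)\<close>.\<close>

definition qrot :: "quad \<Rightarrow> quad" where
  "qrot c = (case c of (c0, cx, cy, cxx, cxy, cyy) \<Rightarrow>
     (c0 + cx + cxx, cy + cxy, - cx - 2 * cxx, cyy, - cxy, cxx))"

lemma qv_qrot: "qv (qrot c) x y = qv c (1 - y) x"
  by (cases c) (simp add: qv_def qrot_def algebra_simps)

lemma qv_uminus: "qv (- c) x y = - qv c x y"
  by (simp add: qv_def algebra_simps)

definition rotc :: "quad \<times> quad \<Rightarrow> quad \<times> quad" where
  "rotc c = (qrot (snd c), - qrot (fst c))"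

definition rot :: "real \<times> real \<Rightarrow> real \<times> real" where
  "rot z = (snd z, 1 - fst z)"

definition usq :: "(real \<times> real) set" where
  "usq = {0<..<1} \<times> {0<..<1}"

definition orbit :: "quad \<times> quad \<Rightarrow> (real \<Rightarrow> real \<times> real) \<Rightarrow> bool" where
  "orbit c \<phi> \<longleftrightarrow> (\<forall>t. (\<phi> has_vector_derivative kf c (\<phi> t)) (at t)) \<and> range \<phi> \<subseteq> usq"

lemma rot_usq: "z \<in> usq \<Longrightarrow> rot z \<in> usq"
  by (auto simp: rot_def usq_def)

lemma continuous_on_qv [continuous_intros]:
  fixes f g :: "'b::topological_space \<Rightarrow> 'a::real_normed_field"
  assumes "continuous_on S f" "continuous_on S g" "continuous_on S q"
  shows "continuous_on S (\<lambda>z. qv (q z) (f z) (g z))"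
  unfolding qv_def using assms by (auto intro!: continuous_intros)

lemma has_vector_derivative_rot:
  assumes "(\<phi> has_vector_derivative kf c (\<phi> t)) (at t within S)"
  shows "((\<lambda>t. rot (\<phi> t)) has_vector_derivative kf (rotc c) (rot (\<phi> t))) (at t within S)"
proof -
  have "((\<lambda>t. rot (\<phi> t)) has_vector_derivative (snd (kf c (\<phi> t)), 0 - fst (kf c (\<phi> t)))) (at t within S)"
    unfolding rot_def
    by (intro has_vector_derivative_Pair has_vector_derivative_diff has_vector_derivative_const
        bounded_linear.has_vector_derivative[OF bounded_linear_fst assms]
        bounded_linear.has_vector_derivative[OF bounded_linear_snd assms])
  moreover have "(snd (kf c z), 0 - fst (kf c z)) = kf (rotc c) (rot z)" for z
    by (simp add: kf_def rot_def rotc_def qv_qrot qv_uminus algebra_simps)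
  ultimately show ?thesis by simp
qed

lemma has_vector_derivative_shift:
  assumes "\<And>t. (\<phi> has_vector_derivative X (\<phi> t)) (at t)"
  shows "((\<lambda>t. \<phi> (t + a)) has_vector_derivative X (\<phi> (t + a))) (at t)"
proof -
  have "((\<lambda>t. t + a) has_vector_derivative 1) (at t)"
    by (auto intro!: derivative_eq_intros simp flip: has_real_derivative_iff_has_vector_derivative)
  from vector_diff_chain_at[OF this assms] show ?thesis by (simp add: o_def)
qed

lemma orbit_rot: "orbit c \<phi> \<Longrightarrow> orbit (rotc c) (\<lambda>t. rot (\<phi> t))"
  unfolding orbit_def using has_vector_derivative_rot rot_usq by blast

lemma orbit_shift: "orbit c \<phi> \<Longrightarrow> orbit c (\<lambda>t. \<phi> (t + a))"
  unfolding orbit_def using has_vector_derivative_shift by blast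

lemma orbit_continuous: "orbit c \<phi> \<Longrightarrow> continuous_on S \<phi>"
  unfolding orbit_def by (meson continuous_at_imp_continuous_on has_vector_derivative_continuous)

section \<open>Lipschitz bounds, uniqueness and global existence of orbits\<close>

definition lipb :: "'a::metric_space set \<Rightarrow> ('a \<Rightarrow> real) \<Rightarrow> bool" where
  "lipb S f \<longleftrightarrow> (\<exists>L B. \<forall>x\<in>S. \<bar>f x\<bar> \<le> B \<and> (\<forall>y\<in>S. \<bar>f x - f y\<bar> \<le> L * dist x y))"

lemma lipb_const: "lipb S (\<lambda>x. c)"
  unfolding lipb_def by (intro exI[of _ 0] exI[of _ "\<bar>c\<bar>"]) auto

lemma lipb_add:
  assumes "lipb S f" "lipb S g" shows "lipb S (\<lambda>x. f x + g x)"
proof -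
  obtain L B L' B' where *: "\<And>x. x \<in> S \<Longrightarrow> \<bar>f x\<bar> \<le> B" "\<And>x. x \<in> S \<Longrightarrow> \<bar>g x\<bar> \<le> B'"
    "\<And>x y. x \<in> S \<Longrightarrow> y \<in> S \<Longrightarrow> \<bar>f x - f y\<bar> \<le> L * dist x y"
    "\<And>x y. x \<in> S \<Longrightarrow> y \<in> S \<Longrightarrow> \<bar>g x - g y\<bar> \<le> L' * dist x y"
    using assms unfolding lipb_def by metis
  have "\<bar>(f x + g x) - (f y + g y)\<bar> \<le> (L + L') * dist x y" if "x \<in> S" "y \<in> S" for x y
    using *(3,4)[OF that] by (simp add: algebra_simps)
  moreover have "\<bar>f x + g x\<bar> \<le> B + B'" if "x \<in> S" for x using *(1,2)[OF that] by linarith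
  ultimately show ?thesis unfolding lipb_def by blast
qed

lemma lipb_mult:
  assumes "lipb S f" "lipb S g" shows "lipb S (\<lambda>x. f x * g x)"
proof -
  obtain L B L' B' where *: "\<And>x. x \<in> S \<Longrightarrow> \<bar>f x\<bar> \<le> B" "\<And>x. x \<in> S \<Longrightarrow> \<bar>g x\<bar> \<le> B'"
    "\<And>x y. x \<in> S \<Longrightarrow> y \<in> S \<Longrightarrow> \<bar>f x - f y\<bar> \<le> L * dist x y"
    "\<And>x y. x \<in> S \<Longrightarrow> y \<in> S \<Longrightarrow> \<bar>g x - g y\<bar> \<le> L' * dist x y"
    using assms unfolding lipb_def by metis
  have "\<bar>f x * g x - f y * g y\<bar> \<le> (B * L' + L * B') * dist x y" if "x \<in> S" "y \<in> S" for x y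
  proof -
    have "f x * g x - f y * g y = f x * (g x - g y) + (f x - f y) * g y" by (simp add: algebra_simps)
    also have "\<bar>\<dots>\<bar> \<le> \<bar>f x\<bar> * \<bar>g x - g y\<bar> + \<bar>f x - f y\<bar> * \<bar>g y\<bar>"
      by (metis abs_mult abs_triangle_ineq)
    also have "\<dots> \<le> B * (L' * dist x y) + (L * dist x y) * B'"
      using *(1)[OF that(1)] *(2)[OF that(2)] *(3,4)[OF that] by (intro add_mono mult_mono) auto
    finally show ?thesis by (simp add: algebra_simps)
  qed
  moreover have "\<bar>f x * g x\<bar> \<le> B * B'" if "x \<in> S" for x
    using *(1,2)[OF that] by (auto simp: abs_mult intro!: mult_mono)
  ultimately show ?thesis unfolding lipb_def by blast
qed

lemma lipb_fst: "bounded S \<Longrightarrow> lipb S (fst :: real \<times> real \<Rightarrow> real)"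
  and lipb_snd: "bounded S \<Longrightarrow> lipb S (snd :: real \<times> real \<Rightarrow> real)"
proof -
  assume "bounded S"
  then obtain B where B: "\<And>x. x \<in> S \<Longrightarrow> norm x \<le> B" by (auto simp: bounded_iff)
  have "\<bar>fst x\<bar> \<le> norm x" "\<bar>snd x\<bar> \<le> norm x" for x :: "real \<times> real"
    using norm_fst_le[of "fst x" "snd x"] norm_snd_le[of "snd x" "fst x"] by auto
  moreover have "\<bar>fst x - fst y\<bar> \<le> dist x y" "\<bar>snd x - snd y\<bar> \<le> dist x y" for x y :: "real \<times> real"
    using dist_fst_le[of x y] dist_snd_le[of x y] by (auto simp: dist_real_def)
  ultimately show "lipb S fst" "lipb S snd"
    unfolding lipb_def using B
    by (metis (no_types, opaque_lifting) mult_1 order_trans)+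
qed

lemma lipb_kf:
  assumes "bounded S"
  shows "lipb S (\<lambda>z. fst (kf c z))" "lipb S (\<lambda>z. snd (kf c z))"
  unfolding kf_def qv_def diff_conv_add_uminus fst_conv snd_conv
  by (intro lipb_add lipb_mult lipb_const lipb_fst lipb_snd assms)+

lemma kf_lipschitz:
  assumes "bounded S"
  obtains L B where "\<And>x. x \<in> S \<Longrightarrow> norm (kf c x) \<le> B"
    "\<And>x y. x \<in> S \<Longrightarrow> y \<in> S \<Longrightarrow> norm (kf c x - kf c y) \<le> L * norm (x - y)"
proof -
  obtain L1 B1 L2 B2 where *:
    "\<And>x. x \<in> S \<Longrightarrow> \<bar>fst (kf c x)\<bar> \<le> B1" "\<And>x. x \<in> S \<Longrightarrow> \<bar>snd (kf c x)\<bar> \<le> B2"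
    "\<And>x y. x \<in> S \<Longrightarrow> y \<in> S \<Longrightarrow> \<bar>fst (kf c x) - fst (kf c y)\<bar> \<le> L1 * dist x y"
    "\<And>x y. x \<in> S \<Longrightarrow> y \<in> S \<Longrightarrow> \<bar>snd (kf c x) - snd (kf c y)\<bar> \<le> L2 * dist x y"
    using lipb_kf[OF assms, of c] unfolding lipb_def by metis
  have n: "norm z \<le> \<bar>fst z\<bar> + \<bar>snd z\<bar>" for z :: "real \<times> real"
    using norm_Pair_le[of "fst z" "snd z"] by simp
  show ?thesis
  proof
    show "norm (kf c x) \<le> B1 + B2" if "x \<in> S" for x
      using *(1,2)[OF that] n[of "kf c x"] by linarith
    show "norm (kf c x - kf c y) \<le> (L1 + L2) * norm (x - y)" if "x \<in> S" "y \<in> S" for x y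
      using *(3,4)[OF that] n[of "kf c x - kf c y"] by (simp add: dist_norm algebra_simps)
  qed
qed

lemma solution_unique:
  assumes "bounded S"
    and "\<And>t. t \<in> {a..b} \<Longrightarrow> (\<phi> has_vector_derivative kf c (\<phi> t)) (at t within {a..b})"
    and "\<And>t. t \<in> {a..b} \<Longrightarrow> (\<psi> has_vector_derivative kf c (\<psi> t)) (at t within {a..b})"
    and "\<phi> ` {a..b} \<subseteq> S" "\<psi> ` {a..b} \<subseteq> S" "s \<in> {a..b}" "t \<in> {a..b}" "\<phi> s = \<psi> s"
  shows "\<phi> t = \<psi> t"
proof -
  obtain L B where L: "\<And>x y. x \<in> S \<Longrightarrow> y \<in> S \<Longrightarrow> norm (kf c x - kf c y) \<le> L * norm (x - y)"
    using kf_lipschitz[OF assms(1)] by metis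
  have "norm (\<phi> t - \<psi> t) \<le> exp (L * \<bar>t - s\<bar>) * norm (\<phi> s - \<psi> s)"
    by (rule gronwall[of a b "\<lambda>t. \<phi> t - \<psi> t" "\<lambda>t. kf c (\<phi> t) - kf c (\<psi> t)"])
      (use assms in \<open>auto intro!: has_vector_derivative_diff L\<close>)
  then show ?thesis using assms(8) by simp
qed

lemma orbit_unique:
  assumes "orbit c \<phi>" "orbit c \<psi>" "\<phi> s = \<psi> s"
  shows "\<phi> t = \<psi> t"
proof (rule solution_unique[of usq "min s t" "max s t" \<phi> c])
  show "bounded usq" unfolding usq_def by (intro bounded_Times) auto
qed (use assms in \<open>auto simp: orbit_def has_vector_derivative_at_within\<close>)

lemma zero_preserved:
  fixes w :: "real \<Rightarrow> real"
  assumes der: "\<And>t. t \<in> {a..b} \<Longrightarrow> (w has_vector_derivative w' t) (at t within {a..b})"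
    and bd: "\<And>t. t \<in> {a..b} \<Longrightarrow> \<bar>w' t\<bar> \<le> C * \<bar>w t\<bar>"
    and "s \<in> {a..b}" "t \<in> {a..b}" "w s = 0"
  shows "w t = 0"
  using gronwall[OF der, of C s t] bd assms by simp

text \<open>A change of sign would give a zero in between, and by Gronwall a zero of
  \<open>w\<close> at one time forces \<open>w = 0\<close> at all times.\<close>

lemma sign_preserved:
  fixes w :: "real \<Rightarrow> real"
  assumes der: "\<And>t. (w has_vector_derivative w' t) (at t)"
    and bd: "\<And>t. \<bar>w' t\<bar> \<le> C * \<bar>w t\<bar>"
    and "w s > 0"
  shows "w t > 0"
proof (rule ccontr)
  assume t: "\<not> w t > 0"
  have c: "continuous_on {min s t..max s t} w"
    using der by (meson continuous_at_imp_continuous_on has_vector_derivative_continuous)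
  have "\<exists>r\<in>{min s t..max s t}. w r = 0"
  proof (cases "s \<le> t")
    case True
    then show ?thesis using IVT2'[of w t 0 s] c t assms(3) by (force simp: min_def max_def)
  next
    case False
    then show ?thesis using IVT'[of w t 0 s] c t assms(3) by (force simp: min_def max_def)
  qed
  then obtain r where r: "r \<in> {min s t..max s t}" "w r = 0" by blast
  have "w s = 0"
    by (rule zero_preserved[of "min s t" "max s t" w w' C r])
      (use der bd r in \<open>auto intro: has_vector_derivative_at_within\<close>)
  then show False using assms(3) by simp
qed

definition clp :: "real \<Rightarrow> real" where "clp x = min 1 (max 0 x)"

lemma clp: "0 \<le> clp x" "clp x \<le> 1" "\<bar>clp x - clp y\<bar> \<le> \<bar>x - y\<bar>" "\<bar>clp x\<bar> \<le> \<bar>x\<bar>" "\<bar>1 - clp x\<bar> \<le> \<bar>1 - x\<bar>"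
  "0 \<le> x \<Longrightarrow> x \<le> 1 \<Longrightarrow> clp x = x"
  by (auto simp: clp_def min_def max_def)

text \<open>Composing the field with the projection \<open>g\<close> onto the closed square makes it
  bounded and globally Lipschitz. The global solution never reaches an edge, because it cannot lose
  the sign of its distance to an edge, and inside the square \<open>g\<close> is the
  identity.\<close>

lemma orbit_exists:
  assumes "z \<in> usq"
  obtains \<phi> where "orbit c \<phi>" "\<phi> 0 = z"
proof -
  let ?S = "{0..1} \<times> {0..1} :: (real \<times> real) set"
  have bS: "bounded ?S" by (intro bounded_Times) auto
  obtain L B where L: "\<And>x. x \<in> ?S \<Longrightarrow> norm (kf c x) \<le> B"
    "\<And>x y. x \<in> ?S \<Longrightarrow> y \<in> ?S \<Longrightarrow> norm (kf c x - kf c y) \<le> L * norm (x - y)"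
    using kf_lipschitz[OF bS] by metis
  define g where "g z = (clp (fst z), clp (snd z))" for z :: "real \<times> real"
  have gS: "g z \<in> ?S" for z using clp by (auto simp: g_def)
  have gl: "norm (g x - g y) \<le> norm (x - y)" for x y
  proof -
    have "sqrt ((fst (g x - g y))\<^sup>2 + (snd (g x - g y))\<^sup>2) \<le> sqrt ((fst (x - y))\<^sup>2 + (snd (x - y))\<^sup>2)"
      using clp(3)[of "fst x" "fst y"] clp(3)[of "snd x" "snd y"]
      by (intro real_sqrt_le_mono add_mono) (simp_all add: g_def flip: abs_le_square_iff)
    then show ?thesis by (simp only: norm_prod_def real_norm_def power2_abs)
  qed
  have ll: "norm (kf c (g x) - kf c (g y)) \<le> max L 0 * norm (x - y)" for x y
  proof -
    have "norm (kf c (g x) - kf c (g y)) \<le> L * norm (g x - g y)" by (rule L(2)[OF gS gS])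
    also have "\<dots> \<le> max L 0 * norm (g x - g y)" by (intro mult_right_mono) auto
    also have "\<dots> \<le> max L 0 * norm (x - y)" by (intro mult_left_mono gl) auto
    finally show ?thesis .
  qed
  have "continuous_on UNIV (\<lambda>x. kf c (g x))"
    by (rule lipschitz_on_continuous_on[of "max L 0"]) (auto simp: lipschitz_on_def dist_norm ll)
  then have cont: "continuous_on UNIV (\<lambda>(t::real, x). kf c (g x))"
    using continuous_on_compose2[of UNIV "\<lambda>x. kf c (g x)" UNIV snd] by (auto simp: case_prod_beta continuous_on_snd)
  obtain \<phi> where \<phi>: "\<phi> 0 = z" "\<And>t. (\<phi> has_vector_derivative kf c (g (\<phi> t))) (at t)"
    by (rule picard_lindelof_global[OF cont ll L(1)[OF gS], of 0 z]) blast
  obtain Bf where Bf: "\<And>z. z \<in> ?S \<Longrightarrow> \<bar>qv (fst c) (fst z) (snd z)\<bar> \<le> Bf"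
      "\<And>z. z \<in> ?S \<Longrightarrow> \<bar>qv (snd c) (fst z) (snd z)\<bar> \<le> Bf"
  proof -
    have "lipb ?S (\<lambda>z. qv q (fst z) (snd z))" for q
      unfolding qv_def by (intro lipb_add lipb_mult lipb_const lipb_fst lipb_snd bS)
    from this[of "fst c"] this[of "snd c"] obtain B1 B2 where
      "\<And>z. z \<in> ?S \<Longrightarrow> \<bar>qv (fst c) (fst z) (snd z)\<bar> \<le> B1"
      "\<And>z. z \<in> ?S \<Longrightarrow> \<bar>qv (snd c) (fst z) (snd z)\<bar> \<le> B2" unfolding lipb_def by metis
    then show ?thesis by (intro that[of "max B1 B2"]) (auto simp: le_max_iff_disj)
  qed
  have d1: "((\<lambda>t. fst (\<phi> t)) has_vector_derivative fst (kf c (g (\<phi> t)))) (at t)"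
    and d2: "((\<lambda>t. snd (\<phi> t)) has_vector_derivative snd (kf c (g (\<phi> t)))) (at t)" for t
    by (intro bounded_linear.has_vector_derivative[OF bounded_linear_fst \<phi>(2)]
        bounded_linear.has_vector_derivative[OF bounded_linear_snd \<phi>(2)])+
  have d1': "((\<lambda>t. 1 - fst (\<phi> t)) has_vector_derivative - fst (kf c (g (\<phi> t)))) (at t)"
    and d2': "((\<lambda>t. 1 - snd (\<phi> t)) has_vector_derivative - snd (kf c (g (\<phi> t)))) (at t)" for t
    using has_vector_derivative_diff[OF has_vector_derivative_const d1, of 1 t]
      has_vector_derivative_diff[OF has_vector_derivative_const d2, of 1 t] by simp_all
  \<comment> \<open>The clamped factor is bounded by the distance of the unclamped coordinate from
    either edge, which is the estimate that \<open>sign_preserved\<close> requires for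
    \<open>x\<close>, \<open>1 - x\<close>, \<open>y\<close> and \<open>1 - y\<close>.\<close>
  have e: "\<bar>clp a * (clp a - 1) * q\<bar> \<le> Bf * \<bar>a\<bar>" "\<bar>clp a * (clp a - 1) * q\<bar> \<le> Bf * \<bar>1 - a\<bar>"
    if "\<bar>q\<bar> \<le> Bf" for a q
  proof -
    have "\<bar>clp a\<bar> * \<bar>clp a - 1\<bar> * \<bar>q\<bar> \<le> \<bar>a\<bar> * 1 * Bf"
      using clp[of a] that by (intro mult_mono) auto
    then show "\<bar>clp a * (clp a - 1) * q\<bar> \<le> Bf * \<bar>a\<bar>" by (simp add: abs_mult mult_ac)
    have "\<bar>clp a\<bar> * \<bar>clp a - 1\<bar> * \<bar>q\<bar> \<le> 1 * \<bar>1 - a\<bar> * Bf"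
      using clp[of a] that by (intro mult_mono) auto
    then show "\<bar>clp a * (clp a - 1) * q\<bar> \<le> Bf * \<bar>1 - a\<bar>" by (simp add: abs_mult mult_ac)
  qed
  have k: "fst (kf c (g w)) = clp (fst w) * (clp (fst w) - 1) * qv (fst c) (fst (g w)) (snd (g w))"
    "snd (kf c (g w)) = clp (snd w) * (clp (snd w) - 1) * qv (snd c) (fst (g w)) (snd (g w))" for w
    by (simp_all add: kf_def g_def)
  have z: "fst z > 0" "1 - fst z > 0" "snd z > 0" "1 - snd z > 0" using assms by (auto simp: usq_def)
  have "fst (\<phi> t) > 0" for t
    by (rule sign_preserved[OF d1, of Bf 0]) (use z \<phi>(1) in \<open>auto simp: k intro!: e Bf gS\<close>)
  moreover have "1 - fst (\<phi> t) > 0" for t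
    by (rule sign_preserved[OF d1', of Bf 0]) (use z \<phi>(1) in \<open>auto simp: k intro!: e Bf gS\<close>)
  moreover have "snd (\<phi> t) > 0" for t
    by (rule sign_preserved[OF d2, of Bf 0]) (use z \<phi>(1) in \<open>auto simp: k intro!: e Bf gS\<close>)
  moreover have "1 - snd (\<phi> t) > 0" for t
    by (rule sign_preserved[OF d2', of Bf 0]) (use z \<phi>(1) in \<open>auto simp: k intro!: e Bf gS\<close>)
  ultimately have sq: "\<phi> t \<in> usq" for t by (simp add: usq_def mem_Times_iff)
  have "g (\<phi> t) = \<phi> t" for t
    using sq[of t] by (auto simp: usq_def g_def mem_Times_iff intro!: prod_eqI clp(6) less_imp_le)
  then have "orbit c \<phi>" using \<phi>(2) sq by (auto simp: orbit_def)
  then show ?thesis using that \<phi>(1) by blast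
qed

section \<open>Passage around a corner\<close>

text \<open>Along orbits \<open>ln x\<close> has derivative \<open>Aq\<close> and
  \<open>ln y\<close> has derivative \<open>- Bq\<close> (\<open>orbit_ln\<close>). For
  \<open>good\<close> fields \<open>Aq c 0 0\<close> and \<open>- Bq c 0 0\<close> are the unstable
  and the stable eigenvalue at the corner \<open>(0, 0)\<close>.\<close>

definition Aq :: "quad \<times> quad \<Rightarrow> real \<Rightarrow> real \<Rightarrow> real" where
  "Aq c x y = (1 - x) * (- qv (fst c) x y)"

definition Bq :: "quad \<times> quad \<Rightarrow> real \<Rightarrow> real \<Rightarrow> real" where
  "Bq c x y = (1 - y) * qv (snd c) x y"

definition om :: "quad \<times> quad \<Rightarrow> real \<Rightarrow> real \<Rightarrow> real" where
  "om c x y = x * Aq c x y * (1/2 - y) + y * Bq c x y * (1/2 - x)"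

lemma kf_eq: "fst (kf c z) = fst z * Aq c (fst z) (snd z)" "snd (kf c z) = - (snd z * Bq c (fst z) (snd z))"
  by (simp_all add: kf_def Aq_def Bq_def algebra_simps)

text \<open>An L-shaped strip along the two half edges that meet at \<open>(0, 0)\<close>. Seen in
  the four rotated frames, such strips cover a whole collar of the boundary
  (\<open>collar_Lreg\<close>).\<close>

definition Lreg :: "real \<Rightarrow> (real \<times> real) set" where
  "Lreg d = {z. 0 \<le> fst z \<and> fst z \<le> 1/2 \<and> 0 \<le> snd z \<and> snd z \<le> 1/2 \<and> (fst z \<le> d \<or> snd z \<le> d)}"

text \<open>Up to a positive factor, \<open>om\<close> is the derivative along orbits of an angle that varies by a bounded
  amount in \<open>Lreg d\<close>. So the multiples of \<open>om\<close> in the following inequalities are negligible when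
  logarithms of coordinates are integrated along an orbit, but away from the corner they dominate.\<close>

definition stat :: "quad \<times> quad \<Rightarrow> real \<Rightarrow> real \<Rightarrow> real \<Rightarrow> bool" where
  "stat c d M k \<longleftrightarrow> 0 < d \<and> d \<le> 1/4 \<and> 0 \<le> M \<and> 0 < k \<and>
     (\<forall>x y. (x, y) \<in> Lreg d \<longrightarrow> (0 < x \<and> 0 < y \<longrightarrow> om c x y > 0) \<and>
        k - M * om c x y \<le> Aq c x y \<and> (x \<le> d \<longrightarrow> Bq c x y > 0))"

text \<open>Up to a bounded factor, \<open>x powr a1 * y\<close> does not increase and
  \<open>x powr a2 * y\<close> does not decrease along orbits in \<open>Lreg d\<close>. For a linear
  saddle \<open>x powr ratio * y\<close> is a first integral; \<open>a1\<close> and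
  \<open>a2\<close> will enclose the ratio.\<close>

definition slope :: "quad \<times> quad \<Rightarrow> real \<Rightarrow> real \<Rightarrow> real \<Rightarrow> real \<Rightarrow> bool" where
  "slope c d M a1 a2 \<longleftrightarrow> (\<forall>x y. (x, y) \<in> Lreg d \<longrightarrow>
     a1 * Aq c x y - Bq c x y \<le> M * om c x y \<and> - (M * om c x y) \<le> a2 * Aq c x y - Bq c x y)"

text \<open>These signs make the flow run counterclockwise along all four edges, with no zero except
  the corners, which become hyperbolic saddles.\<close>

definition good :: "quad \<times> quad \<Rightarrow> bool" where
  "good c \<longleftrightarrow> (\<forall>t::real. 0 \<le> t \<and> t \<le> 1 \<longrightarrow>
     qv (fst c) t 0 < 0 \<and> qv (fst c) t 1 > 0 \<and> qv (snd c) 0 t > 0 \<and> qv (snd c) 1 t < 0)"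

text \<open>The hyperbolicity ratio of the corner \<open>(0, 0)\<close>: the modulus of the stable
  eigenvalue divided by the unstable one, that is \<open>Bq c 0 0 / Aq c 0 0\<close>.\<close>

definition ratio :: "quad \<times> quad \<Rightarrow> real" where
  "ratio c = - qv (snd c) 0 0 / qv (fst c) 0 0"

lemma good_rotc: "good c \<Longrightarrow> good (rotc c)"
  unfolding good_def rotc_def
  by (auto simp: qv_qrot qv_uminus)

text \<open>A strict inequality on the compact set \<open>{p0} \<times> K\<close> persists, with a
  margin, on a neighbourhood of fixed radius. This makes later estimates uniform in the parameter as
  well as in the point.\<close>

lemma tube:
  fixes g :: "'p::metric_space \<Rightarrow> 'b::metric_space \<Rightarrow> real"
  assumes "compact K" "continuous_on UNIV (\<lambda>u. g (fst u) (snd u))" "\<And>z. z \<in> K \<Longrightarrow> g p0 z > 0"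
  shows "\<exists>d m. d > 0 \<and> m > 0 \<and> (\<forall>p z. \<forall>k\<in>K. dist p p0 < d \<longrightarrow> dist z k < d \<longrightarrow> g p z > m)"
proof (cases "K = {}")
  case True
  then show ?thesis by (auto intro: exI[of _ 1])
next
  case False
  let ?g = "\<lambda>u. g (fst u) (snd u)"
  have cK: "compact ({p0} \<times> K)" using assms(1) by (intro compact_Times) auto
  obtain q where q: "q \<in> {p0} \<times> K" "\<And>r. r \<in> {p0} \<times> K \<Longrightarrow> ?g q \<le> ?g r"
    using continuous_attains_inf[OF cK _ continuous_on_subset[OF assms(2)]] False by blast
  define m where "m = ?g q / 2"
  have m: "m > 0" using q assms(3) by (auto simp: m_def)
  have "open (?g -` {m<..})"
    using assms(2) by (intro open_vimage) auto
  moreover have "{p0} \<times> K \<subseteq> ?g -` {m<..}"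
    using q(2) m by (force simp: m_def)
  ultimately obtain e where e: "e > 0" "(\<Union>x\<in>{p0} \<times> K. ball x e) \<subseteq> ?g -` {m<..}"
    using compact_subset_open_imp_ball_epsilon_subset[OF cK] by metis
  have "g p z > m" if *: "dist p p0 < e/2" "k \<in> K" "dist z k < e/2" for p z k
  proof -
    have "dist (p0, k) (p, z) \<le> dist p0 p + dist k z"
      unfolding dist_Pair_Pair by (rule sqrt_sum_squares_le_sum) auto
    also have "\<dots> < e" using * by (simp add: dist_commute)
    finally have "(p, z) \<in> ball (p0, k) e" by simp
    moreover have "(p0, k) \<in> {p0} \<times> K" using * by simp
    ultimately have "(p, z) \<in> (\<Union>x\<in>{p0} \<times> K. ball x e)" by blast
    then have "(p, z) \<in> ?g -` {m<..}" using e(2) by blast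
    then show "g p z > m" by simp
  qed
  then show ?thesis using e(1) m by (intro exI[of _ "e/2"] exI[of _ m]) auto
qed

lemma tube_point:
  fixes g :: "'p::metric_space \<Rightarrow> 'b::metric_space \<Rightarrow> real"
  assumes "continuous_on UNIV (\<lambda>u. g (fst u) (snd u))" "g p0 k > 0"
  shows "\<exists>d m. d > 0 \<and> m > 0 \<and> (\<forall>p z. dist p p0 < d \<longrightarrow> dist z k < d \<longrightarrow> g p z > m)"
  using tube[of "{k}" g p0] assms by simp

lemma continuous_on_Aq: "continuous_on S (\<lambda>z. Aq (fst z) (fst (snd z)) (snd (snd z)))"
  and continuous_on_Bq: "continuous_on S (\<lambda>z. Bq (fst z) (fst (snd z)) (snd (snd z)))"
  and continuous_on_om: "continuous_on S (\<lambda>z. om (fst z) (fst (snd z)) (snd (snd z)))"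
  unfolding om_def Aq_def Bq_def by (auto intro!: continuous_intros)

text \<open>Uniformly near \<open>c0\<close>: away from the corner \<open>om\<close> is bounded below on the edges, and at the
  corner the inequalities hold with \<open>M = 0\<close>.\<close>

lemma stat_slope_exists:
  assumes "good c0" "0 < a1" "a1 < ratio c0" "ratio c0 < a2"
  obtains d0 M k where "0 < d0" "\<And>d. 0 < d \<Longrightarrow> d \<le> d0 \<Longrightarrow> \<forall>\<^sub>F c in nhds c0. stat c d M k \<and> slope c d M a1 a2"
proof -
  have f0: "qv (fst c0) (0::real) 0 < 0" and g0: "qv (snd c0) (0::real) 0 > 0"
    using assms(1) by (auto simp: good_def)
  have A0: "Aq c0 0 0 > 0" and B0: "Bq c0 0 0 > 0" using f0 g0 by (auto simp: Aq_def Bq_def)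
  have s1: "Bq c0 0 0 - a1 * Aq c0 0 0 > 0" and s2: "a2 * Aq c0 0 0 - Bq c0 0 0 > 0"
    using assms(3,4) f0 by (simp_all add: ratio_def Aq_def Bq_def field_simps)
  note cont = continuous_on_Aq continuous_on_Bq continuous_on_om
  have "\<exists>d m. d > 0 \<and> m > 0 \<and> (\<forall>c z. dist c c0 < d \<longrightarrow> dist z (0,0) < d \<longrightarrow> Aq c (fst z) (snd z) > m)"
    by (rule tube_point) (use A0 in \<open>auto intro!: continuous_intros cont\<close>)
  then obtain d1 m1 where d1: "d1 > 0" "m1 > 0"
    "\<And>c z. dist c c0 < d1 \<Longrightarrow> dist z (0,0) < d1 \<Longrightarrow> m1 < Aq c (fst z) (snd z)" by metis
  have "\<exists>d m. d > 0 \<and> m > 0 \<and> (\<forall>c z. dist c c0 < d \<longrightarrow> dist z (0,0) < d \<longrightarrow> Bq c (fst z) (snd z) > m)"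
    by (rule tube_point) (use B0 in \<open>auto intro!: continuous_intros cont\<close>)
  then obtain d2 m2 where d2: "d2 > 0" "m2 > 0"
    "\<And>c z. dist c c0 < d2 \<Longrightarrow> dist z (0,0) < d2 \<Longrightarrow> m2 < Bq c (fst z) (snd z)" by metis
  have "\<exists>d m. d > 0 \<and> m > 0 \<and> (\<forall>c z. dist c c0 < d \<longrightarrow> dist z (0,0) < d \<longrightarrow> Bq c (fst z) (snd z) - a1 * Aq c (fst z) (snd z) > m)"
    by (rule tube_point) (use s1 in \<open>auto intro!: continuous_intros cont\<close>)
  then obtain d3 m3 where d3: "d3 > 0" "m3 > 0"
    "\<And>c z. dist c c0 < d3 \<Longrightarrow> dist z (0,0) < d3 \<Longrightarrow> m3 < Bq c (fst z) (snd z) - a1 * Aq c (fst z) (snd z)" by metis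
  have "\<exists>d m. d > 0 \<and> m > 0 \<and> (\<forall>c z. dist c c0 < d \<longrightarrow> dist z (0,0) < d \<longrightarrow> a2 * Aq c (fst z) (snd z) - Bq c (fst z) (snd z) > m)"
    by (rule tube_point) (use s2 in \<open>auto intro!: continuous_intros cont\<close>)
  then obtain d4 m4 where d4: "d4 > 0" "m4 > 0"
    "\<And>c z. dist c c0 < d4 \<Longrightarrow> dist z (0,0) < d4 \<Longrightarrow> m4 < a2 * Aq c (fst z) (snd z) - Bq c (fst z) (snd z)" by metis
  have "Bq c0 0 y > 0" if "0 \<le> y" "y \<le> 1/2" for y
    using assms(1) that by (auto simp: good_def Bq_def)
  then have T5: "\<exists>d m. d > 0 \<and> m > 0 \<and> (\<forall>c z. \<forall>k\<in>{0} \<times> {0..1/2}. dist c c0 < d \<longrightarrow> dist z k < d \<longrightarrow> Bq c (fst z) (snd z) > m)"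
    by (intro tube cont compact_Times) auto
  obtain d5 m5 where d5: "d5 > 0" "m5 > 0"
    "\<And>c z k. dist c c0 < d5 \<Longrightarrow> k \<in> {0} \<times> {0..1/2} \<Longrightarrow> dist z k < d5 \<Longrightarrow> m5 < Bq c (fst z) (snd z)" using T5 by metis
  define e where "e = Min {d1, d2, d3, d4, 1/4} / 4"
  have e: "0 < e" "e \<le> 1/16" "4 * e \<le> d1" "4 * e \<le> d2" "4 * e \<le> d3" "4 * e \<le> d4"
    using d1 d2 d3 d4 by (auto simp: e_def)
  \<comment> \<open>The half edges without the corner: there one of the two terms of
    \<open>om\<close> vanishes and the other is positive.\<close>
  define K where "K = {e..1/2} \<times> {0} \<union> {0} \<times> {e..1/2::real}"
  have cK: "compact K" unfolding K_def by (intro compact_Un compact_Times) auto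
  have oK: "om c0 (fst z) (snd z) > 0" if "z \<in> K" for z
    using assms(1) that e(1) unfolding K_def
    by (auto simp: good_def Bq_def Aq_def om_def mult_pos_neg mult_neg_pos intro!: mult_pos_pos)
  have T6: "\<exists>d m. d > 0 \<and> m > 0 \<and> (\<forall>c z. \<forall>k\<in>K. dist c c0 < d \<longrightarrow> dist z k < d \<longrightarrow> om c (fst z) (snd z) > m)"
    using oK by (intro tube cont cK) auto
  obtain d6 m6 where d6: "d6 > 0" "m6 > 0"
    "\<And>c z k. dist c c0 < d6 \<Longrightarrow> k \<in> K \<Longrightarrow> dist z k < d6 \<Longrightarrow> m6 < om c (fst z) (snd z)" using T6 by metis
  obtain N where N: "\<And>z. z \<in> {0..1/2} \<times> {0..1/2} \<Longrightarrow> \<bar>Aq c0 (fst z) (snd z)\<bar> + \<bar>Bq c0 (fst z) (snd z)\<bar> \<le> N"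
  proof -
    have "compact ((\<lambda>z. \<bar>Aq c0 (fst z) (snd z)\<bar> + \<bar>Bq c0 (fst z) (snd z)\<bar>) ` ({0..1/2} \<times> {0..1/2}))"
      unfolding Aq_def Bq_def
      by (intro compact_continuous_image compact_Times) (auto intro!: continuous_intros)
    then have "bounded ((\<lambda>z. \<bar>Aq c0 (fst z) (snd z)\<bar> + \<bar>Bq c0 (fst z) (snd z)\<bar>) ` ({0..1/2} \<times> {0..1/2}))"
      by (rule compact_imp_bounded)
    then show ?thesis using that unfolding bounded_iff by (force simp: abs_le_iff)
  qed
  have T7: "\<exists>d m. d > 0 \<and> m > 0 \<and> (\<forall>c z. \<forall>k\<in>{0..1/2} \<times> {0..1/2}. dist c c0 < d \<longrightarrow> dist z k < d \<longrightarrow> (N + 1) - (\<bar>Aq c (fst z) (snd z)\<bar> + \<bar>Bq c (fst z) (snd z)\<bar>) > m)"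
    proof (intro tube continuous_intros cont compact_Times)
    show "0 < (N + 1) - (\<bar>Aq c0 (fst z) (snd z)\<bar> + \<bar>Bq c0 (fst z) (snd z)\<bar>)" if "z \<in> {0..1/2} \<times> {0..1/2}" for z
      using N[OF that] by simp
  qed auto
  obtain d7 m7 where d7: "d7 > 0" "m7 > 0"
    "\<And>c z k. dist c c0 < d7 \<Longrightarrow> k \<in> {0..1/2} \<times> {0..1/2} \<Longrightarrow> dist z k < d7 \<Longrightarrow> m7 < (N + 1) - (\<bar>Aq c (fst z) (snd z)\<bar> + \<bar>Bq c (fst z) (snd z)\<bar>)" using T7 by metis
  have N0: "N \<ge> 0" using N[of "(0,0)"] by auto
  define k where "k = m1"
  \<comment> \<open>Off the corner \<open>om > m6\<close>, while the moduli of \<open>Aq\<close> and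
    \<open>Bq\<close> add up to at most \<open>N + 1\<close>. Hence \<open>M * om\<close> outweighs
    all other terms of the inequalities to be shown.\<close>
  define M where "M = (k + (N + 1) * (2 + \<bar>a1\<bar> + \<bar>a2\<bar>)) / m6"
  have M0: "M \<ge> 0" using d6 d1 N0 by (auto simp: M_def k_def)
  define d0 where "d0 = Min {e, d5/2, d6/2}"
  have d0: "0 < d0" "d0 \<le> e" "d0 < d5" "d0 < d6" using e d5 d6 by (auto simp: d0_def)
  show ?thesis
  proof (rule that[OF d0(1), of M k])
    fix d assume d: "0 < d" "d \<le> d0"
    show "\<forall>\<^sub>F c in nhds c0. stat c d M k \<and> slope c d M a1 a2"
      unfolding eventually_nhds_metric
    proof (intro exI conjI allI impI)
      show "Min {d1, d2, d3, d4, d5, d6, d7} > 0" using d1 d2 d3 d4 d5 d6 d7 by simp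
      fix c assume "dist c c0 < Min {d1, d2, d3, d4, d5, d6, d7}"
      then have c: "dist c c0 < d1" "dist c c0 < d2" "dist c c0 < d3" "dist c c0 < d4"
        "dist c c0 < d5" "dist c c0 < d6" "dist c c0 < d7" by auto
      have main: "(0 < x \<and> 0 < y \<longrightarrow> om c x y > 0) \<and> k - M * om c x y \<le> Aq c x y \<and> (x \<le> d \<longrightarrow> Bq c x y > 0) \<and>
        a1 * Aq c x y - Bq c x y \<le> M * om c x y \<and> - (M * om c x y) \<le> a2 * Aq c x y - Bq c x y"
        if xy: "(x, y) \<in> Lreg d" for x y
      proof -
        have r: "0 \<le> x" "x \<le> 1/2" "0 \<le> y" "y \<le> 1/2" "x \<le> d \<or> y \<le> d" using xy by (auto simp: Lreg_def)
        have B: "Bq c x y > 0" if "x \<le> d"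
        proof -
          have "dist (x, y) (0, y) < d5" using that r d d0 by (simp add: dist_Pair_Pair dist_real_def)
          then show ?thesis using d5(3)[OF c(5), of "(0, y)" "(x, y)"] r d5(2) by auto
        qed
        show ?thesis
        proof (cases "x \<le> e \<and> y \<le> e")
          case True
          have "dist (x, y) (0, 0) \<le> \<bar>x\<bar> + \<bar>y\<bar>"
            unfolding dist_Pair_Pair dist_real_def by (simp add: sqrt_sum_squares_le_sum_abs)
          then have nr: "dist (x, y) (0, 0) < 4 * e" using True r e(1) by linarith
          have *: "Aq c x y > m1" "Bq c x y > m2" "Bq c x y - a1 * Aq c x y > m3" "a2 * Aq c x y - Bq c x y > m4"
            using d1(3)[OF c(1), of "(x,y)"] d2(3)[OF c(2), of "(x,y)"] d3(3)[OF c(3), of "(x,y)"]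
              d4(3)[OF c(4), of "(x,y)"] nr e by auto
          have A: "Aq c x y > 0" "Bq c x y > 0" using * d1 d2 by auto
          have y2: "1/2 - y > 0" "1/2 - x > 0" using True e by auto
          have o: "om c x y \<ge> 0" unfolding om_def using A y2 r by (intro add_nonneg_nonneg mult_nonneg_nonneg) auto
          have "0 < om c x y" if "0 < x" "0 < y"
            unfolding om_def using A y2 that by (intro add_pos_pos mult_pos_pos) auto
          then show ?thesis using * B d3(2) d4(2) mult_nonneg_nonneg[OF M0 o] unfolding k_def by argo
        next
          case False
          define z0 where "z0 = (if x \<le> d then (0, y) else (x, 0))"
          have "z0 \<in> K" using False r d d0 e(1) by (auto simp: z0_def K_def)
          moreover have "dist (x, y) z0 < d6" using r d d0 by (auto simp: z0_def dist_Pair_Pair dist_real_def)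
          ultimately have o: "om c x y > m6" using d6(3)[OF c(6), of z0 "(x, y)"] by simp
          have ab: "\<bar>Aq c x y\<bar> + \<bar>Bq c x y\<bar> \<le> N + 1"
            using d7(3)[OF c(7), of "(x,y)" "(x,y)"] d7(1,2) r by auto
          have "M * m6 \<le> M * om c x y" using o M0 by (intro mult_left_mono) auto
          moreover have "M * m6 = k + (N + 1) * (2 + \<bar>a1\<bar> + \<bar>a2\<bar>)" using d6 by (simp add: M_def)
          ultimately have Mo: "M * om c x y \<ge> k + (N + 1) * (2 + \<bar>a1\<bar> + \<bar>a2\<bar>)" by simp
          have "\<bar>a1 * Aq c x y\<bar> \<le> \<bar>a1\<bar> * (N + 1)" "\<bar>a2 * Aq c x y\<bar> \<le> \<bar>a2\<bar> * (N + 1)"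
            using ab unfolding abs_mult by (intro mult_left_mono; simp)+
          moreover have "(N + 1) * (2 + \<bar>a1\<bar> + \<bar>a2\<bar>) = 2 * (N + 1) + \<bar>a1\<bar> * (N + 1) + \<bar>a2\<bar> * (N + 1)"
            by (simp add: algebra_simps)
          moreover have "\<bar>a1\<bar> * (N + 1) \<ge> 0" "\<bar>a2\<bar> * (N + 1) \<ge> 0" using N0 by auto
          moreover have "k > 0" using d1 by (simp add: k_def)
          moreover have "om c x y > 0" using o d6 by simp
          ultimately show ?thesis using B ab Mo N0 by (smt (verit))
        qed
      qed
      have "d \<le> 1/4" using d d0 e by simp
      then show "stat c d M k" "slope c d M a1 a2"
        unfolding stat_def slope_def using main d M0 d1(2) by (auto simp: k_def)
    qed
  qed
qed

text \<open>Real induction, by the infimum of the exceptional set. In \<open>Lreg_stays\<close> the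
  limit step comes from closedness of the region and the step to the right from the behaviour of the
  flow at its boundary.\<close>

lemma real_induct_Icc:
  fixes P :: "real \<Rightarrow> bool"
  assumes Pa: "P a"
    and cl: "\<And>t. a < t \<Longrightarrow> t \<le> b \<Longrightarrow> (\<And>s. a \<le> s \<Longrightarrow> s < t \<Longrightarrow> P s) \<Longrightarrow> P t"
    and op: "\<And>t. a \<le> t \<Longrightarrow> t < b \<Longrightarrow> (\<And>s. a \<le> s \<Longrightarrow> s \<le> t \<Longrightarrow> P s) \<Longrightarrow>
      \<exists>e>0. \<forall>s. t < s \<and> s < t + e \<longrightarrow> P s"
    and t: "a \<le> t" "t \<le> b"
  shows "P t"
proof (rule ccontr)
  assume nP: "\<not> P t"
  define S where "S = {s. a \<le> s \<and> s \<le> b \<and> \<not> P s}"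
  have S: "S \<noteq> {}" "bdd_below S" using t nP by (auto simp: S_def intro: bdd_belowI[of _ a])
  define m where "m = Inf S"
  have am: "a \<le> m" unfolding m_def by (rule cInf_greatest[OF S(1)]) (simp add: S_def)
  have mb: "m \<le> b" using cInf_lower[OF _ S(2), of t] t nP by (auto simp: S_def m_def)
  have less: "P s" if "a \<le> s" "s < m" for s
  proof (rule ccontr)
    assume "\<not> P s"
    then have "m \<le> s" unfolding m_def using that mb by (intro cInf_lower[OF _ S(2)]) (auto simp: S_def)
    then show False using that by simp
  qed
  have Pm: "P m" using cl[OF _ mb less] Pa am by (cases "a = m") auto
  have le: "P s" if "a \<le> s" "s \<le> m" for s using less[of s] Pm that by (cases "s = m") auto
  show False
  proof (cases "m < b")
    case True
    obtain e where e: "e > 0" "\<And>s. m < s \<Longrightarrow> s < m + e \<Longrightarrow> P s" using op[OF am True le] by blast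
    obtain s where s: "s \<in> S" "s < m + e" using cInf_lessD[OF S(1), of "m + e"] e(1) by (auto simp: m_def)
    then show False using e(2)[of s] le[of s] by (cases "s \<le> m") (auto simp: S_def)
  next
    case False
    then have "m = b" using mb by simp
    then show False using le[of t] t nP by simp
  qed
qed

section \<open>Logarithms and angle along an orbit near the corner\<close>

lemma orbitD:
  assumes "orbit c \<phi>"
  shows "((\<lambda>t. fst (\<phi> t)) has_real_derivative fst (\<phi> t) * Aq c (fst (\<phi> t)) (snd (\<phi> t))) (at t)"
    "((\<lambda>t. snd (\<phi> t)) has_real_derivative - (snd (\<phi> t) * Bq c (fst (\<phi> t)) (snd (\<phi> t)))) (at t)"
    "0 < fst (\<phi> t)" "fst (\<phi> t) < 1" "0 < snd (\<phi> t)" "snd (\<phi> t) < 1"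
proof -
  have d: "(\<phi> has_vector_derivative kf c (\<phi> t)) (at t)" and "\<phi> t \<in> usq" using assms by (auto simp: orbit_def)
  show "((\<lambda>t. fst (\<phi> t)) has_real_derivative fst (\<phi> t) * Aq c (fst (\<phi> t)) (snd (\<phi> t))) (at t)"
    using bounded_linear.has_vector_derivative[OF bounded_linear_fst d]
    by (simp add: has_real_derivative_iff_has_vector_derivative kf_eq)
  show "((\<lambda>t. snd (\<phi> t)) has_real_derivative - (snd (\<phi> t) * Bq c (fst (\<phi> t)) (snd (\<phi> t)))) (at t)"
    using bounded_linear.has_vector_derivative[OF bounded_linear_snd d]
    by (simp add: has_real_derivative_iff_has_vector_derivative kf_eq)
  show "0 < fst (\<phi> t)" "fst (\<phi> t) < 1" "0 < snd (\<phi> t)" "snd (\<phi> t) < 1"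
    using \<open>\<phi> t \<in> usq\<close> by (auto simp: usq_def mem_Times_iff)
qed

lemma orbit_ln:
  assumes "orbit c \<phi>"
  shows "((\<lambda>t. ln (fst (\<phi> t))) has_real_derivative Aq c (fst (\<phi> t)) (snd (\<phi> t))) (at t)"
    "((\<lambda>t. ln (snd (\<phi> t))) has_real_derivative - Bq c (fst (\<phi> t)) (snd (\<phi> t))) (at t)"
proof -
  have p: "0 < fst (\<phi> t)" "0 < snd (\<phi> t)" using orbitD[OF assms] by auto
  show "((\<lambda>t. ln (fst (\<phi> t))) has_real_derivative Aq c (fst (\<phi> t)) (snd (\<phi> t))) (at t)"
    by (rule DERIV_cong[OF DERIV_chain2[OF DERIV_ln orbitD(1)[OF assms]]]) (use p in auto)
  show "((\<lambda>t. ln (snd (\<phi> t))) has_real_derivative - Bq c (fst (\<phi> t)) (snd (\<phi> t))) (at t)"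
    by (rule DERIV_cong[OF DERIV_chain2[OF DERIV_ln orbitD(2)[OF assms]]]) (use p in auto)
qed

text \<open>On lines through the centre of the square \<open>pc\<close> is constant: it plays the role of the polar
  angle, but with a rational inverse.\<close>

definition pc :: "real \<times> real \<Rightarrow> real" where
  "pc z = (fst z - snd z) / (1 - fst z - snd z)"

lemma pc_bounds:
  assumes "z \<in> Lreg d" "d \<le> 1/4"
  shows "1 - fst z - snd z > 0" "- 1 \<le> pc z" "pc z \<le> 1"
proof -
  show *: "1 - fst z - snd z > 0" using assms by (auto simp: Lreg_def)
  show "- 1 \<le> pc z" "pc z \<le> 1" using assms * by (auto simp: pc_def Lreg_def field_simps)
qed

lemma pc_deriv:
  assumes o: "orbit c \<phi>" and L: "1 - fst (\<phi> t) - snd (\<phi> t) > 0"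
  shows "((\<lambda>t. pc (\<phi> t)) has_real_derivative
    2 * om c (fst (\<phi> t)) (snd (\<phi> t)) / (1 - fst (\<phi> t) - snd (\<phi> t))\<^sup>2) (at t)"
proof -
  define x y where "x = fst (\<phi> t)" and "y = snd (\<phi> t)"
  define A B where "A = Aq c x y" and "B = Bq c x y"
  have d1: "((\<lambda>t. fst (\<phi> t)) has_real_derivative x * A) (at t)"
    and d2: "((\<lambda>t. snd (\<phi> t)) has_real_derivative - (y * B)) (at t)"
    using orbitD(1,2)[OF o, of t] by (simp_all add: x_def y_def A_def B_def)
  have "1 - fst (\<phi> t) - snd (\<phi> t) \<noteq> 0" using L by simp
  from DERIV_divide[OF DERIV_diff[OF d1 d2] DERIV_diff[OF DERIV_diff[OF DERIV_const[of 1] d1] d2] this]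
  have "((\<lambda>t. pc (\<phi> t)) has_real_derivative ((x * A - - (y * B)) * (1 - x - y) - (x - y) * (0 - x * A - - (y * B))) /
      ((1 - x - y) * (1 - x - y))) (at t)"
    by (simp add: pc_def x_def y_def)
  moreover have "(x * A - - (y * B)) * (1 - x - y) - (x - y) * (0 - x * A - - (y * B)) = 2 * om c x y"
    unfolding om_def A_def[symmetric] B_def[symmetric] by (simp add: algebra_simps)
  ultimately show ?thesis by (simp add: x_def y_def power2_eq_square)
qed

text \<open>Since \<open>1 - x - y\<close> is at most 1, \<open>pc\<close> grows at least at the
  rate \<open>om\<close>, so \<open>S - M * pc\<close> does not increase. As \<open>pc\<close> stays
  between -1 and 1, the error is \<open>2 * M\<close> however long the passage takes.\<close>

lemma Lreg_growth:
  assumes o: "orbit c \<phi>" and st: "stat c d M k" and t: "t0 \<le> t1"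
    and L: "\<And>t. t0 \<le> t \<Longrightarrow> t \<le> t1 \<Longrightarrow> \<phi> t \<in> Lreg d"
    and S: "\<And>t. t0 \<le> t \<Longrightarrow> t \<le> t1 \<Longrightarrow> (S has_real_derivative S' t) (at t)"
    and S': "\<And>t. t0 \<le> t \<Longrightarrow> t \<le> t1 \<Longrightarrow> S' t \<le> M * om c (fst (\<phi> t)) (snd (\<phi> t))"
  shows "S t1 - S t0 \<le> 2 * M"
proof -
  have d: "d \<le> 1/4" "M \<ge> 0" using st by (auto simp: stat_def)
  have "S t1 - M * pc (\<phi> t1) \<le> S t0 - M * pc (\<phi> t0)"
  proof (rule DERIV_nonpos_imp_nonincreasing[OF t])
    fix t assume t: "t0 \<le> t" "t \<le> t1"
    define x y where "x = fst (\<phi> t)" and "y = snd (\<phi> t)"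
    have xy: "0 < x" "0 < y" "1 - x - y > 0" "om c x y > 0"
      using orbitD[OF o, of t] pc_bounds[OF L[OF t] d(1)] st L[OF t] unfolding stat_def x_def y_def by auto
    have "(1 - x - y)\<^sup>2 \<le> 1" using xy by (simp add: power_le_one)
    then have "M * om c x y \<le> M * (2 * om c x y / (1 - x - y)\<^sup>2)"
      using xy d by (intro mult_left_mono) (auto simp: field_simps)
    then have "S' t - M * (2 * om c x y / (1 - x - y)\<^sup>2) \<le> 0"
      using S'[OF t] unfolding x_def y_def by linarith
    moreover have "((\<lambda>t. S t - M * pc (\<phi> t)) has_real_derivative S' t - M * (2 * om c x y / (1 - x - y)\<^sup>2)) (at t)"
      unfolding x_def y_def
      by (intro DERIV_diff S t DERIV_cmult pc_deriv o) (use xy in \<open>simp add: x_def y_def\<close>)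
    ultimately show "\<exists>y. ((\<lambda>t. S t - M * pc (\<phi> t)) has_real_derivative y) (at t) \<and> y \<le> 0" by blast
  qed
  moreover have "M * pc (\<phi> t1) \<le> M * 1" "M * (- 1) \<le> M * pc (\<phi> t0)"
    using pc_bounds[OF L d(1)] t d(2) by (intro mult_left_mono; auto)+
  ultimately show ?thesis by linarith
qed

text \<open>The a priori estimate of a continuity argument: as long as the orbit has not left
  \<open>Lreg d\<close>, it keeps off the part of the boundary of this region that faces the centre
  of the square.\<close>

definition stays :: "(real \<Rightarrow> real \<times> real) \<Rightarrow> real \<Rightarrow> real \<Rightarrow> bool" where
  "stays \<phi> d t0 \<longleftrightarrow> (\<forall>t\<ge>t0. (\<forall>s. t0 \<le> s \<and> s \<le> t \<longrightarrow> \<phi> s \<in> Lreg d) \<longrightarrow> fst (\<phi> t) < d \<or> snd (\<phi> t) < d)"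

text \<open>An exit towards the centre is excluded by \<open>stays\<close>. On
  \<open>y = 1/2\<close> the region has \<open>x \<le> d\<close>, where \<open>y\<close> decreases;
  an exit through \<open>x = 1/2\<close> is excluded up to \<open>T\<close>; and an orbit never
  reaches the edges.\<close>

lemma Lreg_stays:
  assumes o: "orbit c \<phi>" and st: "stat c d M k" and H: "stays \<phi> d t0" and L0: "\<phi> t0 \<in> Lreg d"
    and x: "\<And>t. t0 \<le> t \<Longrightarrow> t \<le> T \<Longrightarrow> fst (\<phi> t) \<le> 1/2" and t: "t0 \<le> t" "t \<le> T"
  shows "\<phi> t \<in> Lreg d"
proof (rule real_induct_Icc[where P = "\<lambda>t. \<phi> t \<in> Lreg d" and a = t0 and b = T])
  show "\<phi> t0 \<in> Lreg d" by (rule L0)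
  have cont: "isCont \<phi> t" for t using orbit_continuous[OF o] continuous_on_eq_continuous_at open_UNIV by blast
  have clL: "closed (Lreg d)"
    unfolding Lreg_def by (intro closed_Collect_conj closed_Collect_disj closed_Collect_le continuous_intros)
  show "\<phi> t \<in> Lreg d" if "t0 < t" "t \<le> T" "\<And>s. t0 \<le> s \<Longrightarrow> s < t \<Longrightarrow> \<phi> s \<in> Lreg d" for t
  proof (rule Lim_in_closed_set[OF clL])
    show "\<forall>\<^sub>F s in at_left t. \<phi> s \<in> Lreg d"
      using that(1,3) unfolding eventually_at_left_field by (intro exI[of _ t0]) auto
    show "(\<phi> \<longlongrightarrow> \<phi> t) (at_left t)"
      using cont[of t] by (simp add: isCont_def filterlim_at_split)
  qed simp
  show "\<exists>e>0. \<forall>s. t < s \<and> s < t + e \<longrightarrow> \<phi> s \<in> Lreg d"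
    if t: "t0 \<le> t" "t < T" "\<And>s. t0 \<le> s \<Longrightarrow> s \<le> t \<Longrightarrow> \<phi> s \<in> Lreg d" for t
  proof -
    have sm: "fst (\<phi> t) < d \<or> snd (\<phi> t) < d" using H t unfolding stays_def by auto
    have Lt: "\<phi> t \<in> Lreg d" using t by auto
    have d: "0 < d" "d \<le> 1/4" using st by (auto simp: stat_def)
    have cf: "isCont (\<lambda>s. fst (\<phi> s)) t" "isCont (\<lambda>s. snd (\<phi> s)) t" using cont by (auto intro!: continuous_intros)
    have "\<forall>\<^sub>F s in at_right t. fst (\<phi> s) < d \<or> snd (\<phi> s) < d"
    using sm
      proof
        assume "fst (\<phi> t) < d"
        then have "\<forall>\<^sub>F s in at t. fst (\<phi> s) < d" using cf(1) by (auto simp: isCont_def dest: order_tendstoD)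
        then show ?thesis by (auto simp: eventually_at_split elim: eventually_mono)
      next
        assume "snd (\<phi> t) < d"
        then have "\<forall>\<^sub>F s in at t. snd (\<phi> s) < d" using cf(2) by (auto simp: isCont_def dest: order_tendstoD)
        then show ?thesis by (auto simp: eventually_at_split elim: eventually_mono)
      qed
    moreover have "\<forall>\<^sub>F s in at_right t. snd (\<phi> s) \<le> 1/2"
    proof (cases "snd (\<phi> t) = 1/2")
      case True
      then have "fst (\<phi> t) \<le> d" using Lt d by (auto simp: Lreg_def)
      then have "Bq c (fst (\<phi> t)) (snd (\<phi> t)) > 0" using st Lt unfolding stat_def by (metis prod.collapse)
      then have "- (snd (\<phi> t) * Bq c (fst (\<phi> t)) (snd (\<phi> t))) < 0" using orbitD(5)[OF o, of t] by (simp add: mult_pos_pos)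
      from DERIV_neg_dec_right[OF orbitD(2)[OF o] this] obtain e where
        e: "e > 0" "\<And>h. h > 0 \<Longrightarrow> h < e \<Longrightarrow> snd (\<phi> (t + h)) < snd (\<phi> t)" by auto
      show ?thesis unfolding eventually_at_right_field
      proof (intro exI[of _ "t + e"] conjI allI impI)
        fix s assume "t < s" "s < t + e"
        then show "snd (\<phi> s) \<le> 1/2" using e(2)[of "s - t"] True by simp
      qed (use e in simp)
    next
      case False
      then have "snd (\<phi> t) < 1/2" using Lt by (auto simp: Lreg_def)
      then have "\<forall>\<^sub>F s in at t. snd (\<phi> s) < 1/2" by (rule order_tendstoD(2)[OF cf(2)[unfolded isCont_def]])
      then show ?thesis by (auto simp: eventually_at_split elim: eventually_mono)
    qed
    moreover have "\<forall>\<^sub>F s in at_right t. t0 \<le> s \<and> s \<le> T"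
      using t unfolding eventually_at_right_field by (intro exI[of _ T]) auto
    ultimately have "\<forall>\<^sub>F s in at_right t. \<phi> s \<in> Lreg d"
    proof eventually_elim
      case (elim s)
      then show ?case using x[of s] orbitD[OF o, of s] by (auto simp: Lreg_def)
    qed
    then show ?thesis unfolding eventually_at_right_field by (metis add_diff_cancel_left' diff_add_cancel diff_gt_0_iff_gt)
  qed
qed (use t in auto)

text \<open>By \<open>stat\<close>, \<open>ln x\<close> grows at the rate \<open>k\<close> up to the
  bounded error of \<open>Lreg_growth\<close>, but it stays negative on the square. So
  \<open>x = 1/2\<close> is reached, and the first such time is taken.\<close>

lemma quarter_passage:
  assumes o: "orbit c \<phi>" and st: "stat c d M k" and H: "stays \<phi> d t0" and L0: "\<phi> t0 \<in> Lreg d"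
  obtains \<tau> where "t0 \<le> \<tau>" "fst (\<phi> \<tau>) = 1/2" "\<And>t. t0 \<le> t \<Longrightarrow> t \<le> \<tau> \<Longrightarrow> \<phi> t \<in> Lreg d"
    "\<And>t. t0 \<le> t \<Longrightarrow> t \<le> \<tau> \<Longrightarrow> fst (\<phi> t) < d \<or> snd (\<phi> t) < d"
    "\<And>t. t0 \<le> t \<Longrightarrow> t < \<tau> \<Longrightarrow> fst (\<phi> t) < 1/2" "\<And>t. t0 < t \<Longrightarrow> t \<le> \<tau> \<Longrightarrow> snd (\<phi> t) < 1/2"
proof -
  have d: "0 < d" "d \<le> 1/4" "k > 0" using st by (auto simp: stat_def)
  have cx: "continuous_on UNIV (\<lambda>s. fst (\<phi> s))" by (intro continuous_intros orbit_continuous[OF o])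
  have "\<exists>t\<ge>t0. fst (\<phi> t) \<ge> 1/2"
  proof (rule ccontr)
    assume "\<not> ?thesis"
    then have x: "fst (\<phi> t) < 1/2" if "t0 \<le> t" for t using that by force
    have L: "\<phi> t \<in> Lreg d" if "t0 \<le> t" for t
      by (rule Lreg_stays[OF o st H L0 _ that order_refl]) (use x in \<open>auto intro: less_imp_le\<close>)
    \<comment> \<open>At this time the growth estimate would give ln x at least 1.\<close>
    define T where "T = t0 + (2 * M - ln (fst (\<phi> t0)) + 1) / k"
    have "ln (fst (\<phi> t0)) < 0" using orbitD[OF o, of t0] by simp
    then have T: "T > t0" using d st by (auto simp: T_def stat_def intro!: divide_pos_pos)
    have "(k * T - ln (fst (\<phi> T))) - (k * t0 - ln (fst (\<phi> t0))) \<le> 2 * M"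
    proof (rule Lreg_growth[OF o st, of t0 T "\<lambda>t. k * t - ln (fst (\<phi> t))" "\<lambda>t. k - Aq c (fst (\<phi> t)) (snd (\<phi> t))"])
      show "((\<lambda>t. k * t - ln (fst (\<phi> t))) has_real_derivative k - Aq c (fst (\<phi> t)) (snd (\<phi> t))) (at t)" for t
        using DERIV_diff[OF DERIV_cmult[OF DERIV_ident, of k] orbit_ln(1)[OF o]] by simp
      show "k - Aq c (fst (\<phi> t)) (snd (\<phi> t)) \<le> M * om c (fst (\<phi> t)) (snd (\<phi> t))" if "t0 \<le> t" for t
      proof -
        have "(fst (\<phi> t), snd (\<phi> t)) \<in> Lreg d" using L[OF that] by simp
        then have "k - M * om c (fst (\<phi> t)) (snd (\<phi> t)) \<le> Aq c (fst (\<phi> t)) (snd (\<phi> t))" using st unfolding stat_def by blast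
        then show ?thesis by linarith
      qed
    qed (use T L in auto)
    moreover have "k * (T - t0) = 2 * M - ln (fst (\<phi> t0)) + 1" using d by (simp add: T_def)
    moreover have "ln (fst (\<phi> T)) < 0" using orbitD[OF o, of T] by simp
    ultimately show False by (simp add: algebra_simps)
  qed
  then obtain t1 where t1: "t1 \<ge> t0" "fst (\<phi> t1) \<ge> 1/2" by blast
  define S where "S = {t. t0 \<le> t \<and> t \<le> t1 \<and> 1/2 \<le> fst (\<phi> t)}"
  have cS: "compact S"
  proof -
    have "closed S" unfolding S_def
      by (intro closed_Collect_conj closed_Collect_le continuous_intros cx)
    moreover have "bounded S" by (rule bounded_subset[of "{t0..t1}"]) (auto simp: S_def)
    ultimately show ?thesis by (simp add: compact_eq_bounded_closed)
  qed
  have neS: "S \<noteq> {}" using t1 by (auto simp: S_def)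
  obtain \<tau> where \<tau>: "\<tau> \<in> S" "\<And>t. t \<in> S \<Longrightarrow> \<tau> \<le> t" using compact_attains_inf[OF cS neS] by blast
  have lt: "fst (\<phi> t) < 1/2" if "t0 \<le> t" "t < \<tau>" for t
  proof (rule ccontr)
    assume "\<not> fst (\<phi> t) < 1/2"
    then have "t \<in> S" using that \<tau>(1) by (auto simp: S_def)
    then show False using \<tau>(2) that by fastforce
  qed
  have L0x: "fst (\<phi> t0) \<le> 1/2" using L0 by (auto simp: Lreg_def)
  have eq: "fst (\<phi> \<tau>) = 1/2"
  proof (rule antisym)
    show "1/2 \<le> fst (\<phi> \<tau>)" using \<tau>(1) by (simp add: S_def)
    show "fst (\<phi> \<tau>) \<le> 1/2"
    proof (rule ccontr)
      assume a: "\<not> fst (\<phi> \<tau>) \<le> 1/2"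
      then have "\<exists>s\<ge>t0. s \<le> \<tau> \<and> fst (\<phi> s) = 1/2"
        using L0x \<tau>(1) by (intro IVT' continuous_on_subset[OF cx]) (auto simp: S_def)
      then obtain s where s: "t0 \<le> s" "s \<le> \<tau>" "fst (\<phi> s) = 1/2" by blast
      then have "s \<in> S" using \<tau>(1) by (auto simp: S_def)
      then have "s = \<tau>" using \<tau>(2)[of s] s by simp
      then show False using a s by simp
    qed
  qed
  have \<tau>0: "t0 \<le> \<tau>" using \<tau> by (auto simp: S_def)
  have L: "\<phi> t \<in> Lreg d" if "t0 \<le> t" "t \<le> \<tau>" for t
  proof (rule Lreg_stays[OF o st H L0 _ that])
    show "fst (\<phi> s) \<le> 1/2" if "t0 \<le> s" "s \<le> \<tau>" for s
      using lt[of s] eq that by (cases "s = \<tau>") auto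
  qed
  have sm: "fst (\<phi> t) < d \<or> snd (\<phi> t) < d" if "t0 \<le> t" "t \<le> \<tau>" for t
    using H L that unfolding stays_def by auto
  have y: "snd (\<phi> t) < 1/2" if t: "t0 < t" "t \<le> \<tau>" for t
  proof (rule ccontr)
    assume "\<not> snd (\<phi> t) < 1/2"
    moreover have "\<phi> t \<in> Lreg d" using L[of t] t by simp
    ultimately have y: "snd (\<phi> t) = 1/2" and Lt: "\<phi> t \<in> Lreg d" by (auto simp: Lreg_def)
    then have "fst (\<phi> t) \<le> d" using d by (auto simp: Lreg_def)
    then have "Bq c (fst (\<phi> t)) (snd (\<phi> t)) > 0" using st Lt unfolding stat_def by (metis prod.collapse)
    then have "- (snd (\<phi> t) * Bq c (fst (\<phi> t)) (snd (\<phi> t))) < 0" using orbitD(5)[OF o, of t] by (simp add: mult_pos_pos)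
    from DERIV_neg_dec_left[OF orbitD(2)[OF o] this] obtain e where
      e: "e > 0" "\<And>h. h > 0 \<Longrightarrow> h < e \<Longrightarrow> snd (\<phi> t) < snd (\<phi> (t - h))" by auto
    define h where "h = min (e/2) (t - t0)"
    have h: "h > 0" "h < e" "t0 \<le> t - h" "t - h \<le> \<tau>" using e t by (auto simp: h_def)
    from e(2)[OF h(1,2)] L[OF h(3,4)] y show False by (auto simp: Lreg_def)
  qed
  show ?thesis by (rule that[OF \<tau>0 eq L sm lt y])
qed

section \<open>Analyticity of the corner passage\<close>

text \<open>Complex differentiability in \<open>z\<close>, expressed by a jointly continuous divided
  difference. This form passes to sums and products by algebra alone, and it turns the difference of
  two solutions of an equation into a solution of a linear one.\<close>

definition cdd :: "(real \<Rightarrow> complex \<Rightarrow> complex) \<Rightarrow> bool" where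
  "cdd h \<longleftrightarrow> continuous_on UNIV (\<lambda>u. h (fst u) (snd u)) \<and>
     (\<exists>h'. continuous_on UNIV (\<lambda>u. h' (fst u) (fst (snd u)) (snd (snd u))) \<and>
           (\<forall>p z1 z2. h p z1 - h p z2 = h' p z1 z2 * (z1 - z2)))"

lemma cddI:
  assumes "continuous_on UNIV (\<lambda>u. h (fst u) (snd u))"
    and "continuous_on UNIV (\<lambda>u. h' (fst u) (fst (snd u)) (snd (snd u)))"
    and "\<And>p z1 z2. h p z1 - h p z2 = h' p z1 z2 * (z1 - z2)"
  shows "cdd h"
  unfolding cdd_def using assms by blast

lemma cdd_id: "cdd (\<lambda>p z. z)"
  by (rule cddI[where h' = "\<lambda>p z1 z2. 1"]) (auto intro!: continuous_intros)

lemma cdd_coeff: "continuous_on UNIV a \<Longrightarrow> cdd (\<lambda>p z. a p)"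
  by (rule cddI[where h' = "\<lambda>p z1 z2. 0"])
    (auto intro!: continuous_intros intro: continuous_on_compose2[of UNIV a])

lemma cdd_add:
  assumes "cdd f" "cdd g" shows "cdd (\<lambda>p z. f p z + g p z)"
proof -
  obtain fd where fd: "continuous_on UNIV (\<lambda>u. fd (fst u) (fst (snd u)) (snd (snd u)))"
    "\<And>p z1 z2. f p z1 - f p z2 = fd p z1 z2 * (z1 - z2)" using assms(1) unfolding cdd_def by blast
  obtain gd where gd: "continuous_on UNIV (\<lambda>u. gd (fst u) (fst (snd u)) (snd (snd u)))"
    "\<And>p z1 z2. g p z1 - g p z2 = gd p z1 z2 * (z1 - z2)" using assms(2) unfolding cdd_def by blast
  show ?thesis
  proof (rule cddI[where h' = "\<lambda>p z1 z2. fd p z1 z2 + gd p z1 z2"])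
    show "f p z1 + g p z1 - (f p z2 + g p z2) = (fd p z1 z2 + gd p z1 z2) * (z1 - z2)" for p z1 z2
      using fd(2)[of p z1 z2] gd(2)[of p z1 z2] by (simp add: distrib_right) (metis add_diff_add)
  qed (use assms fd(1) gd(1) in \<open>auto intro!: continuous_intros simp: cdd_def\<close>)
qed

lemma cdd_mult:
  assumes "cdd f" "cdd g" shows "cdd (\<lambda>p z. f p z * g p z)"
proof -
  obtain fd where fd: "continuous_on UNIV (\<lambda>u. fd (fst u) (fst (snd u)) (snd (snd u)))"
    "\<And>p z1 z2. f p z1 - f p z2 = fd p z1 z2 * (z1 - z2)" using assms(1) unfolding cdd_def by blast
  obtain gd where gd: "continuous_on UNIV (\<lambda>u. gd (fst u) (fst (snd u)) (snd (snd u)))"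
    "\<And>p z1 z2. g p z1 - g p z2 = gd p z1 z2 * (z1 - z2)" using assms(2) unfolding cdd_def by blast
  have cf: "continuous_on UNIV (\<lambda>u. f (fst u) (snd u))" and cg: "continuous_on UNIV (\<lambda>u. g (fst u) (snd u))"
    using assms by (auto simp: cdd_def)
  have "continuous_on UNIV (\<lambda>u::real \<times> complex \<times> complex. (fst u, fst (snd u)))"
    "continuous_on UNIV (\<lambda>u::real \<times> complex \<times> complex. (fst u, snd (snd u)))" by (intro continuous_intros)+
  from continuous_on_compose2[OF cg this(1)] continuous_on_compose2[OF cf this(2)]
  have c2: "continuous_on UNIV (\<lambda>u::real \<times> complex \<times> complex. g (fst u) (fst (snd u)))"
    "continuous_on UNIV (\<lambda>u::real \<times> complex \<times> complex. f (fst u) (snd (snd u)))" by simp_all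
  show ?thesis
  proof (rule cddI[where h' = "\<lambda>p z1 z2. fd p z1 z2 * g p z1 + f p z2 * gd p z1 z2"])
    show "f p z1 * g p z1 - f p z2 * g p z2 = (fd p z1 z2 * g p z1 + f p z2 * gd p z1 z2) * (z1 - z2)" for p z1 z2
    proof -
      have "f p z1 * g p z1 - f p z2 * g p z2 = (f p z1 - f p z2) * g p z1 + f p z2 * (g p z1 - g p z2)"
        by (simp add: algebra_simps)
      then show ?thesis unfolding fd(2) gd(2) by (simp add: algebra_simps)
    qed
  qed (use cf cg c2 fd(1) gd(1) in \<open>auto intro!: continuous_intros\<close>)
qed

section \<open>Holomorphic dependence of a scalar equation on its initial value\<close>

lemma linear_scalar_ode:
  fixes w q :: "real \<Rightarrow> complex"
  assumes ab: "a \<le> b" and q: "continuous_on {a..b} q"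
    and w: "\<And>t. t \<in> {a..b} \<Longrightarrow> (w has_vector_derivative q t * w t) (at t within {a..b})"
  shows "w b = w a * exp (integral {a..b} q)"
proof -
  define Q where "Q t = integral {a..t} q" for t
  have dQ: "(Q has_vector_derivative q t) (at t within {a..b})" if "t \<in> {a..b}" for t
    unfolding Q_def by (rule integral_has_vector_derivative[OF q that])
  have dE: "((\<lambda>t. exp (- Q t)) has_vector_derivative - q t * exp (- Q t)) (at t within {a..b})" if "t \<in> {a..b}" for t
  proof -
    have "((\<lambda>t. - Q t) has_vector_derivative - q t) (at t within {a..b})"
      using has_vector_derivative_minus[OF dQ[OF that]] .
    from field_vector_diff_chain_within[OF this, of exp "exp (- Q t)"]
    show ?thesis by (simp add: o_def DERIV_exp has_field_derivative_at_within)
  qed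
  have "((\<lambda>t. w t * exp (- Q t)) has_derivative (\<lambda>h. 0)) (at t within {a..b})" if "t \<in> {a..b}" for t
    using has_vector_derivative_mult[OF w[OF that] dE[OF that]]
    by (simp add: has_vector_derivative_def algebra_simps)
  then obtain k where k: "\<And>t. t \<in> {a..b} \<Longrightarrow> w t * exp (- Q t) = k"
    using has_derivative_zero_constant[of "{a..b}" "\<lambda>t. w t * exp (- Q t)"] by auto
  have "w b * exp (- Q b) = w a" using k[of a] k[of b] ab by (simp add: Q_def)
  then have "w b * exp (- Q b) * exp (Q b) = w a * exp (Q b)" by simp
  then show ?thesis by (simp add: Q_def mult.assoc flip: exp_add)
qed

definition csol :: "(real \<Rightarrow> complex \<Rightarrow> complex) \<Rightarrow> (real \<Rightarrow> complex \<Rightarrow> complex) \<Rightarrow> real \<Rightarrow> real \<Rightarrow> (real \<Rightarrow> complex) \<Rightarrow> bool" where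
  "csol N D a b \<zeta> \<longleftrightarrow> (\<forall>t\<in>{a..b}. D t (\<zeta> t) \<noteq> 0 \<and>
     (\<zeta> has_vector_derivative N t (\<zeta> t) / D t (\<zeta> t)) (at t within {a..b}))"

lemma csol_continuous: "csol N D a b \<zeta> \<Longrightarrow> continuous_on {a..b} \<zeta>"
  unfolding csol_def continuous_on_eq_continuous_within by (meson has_vector_derivative_continuous)

lemma csol_subset: "csol N D a b \<zeta> \<Longrightarrow> c \<le> b \<Longrightarrow> csol N D a c \<zeta>"
  unfolding csol_def by (auto intro: has_vector_derivative_within_subset[of _ _ _ "{a..b}"])

text \<open>\<open>rdd\<close> is the divided difference of the quotient \<open>N / D\<close>.\<close>

definition rdd where
  "rdd N D Nd Dd t z1 z2 = (Nd t z1 z2 * D t z2 - N t z2 * Dd t z1 z2) / (D t z1 * D t z2)"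

locale quotient_field =
  fixes N D :: "real \<Rightarrow> complex \<Rightarrow> complex" and Nd Dd :: "real \<Rightarrow> complex \<Rightarrow> complex \<Rightarrow> complex"
  assumes N: "continuous_on UNIV (\<lambda>u. N (fst u) (snd u))" and D: "continuous_on UNIV (\<lambda>u. D (fst u) (snd u))"
    and Nd: "continuous_on UNIV (\<lambda>u. Nd (fst u) (fst (snd u)) (snd (snd u)))"
    and Dd: "continuous_on UNIV (\<lambda>u. Dd (fst u) (fst (snd u)) (snd (snd u)))"
    and Ndd: "\<And>p z1 z2. N p z1 - N p z2 = Nd p z1 z2 * (z1 - z2)"
    and Ddd: "\<And>p z1 z2. D p z1 - D p z2 = Dd p z1 z2 * (z1 - z2)"
begin

abbreviation "R t z \<equiv> N t z / D t z"
abbreviation "Rd \<equiv> rdd N D Nd Dd"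

lemma R_diff: "D t z1 \<noteq> 0 \<Longrightarrow> D t z2 \<noteq> 0 \<Longrightarrow> R t z1 - R t z2 = Rd t z1 z2 * (z1 - z2)"
proof -
  assume d: "D t z1 \<noteq> 0" "D t z2 \<noteq> 0"
  have "R t z1 - R t z2 = ((N t z1 - N t z2) * D t z2 - N t z2 * (D t z1 - D t z2)) / (D t z1 * D t z2)"
    using d by (simp add: field_simps)
  then show ?thesis unfolding Ndd Ddd rdd_def by (simp add: algebra_simps)
qed

lemma continuous_on_N [continuous_intros]:
  "continuous_on S f \<Longrightarrow> continuous_on S g \<Longrightarrow> continuous_on S (\<lambda>x. N (f x) (g x))"
  using continuous_on_compose2[OF N, of S "\<lambda>x. (f x, g x)"] continuous_on_Pair[of S f g] by simp

lemma continuous_on_D [continuous_intros]: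
  "continuous_on S f \<Longrightarrow> continuous_on S g \<Longrightarrow> continuous_on S (\<lambda>x. D (f x) (g x))"
  using continuous_on_compose2[OF D, of S "\<lambda>x. (f x, g x)"] continuous_on_Pair[of S f g] by simp

lemma continuous_on_Rd:
  assumes "continuous_on S f" "continuous_on S g" "continuous_on S h"
    and "\<And>x. x \<in> S \<Longrightarrow> D (f x) (g x) \<noteq> 0" "\<And>x. x \<in> S \<Longrightarrow> D (f x) (h x) \<noteq> 0"
  shows "continuous_on S (\<lambda>x. Rd (f x) (g x) (h x))"
proof -
  have "continuous_on S (\<lambda>x. (f x, g x, h x))" using assms by (intro continuous_intros)
  from continuous_on_compose2[OF Nd this] continuous_on_compose2[OF Dd this] show ?thesis
    unfolding rdd_def using assms by (intro continuous_intros) auto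
qed

text \<open>The difference solves a linear equation whose coefficient is the divided difference of
  the right-hand side. The explicit exponential gives uniqueness and, in
  \<open>holomorphic_dependence\<close>, the difference quotients of the flow.\<close>

lemma csol_diff:
  assumes "a \<le> b" "csol N D a b \<zeta>1" "csol N D a b \<zeta>2"
  shows "\<zeta>1 b - \<zeta>2 b = (\<zeta>1 a - \<zeta>2 a) * exp (integral {a..b} (\<lambda>t. Rd t (\<zeta>1 t) (\<zeta>2 t)))"
proof (rule linear_scalar_ode[OF assms(1)])
  show "continuous_on {a..b} (\<lambda>t. Rd t (\<zeta>1 t) (\<zeta>2 t))"
    by (rule continuous_on_Rd) (use assms csol_continuous in \<open>auto simp: csol_def intro!: continuous_intros\<close>)
  show "((\<lambda>t. \<zeta>1 t - \<zeta>2 t) has_vector_derivative Rd t (\<zeta>1 t) (\<zeta>2 t) * (\<zeta>1 t - \<zeta>2 t)) (at t within {a..b})"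
    if "t \<in> {a..b}" for t
    using has_vector_derivative_diff[of \<zeta>1 "R t (\<zeta>1 t)" "at t within {a..b}" \<zeta>2 "R t (\<zeta>2 t)"]
      R_diff[of t "\<zeta>1 t" "\<zeta>2 t"] assms(2,3) that by (auto simp: csol_def)
qed

lemma csol_unique:
  assumes "csol N D a b \<zeta>1" "csol N D a b \<zeta>2" "s \<in> {a..b}" "\<zeta>1 s = \<zeta>2 s"
  shows "\<zeta>1 a = \<zeta>2 a"
  using csol_diff[of a s \<zeta>1 \<zeta>2] csol_subset[OF assms(1), of s] csol_subset[OF assms(2), of s] assms(3,4) by auto

text \<open>By \<open>csol_diff\<close> a difference quotient of the end value is the exponential of
  an integral that depends continuously on the initial value, so its limit exists and is the complex
  derivative.\<close>

theorem holomorphic_dependence: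
  assumes ab: "a \<le> b" and \<rho>: "csol N D a b \<rho>"
  shows "\<exists>e g. e > 0 \<and> g holomorphic_on ball (\<rho> a) e \<and>
    (\<forall>\<zeta>. csol N D a b \<zeta> \<and> \<zeta> a \<in> ball (\<rho> a) e \<longrightarrow> g (\<zeta> a) = \<zeta> b)"
proof -
  define cl where "cl t = max a (min b t)" for t :: real
  have cl: "cl t \<in> {a..b}" "t \<in> {a..b} \<Longrightarrow> cl t = t" for t using ab by (auto simp: cl_def)
  have ccl: "continuous_on S cl" for S unfolding cl_def by (intro continuous_intros)
  define \<rho>' where "\<rho>' t = \<rho> (cl t)" for t
  have c\<rho>: "continuous_on S \<rho>'" for S
    unfolding \<rho>'_def by (rule continuous_on_compose2[OF csol_continuous[OF \<rho>] ccl]) (use cl in auto)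
  have "\<exists>d m. d > 0 \<and> m > 0 \<and> (\<forall>v z. \<forall>k\<in>{a..b}. dist v 0 < d \<longrightarrow> dist z k < d \<longrightarrow> norm (D z (\<rho>' z + v)) > m)"
  proof (rule tube)
    show "continuous_on UNIV (\<lambda>u. norm (D (snd u) (\<rho>' (snd u) + fst u)))"
      by (intro continuous_intros continuous_on_compose2[OF c\<rho>[of UNIV]]) auto
    show "0 < norm (D z (\<rho>' z + 0))" if "z \<in> {a..b}" for z
      using \<rho> that cl by (auto simp: csol_def \<rho>'_def)
  qed simp
  then obtain d m where d: "d > 0" "\<And>v z. dist v 0 < d \<Longrightarrow> z \<in> {a..b} \<Longrightarrow> norm (D z (\<rho>' z + v)) > m" "m > 0"
    by (metis dist_self)
  define \<delta> where "\<delta> = d / 2"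
  have \<delta>: "\<delta> > 0" using d by (simp add: \<delta>_def)
  have D0: "D t (\<rho>' t + v) \<noteq> 0" if "t \<in> {a..b}" "norm v \<le> \<delta>" for t v
    using d(2)[of v t] d(1,3) that by (auto simp: \<delta>_def)
  \<comment> \<open>Projecting the deviation from \<open>\<rho>\<close> onto a ball on which
    \<open>D\<close> has no zero makes the right-hand side bounded and Lipschitz on the whole plane,
    as global existence requires.\<close>
  define pr where "pr = closest_point (cball (0::complex) \<delta>)"
  have pr: "norm (pr v) \<le> \<delta>" "norm (pr v - pr v') \<le> norm (v - v')" "norm v \<le> \<delta> \<Longrightarrow> pr v = v" for v v'
    using closest_point_in_set[of "cball (0::complex) \<delta>" v] closest_point_lipschitz[of "cball (0::complex) \<delta>" v v']
      closest_point_self[of v "cball (0::complex) \<delta>"] \<delta>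
    by (auto simp: pr_def dist_norm)
  have cpr: "continuous_on S pr" for S
    unfolding pr_def using \<delta> by (intro continuous_on_closest_point) auto
  have cK: "compact ({a..b} \<times> cball (0::complex) \<delta> \<times> cball (0::complex) \<delta>)" by (intro compact_Times) auto
  have "compact ((\<lambda>u. Rd (fst u) (\<rho>' (fst u) + fst (snd u)) (\<rho>' (fst u) + snd (snd u))) ` ({a..b} \<times> cball (0::complex) \<delta> \<times> cball (0::complex) \<delta>))"
    by (intro compact_continuous_image[OF _ cK] continuous_on_Rd continuous_intros continuous_on_compose2[OF c\<rho>[of UNIV]])
      (use D0 in auto)
  then obtain L where "\<And>t v1 v2. t \<in> {a..b} \<Longrightarrow> norm v1 \<le> \<delta> \<Longrightarrow> norm v2 \<le> \<delta> \<Longrightarrow> norm (Rd t (\<rho>' t + v1) (\<rho>' t + v2)) \<le> L"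
    unfolding compact_eq_bounded_closed bounded_iff by fastforce
  then have L: "\<And>t v1 v2. t \<in> {a..b} \<Longrightarrow> norm v1 \<le> \<delta> \<Longrightarrow> norm v2 \<le> \<delta> \<Longrightarrow> norm (Rd t (\<rho>' t + v1) (\<rho>' t + v2)) \<le> L" .
  have L0: "L \<ge> 0" using L[of a 0 0] ab \<delta> by (auto intro: order_trans[OF norm_ge_zero])
  have cK2: "compact ({a..b} \<times> cball (0::complex) \<delta>)" by (intro compact_Times) auto
  have "compact ((\<lambda>u. R (fst u) (\<rho>' (fst u) + snd u)) ` ({a..b} \<times> cball (0::complex) \<delta>))"
    by (intro compact_continuous_image[OF _ cK2] continuous_intros continuous_on_compose2[OF c\<rho>[of UNIV]])
      (use D0 in auto)
  then obtain B where B: "\<And>t v. t \<in> {a..b} \<Longrightarrow> norm v \<le> \<delta> \<Longrightarrow> norm (R t (\<rho>' t + v)) \<le> B"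
    unfolding compact_eq_bounded_closed bounded_iff by fastforce
  define f where "f t x = R (cl t) (\<rho>' (cl t) + pr (x - \<rho>' (cl t)))" for t x
  have f_cont: "continuous_on UNIV (\<lambda>(t, x). f t x)"
    unfolding f_def case_prod_beta
    by (intro continuous_intros continuous_on_compose2[OF c\<rho>[of UNIV]] continuous_on_compose2[OF ccl[of UNIV]]
        continuous_on_compose2[OF cpr[of UNIV]]) (use D0[OF cl(1) pr(1)] in auto)
  have f_bd: "norm (f t x) \<le> B" for t x unfolding f_def by (rule B[OF cl(1) pr(1)])
  have f_lip: "norm (f t x - f t y) \<le> L * norm (x - y)" for t x y
  proof -
    have "f t x - f t y = Rd (cl t) (\<rho>' (cl t) + pr (x - \<rho>' (cl t))) (\<rho>' (cl t) + pr (y - \<rho>' (cl t))) *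
      (pr (x - \<rho>' (cl t)) - pr (y - \<rho>' (cl t)))"
      unfolding f_def by (subst R_diff[OF D0[OF cl(1) pr(1)] D0[OF cl(1) pr(1)]]) simp
    also have "norm \<dots> \<le> L * norm (x - y)"
      unfolding norm_mult using pr(2)[of "x - \<rho>' (cl t)" "y - \<rho>' (cl t)"] L0
      by (intro mult_mono L cl pr) auto
    finally show ?thesis .
  qed
  have "\<exists>x. x a = z \<and> (\<forall>t. (x has_vector_derivative f t (x t)) (at t))" for z
    by (rule picard_lindelof_global[OF f_cont f_lip f_bd, of a z]) blast
  then obtain \<zeta> where \<zeta>: "\<And>z. \<zeta> z a = z" "\<And>z t. (\<zeta> z has_vector_derivative f t (\<zeta> z t)) (at t)" by metis
  define E where "E = exp (L * (b - a))"
  have E: "E > 0" by (simp add: E_def)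
  have E': "exp (L * \<bar>t - a\<bar>) * r \<le> E * r" if "t \<in> {a..b}" "r \<ge> 0" for t r
    unfolding E_def using that L0 by (intro mult_right_mono) (auto intro!: mult_left_mono)
  have dist_z: "norm (\<zeta> z t - \<zeta> z' t) \<le> E * norm (z - z')" if t: "t \<in> {a..b}" for z z' t
  proof -
    have "norm (\<zeta> z t - \<zeta> z' t) \<le> exp (L * \<bar>t - a\<bar>) * norm (\<zeta> z a - \<zeta> z' a)"
      by (rule gronwall[of a b "\<lambda>t. \<zeta> z t - \<zeta> z' t" "\<lambda>t. f t (\<zeta> z t) - f t (\<zeta> z' t)"])
        (use t ab in \<open>auto intro!: f_lip has_vector_derivative_diff has_vector_derivative_at_within[OF \<zeta>(2)]\<close>)
    then show ?thesis using E'[OF t, of "norm (z - z')"] \<zeta>(1) by simp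
  qed
  have dist_\<rho>: "norm (\<zeta> z t - \<rho> t) \<le> E * norm (z - \<rho> a)" if t: "t \<in> {a..b}" for z t
  proof -
    have f\<rho>: "f t (\<rho> t) = R t (\<rho> t)" if "t \<in> {a..b}" for t
      using that cl(2)[OF that] pr(3)[of 0] \<delta> by (simp add: f_def \<rho>'_def)
    have "norm (\<zeta> z t - \<rho> t) \<le> exp (L * \<bar>t - a\<bar>) * norm (\<zeta> z a - \<rho> a)"
    proof (rule gronwall[of a b "\<lambda>t. \<zeta> z t - \<rho> t" "\<lambda>t. f t (\<zeta> z t) - f t (\<rho> t)"])
      show "((\<lambda>t. \<zeta> z t - \<rho> t) has_vector_derivative f t (\<zeta> z t) - f t (\<rho> t)) (at t within {a..b})" if "t \<in> {a..b}" for t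
        using \<rho> that by (auto simp: f\<rho> csol_def intro!: has_vector_derivative_diff has_vector_derivative_at_within[OF \<zeta>(2)])
    qed (use t ab f_lip in auto)
    then show ?thesis using E'[OF t, of "norm (z - \<rho> a)"] \<zeta>(1) by simp
  qed
  \<comment> \<open>Gronwall multiplies deviations by at most \<open>E\<close>, so solutions that
    start this close never feel the projection.\<close>
  define \<epsilon> where "\<epsilon> = \<delta> / E"
  have \<epsilon>: "\<epsilon> > 0" using \<delta> E by (simp add: \<epsilon>_def)
  have in_tube: "norm (\<zeta> z t - \<rho>' t) \<le> \<delta>" if "z \<in> ball (\<rho> a) \<epsilon>" "t \<in> {a..b}" for z t
  proof -
    have "E * norm (z - \<rho> a) \<le> E * \<epsilon>" using that(1) E by (intro mult_left_mono) (auto simp: dist_norm norm_minus_commute)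
    then show ?thesis using dist_\<rho>[OF that(2), of z] cl(2)[OF that(2)] E by (simp add: \<rho>'_def \<epsilon>_def)
  qed
  have D\<zeta>: "D t (\<zeta> z t) \<noteq> 0" if "z \<in> ball (\<rho> a) \<epsilon>" "t \<in> {a..b}" for z t
    using D0[OF that(2) in_tube[OF that]] by simp
  have sol: "csol N D a b (\<zeta> z)" if z: "z \<in> ball (\<rho> a) \<epsilon>" for z
    unfolding csol_def
  proof
    fix t assume t: "t \<in> {a..b}"
    have "f t (\<zeta> z t) = R t (\<zeta> z t)"
      using pr(3)[OF in_tube[OF z t]] cl(2)[OF t] by (simp add: f_def)
    then show "D t (\<zeta> z t) \<noteq> 0 \<and> (\<zeta> z has_vector_derivative R t (\<zeta> z t)) (at t within {a..b})"
      using D\<zeta>[OF z t] has_vector_derivative_at_within[OF \<zeta>(2)[of z t], of "{a..b}"] by simp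
  qed
  have c\<zeta>: "continuous_on (UNIV \<times> {a..b}) (\<lambda>(z, t). \<zeta> z t)"
    unfolding continuous_on_def
  proof
    fix u :: "complex \<times> real" assume u: "u \<in> UNIV \<times> {a..b}"
    let ?F = "at u within UNIV \<times> {a..b}"
    have c1: "continuous_on UNIV (\<zeta> (fst u))"
      using \<zeta>(2) by (meson continuous_at_imp_continuous_on has_vector_derivative_continuous)
    have "continuous_on (UNIV \<times> {a..b}) (\<lambda>v::complex \<times> real. \<zeta> (fst u) (snd v))"
      by (intro continuous_on_compose2[OF c1] continuous_intros) auto
    then have t1: "((\<lambda>v. \<zeta> (fst u) (snd v)) \<longlongrightarrow> \<zeta> (fst u) (snd u)) ?F"
      using u unfolding continuous_on_def by blast
    have "((\<lambda>v. \<zeta> (fst v) (snd v) - \<zeta> (fst u) (snd v)) \<longlongrightarrow> 0) ?F"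
    proof (rule Lim_null_comparison)
      show "\<forall>\<^sub>F v in ?F. norm (\<zeta> (fst v) (snd v) - \<zeta> (fst u) (snd v)) \<le> E * norm (fst v - fst u)"
        unfolding eventually_at_filter by (intro always_eventually) (use dist_z in auto)
      have "((\<lambda>v. E * norm (fst v - fst u)) \<longlongrightarrow> E * norm (fst u - fst u)) ?F" by (intro tendsto_intros)
      then show "((\<lambda>v. E * norm (fst v - fst u)) \<longlongrightarrow> 0) ?F" by simp
    qed
    from tendsto_add[OF this t1] show "((\<lambda>(z, t). \<zeta> z t) \<longlongrightarrow> (case u of (z, t) \<Rightarrow> \<zeta> z t)) ?F"
      by (simp add: case_prod_unfold)
  qed
  define g where "g z = \<zeta> z b" for z
  have "(g has_field_derivative exp (integral {a..b} (\<lambda>t. Rd t (\<zeta> z1 t) (\<zeta> z1 t)))) (at z1)"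
    if z1: "z1 \<in> ball (\<rho> a) \<epsilon>" for z1
  proof -
    define I where "I z = integral {a..b} (\<lambda>t. Rd t (\<zeta> z t) (\<zeta> z1 t))" for z
    have "continuous_on (ball (\<rho> a) \<epsilon>) (\<lambda>z. integral (cbox a b) (\<lambda>t. Rd t (\<zeta> z t) (\<zeta> z1 t)))"
    proof (rule integral_continuous_on_param)
      have s: "continuous_on (ball (\<rho> a) \<epsilon> \<times> {a..b}) (\<lambda>u. \<zeta> (fst u) (snd u))"
        using continuous_on_subset[OF c\<zeta>, of "ball (\<rho> a) \<epsilon> \<times> {a..b}"] by (simp add: case_prod_unfold subset_iff)
      have s1: "continuous_on (ball (\<rho> a) \<epsilon> \<times> {a..b}) (\<lambda>u. \<zeta> z1 (snd u))"
      proof -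
        have "continuous_on UNIV (\<zeta> z1)"
          using \<zeta>(2) by (meson continuous_at_imp_continuous_on has_vector_derivative_continuous)
        then show ?thesis by (rule continuous_on_compose2) (intro continuous_intros, simp)
      qed
      show "continuous_on (ball (\<rho> a) \<epsilon> \<times> cbox a b) (\<lambda>(z, t). Rd t (\<zeta> z t) (\<zeta> z1 t))"
        unfolding case_prod_unfold interval_cbox[symmetric]
        by (intro continuous_on_Rd s s1 continuous_intros) (use D\<zeta> z1 in auto)
    qed
    then have "continuous_on (ball (\<rho> a) \<epsilon>) I" by (simp add: I_def[abs_def])
    then have "isCont I z1" using z1 continuous_on_eq_continuous_at open_ball by blast
    then have "((\<lambda>z. exp (I z)) \<longlongrightarrow> exp (I z1)) (at z1)" by (intro tendsto_intros) (simp add: isCont_def)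
    moreover have "\<forall>\<^sub>F z in at z1. exp (I z) = (g z - g z1) / (z - z1)"
    proof -
      have "\<forall>\<^sub>F z in at z1. z \<in> ball (\<rho> a) \<epsilon>" using z1 by (intro eventually_at_in_open') auto
      moreover have "\<forall>\<^sub>F z in at z1. z \<noteq> z1" by (simp add: eventually_at_filter)
      ultimately show ?thesis
      proof eventually_elim
        case (elim z)
        show ?case using csol_diff[OF ab sol[OF elim(1)] sol[OF z1]] \<zeta>(1) elim(2) by (simp add: g_def I_def)
      qed
    qed
    ultimately have "((\<lambda>z. (g z - g z1) / (z - z1)) \<longlongrightarrow> exp (I z1)) (at z1)"
      by (rule Lim_transform_eventually)
    then show ?thesis by (simp add: has_field_derivative_iff I_def)
  qed
  then have "g holomorphic_on ball (\<rho> a) \<epsilon>"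
    unfolding holomorphic_on_def field_differentiable_def
    by (blast intro: has_field_derivative_at_within)
  moreover have "g (z a) = z b" if z: "csol N D a b z" "z a \<in> ball (\<rho> a) \<epsilon>" for z
    using csol_diff[OF ab sol[OF z(2)] z(1)] \<zeta>(1)[of "z a"] by (simp add: g_def)
  ultimately show ?thesis using \<epsilon> by blast
qed

end

text \<open>The transition through \<open>Lreg d\<close> from \<open>y = 1/2\<close> to \<open>x = 1/2\<close>.\<close>

definition qpass :: "quad \<times> quad \<Rightarrow> real \<Rightarrow> (real \<Rightarrow> real \<times> real) \<Rightarrow> real \<Rightarrow> bool" where
  "qpass c d \<phi> \<tau> \<longleftrightarrow> orbit c \<phi> \<and> 0 < \<tau> \<and> fst (\<phi> \<tau>) = 1/2 \<and>
     (\<forall>t. 0 \<le> t \<and> t \<le> \<tau> \<longrightarrow> \<phi> t \<in> Lreg d \<and> (fst (\<phi> t) < d \<or> snd (\<phi> t) < d)) \<and>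
     (\<forall>t. 0 \<le> t \<and> t < \<tau> \<longrightarrow> fst (\<phi> t) < 1/2) \<and> (\<forall>t. 0 < t \<and> t \<le> \<tau> \<longrightarrow> snd (\<phi> t) < 1/2)"

text \<open>A relation rather than a function, because an orbit that starts too far from the edge
  may fail to complete the passage inside \<open>Lreg d\<close>.\<close>

definition tr :: "quad \<times> quad \<Rightarrow> real \<Rightarrow> real \<Rightarrow> real \<Rightarrow> bool" where
  "tr c d s s' \<longleftrightarrow> (\<exists>\<phi> \<tau>. qpass c d \<phi> \<tau> \<and> \<phi> 0 = (s, 1/2) \<and> \<phi> \<tau> = (1/2, s'))"

section \<open>Transition maps at one corner\<close>

lemma Lreg_mono: "d \<le> d' \<Longrightarrow> Lreg d \<subseteq> Lreg d'"
  by (auto simp: Lreg_def)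

lemma tr_mono:
  assumes "tr c d s s'" "d \<le> d'" shows "tr c d' s s'"
proof -
  obtain \<phi> \<tau> where q: "qpass c d \<phi> \<tau>" "\<phi> 0 = (s, 1/2)" "\<phi> \<tau> = (1/2, s')" using assms(1) unfolding tr_def by blast
  have "\<phi> t \<in> Lreg d' \<and> (fst (\<phi> t) < d' \<or> snd (\<phi> t) < d')" if "0 \<le> t \<and> t \<le> \<tau>" for t
  proof -
    have "\<phi> t \<in> Lreg d" "fst (\<phi> t) < d \<or> snd (\<phi> t) < d" using q(1) that by (auto simp: qpass_def)
    then show ?thesis using Lreg_mono[OF assms(2)] assms(2) by auto
  qed
  then have "qpass c d' \<phi> \<tau>" using q(1) by (simp add: qpass_def)
  then show ?thesis using q unfolding tr_def by blast
qed

lemma tr_pos: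
  assumes "tr c d s s'" shows "0 < s \<and> s < 1/2 \<and> 0 < s' \<and> s' < 1/2"
proof -
  obtain \<phi> \<tau> where q: "qpass c d \<phi> \<tau>" "\<phi> 0 = (s, 1/2)" "\<phi> \<tau> = (1/2, s')" using assms(1) unfolding tr_def by blast
  then have "orbit c \<phi>" "fst (\<phi> 0) < 1/2" "snd (\<phi> \<tau>) < 1/2" unfolding qpass_def by auto
  then show ?thesis using orbitD(3)[of c \<phi> 0] orbitD(5)[of c \<phi> \<tau>] q by simp
qed

lemma tr_unique:
  assumes "tr c d s s1" "tr c d s s2" shows "s1 = s2"
proof -
  obtain \<phi> \<tau> where 1: "qpass c d \<phi> \<tau>" "\<phi> 0 = (s, 1/2)" "\<phi> \<tau> = (1/2, s1)" using assms(1) unfolding tr_def by blast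
  obtain \<psi> \<sigma> where 2: "qpass c d \<psi> \<sigma>" "\<psi> 0 = (s, 1/2)" "\<psi> \<sigma> = (1/2, s2)" using assms(2) unfolding tr_def by blast
  have eq: "\<phi> t = \<psi> t" for t
    by (rule orbit_unique[of c \<phi> \<psi> 0]) (use 1 2 in \<open>auto simp: qpass_def\<close>)
  have lt: "0 < \<tau>" "fst (\<phi> \<tau>) = 1/2" "\<And>t. 0 \<le> t \<Longrightarrow> t < \<tau> \<Longrightarrow> fst (\<phi> t) < 1/2"
    "0 < \<sigma>" "fst (\<psi> \<sigma>) = 1/2" "\<And>t. 0 \<le> t \<Longrightarrow> t < \<sigma> \<Longrightarrow> fst (\<psi> t) < 1/2"
    using 1(1) 2(1) by (simp_all add: qpass_def)
  have "\<not> \<tau> < \<sigma>" "\<not> \<sigma> < \<tau>" using lt(1,2,4,5) lt(3)[of \<sigma>] lt(6)[of \<tau>] eq by auto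
  then have "\<tau> = \<sigma>" by simp
  then show ?thesis using 1 2 eq by auto
qed

text \<open>\<open>U\<close> is the logarithm of \<open>x powr a1 * y\<close> and grows by at most
  \<open>2 * M\<close>. By the hypothesis \<open>small\<close> it stays below its least value at
  points with both coordinates at least \<open>d\<close>, so the orbit stays near the edges; at the
  end of the passage the same bound says that \<open>s'\<close> is at most a constant times
  \<open>s powr a1\<close>.\<close>

lemma quarter_turn:
  assumes st: "stat c d M k" and sl: "slope c d M a1 a2" and a1: "a1 > 0" and s: "0 < s" "s \<le> d"
    and small: "a1 * ln s + ln (1/2) + 2 * M < (a1 + 1) * ln d"
  shows "\<exists>s'. tr c d s s' \<and> a1 * ln (1/2) + ln s' \<le> a1 * ln s + ln (1/2) + 2 * M"
proof -
  have d: "0 < d" "d \<le> 1/4" using st by (auto simp: stat_def)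
  have "(s, 1/2) \<in> usq" using s d by (auto simp: usq_def)
  then obtain \<phi> where o: "orbit c \<phi>" and \<phi>0: "\<phi> 0 = (s, 1/2)" by (rule orbit_exists) blast
  define U where "U t = a1 * ln (fst (\<phi> t)) + ln (snd (\<phi> t))" for t
  have dU: "(U has_real_derivative a1 * Aq c (fst (\<phi> t)) (snd (\<phi> t)) - Bq c (fst (\<phi> t)) (snd (\<phi> t))) (at t)" for t
    unfolding U_def using DERIV_add[OF DERIV_cmult[OF orbit_ln(1)[OF o], of a1] orbit_ln(2)[OF o]] by simp
  have gr: "U t \<le> U 0 + 2 * M" if t: "0 \<le> t" "\<And>s. 0 \<le> s \<Longrightarrow> s \<le> t \<Longrightarrow> \<phi> s \<in> Lreg d" for t
  proof -
    have "U t - U 0 \<le> 2 * M"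
    proof (rule Lreg_growth[OF o st t(1) t(2) dU])
      fix r assume "0 \<le> r" "r \<le> t"
      then have "(fst (\<phi> r), snd (\<phi> r)) \<in> Lreg d" using t(2)[of r] by simp
      then show "a1 * Aq c (fst (\<phi> r)) (snd (\<phi> r)) - Bq c (fst (\<phi> r)) (snd (\<phi> r)) \<le> M * om c (fst (\<phi> r)) (snd (\<phi> r))"
        using sl unfolding slope_def by blast
    qed auto
    then show ?thesis by simp
  qed
  have U0: "U 0 = a1 * ln s + ln (1/2)" by (simp add: U_def \<phi>0)
  have H: "stays \<phi> d 0"
    unfolding stays_def
  proof (intro allI impI)
    fix t :: real assume t: "0 \<le> t" "\<forall>s. 0 \<le> s \<and> s \<le> t \<longrightarrow> \<phi> s \<in> Lreg d"
    show "fst (\<phi> t) < d \<or> snd (\<phi> t) < d"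
    proof (rule ccontr)
      assume "\<not> ?thesis"
      then have *: "d \<le> fst (\<phi> t)" "d \<le> snd (\<phi> t)" by auto
      have "a1 * ln d + ln d \<le> U t" unfolding U_def using * d a1 by (intro add_mono mult_left_mono) auto
      then show False using gr[OF t(1)] t(2) U0 small by (auto simp: algebra_simps)
    qed
  qed
  have L0: "\<phi> 0 \<in> Lreg d" using \<phi>0 s d by (auto simp: Lreg_def)
  obtain \<tau> where \<tau>: "0 \<le> \<tau>" "fst (\<phi> \<tau>) = 1/2" "\<And>t. 0 \<le> t \<Longrightarrow> t \<le> \<tau> \<Longrightarrow> \<phi> t \<in> Lreg d"
    "\<And>t. 0 \<le> t \<Longrightarrow> t \<le> \<tau> \<Longrightarrow> fst (\<phi> t) < d \<or> snd (\<phi> t) < d"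
    "\<And>t. 0 \<le> t \<Longrightarrow> t < \<tau> \<Longrightarrow> fst (\<phi> t) < 1/2" "\<And>t. 0 < t \<Longrightarrow> t \<le> \<tau> \<Longrightarrow> snd (\<phi> t) < 1/2"
    by (rule quarter_passage[OF o st H L0]) blast
  have "\<tau> \<noteq> 0" using \<tau>(2) \<phi>0 s d by auto
  then have "qpass c d \<phi> \<tau>" unfolding qpass_def using o \<tau> by auto
  then have "tr c d s (snd (\<phi> \<tau>))" unfolding tr_def using \<phi>0 \<tau>(2) by (intro exI[of _ \<phi>] exI[of _ \<tau>]) (simp add: prod_eq_iff)
  moreover have "a1 * ln (1/2) + ln (snd (\<phi> \<tau>)) \<le> a1 * ln s + ln (1/2) + 2 * M"
    using gr[OF \<tau>(1) \<tau>(3)] U0 \<tau>(2) by (auto simp: U_def)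
  ultimately show ?thesis by blast
qed

lemma quarter_turn_lower:
  assumes st: "stat c d M k" and sl: "slope c d M a1 a2" and t: "tr c d s s'"
  shows "a2 * ln (1/2) + ln s' \<ge> a2 * ln s + ln (1/2) - 2 * M"
proof -
  obtain \<phi> \<tau> where q: "qpass c d \<phi> \<tau>" "\<phi> 0 = (s, 1/2)" "\<phi> \<tau> = (1/2, s')" using t unfolding tr_def by blast
  then have o: "orbit c \<phi>" and L: "\<And>t. 0 \<le> t \<Longrightarrow> t \<le> \<tau> \<Longrightarrow> \<phi> t \<in> Lreg d" "0 \<le> \<tau>" by (auto simp: qpass_def)
  define U where "U t = - (a2 * ln (fst (\<phi> t)) + ln (snd (\<phi> t)))" for t
  have dU: "(U has_real_derivative - (a2 * Aq c (fst (\<phi> t)) (snd (\<phi> t)) - Bq c (fst (\<phi> t)) (snd (\<phi> t)))) (at t)" for t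
    unfolding U_def using DERIV_minus[OF DERIV_add[OF DERIV_cmult[OF orbit_ln(1)[OF o], of a2] orbit_ln(2)[OF o]]] by simp
  have "U \<tau> - U 0 \<le> 2 * M"
  proof (rule Lreg_growth[OF o st L(2) L(1) dU])
    fix r assume "0 \<le> r" "r \<le> \<tau>"
    then have "(fst (\<phi> r), snd (\<phi> r)) \<in> Lreg d" using L(1)[of r] by simp
    then have "- (M * om c (fst (\<phi> r)) (snd (\<phi> r))) \<le> a2 * Aq c (fst (\<phi> r)) (snd (\<phi> r)) - Bq c (fst (\<phi> r)) (snd (\<phi> r))"
      using sl unfolding slope_def by blast
    then show "- (a2 * Aq c (fst (\<phi> r)) (snd (\<phi> r)) - Bq c (fst (\<phi> r)) (snd (\<phi> r))) \<le> M * om c (fst (\<phi> r)) (snd (\<phi> r))"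
      by linarith
  qed auto
  then show ?thesis using q by (simp add: U_def)
qed

lemma ratio_pos: "good c \<Longrightarrow> ratio c > 0"
  unfolding good_def ratio_def using divide_pos_neg[of "qv (snd c) 0 0" "qv (fst c) (0::real) 0"] by auto

lemma quarter_exists:
  assumes "good c0"
  obtains d0 where "d0 > 0" "d0 \<le> 1/4" "\<And>d. 0 < d \<Longrightarrow> d \<le> d0 \<Longrightarrow> (\<exists>M k. \<forall>\<^sub>F c in nhds c0. stat c d M k)"
    "\<And>d e. 0 < d \<Longrightarrow> d \<le> d0 \<Longrightarrow> e > 0 \<Longrightarrow>
       \<exists>\<sigma>>0. \<forall>\<^sub>F c in nhds c0. \<forall>s. 0 < s \<and> s < \<sigma> \<longrightarrow> (\<exists>s'. s' < e \<and> tr c d s s')"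
proof -
  have r: "ratio c0 > 0" by (rule ratio_pos[OF assms])
  \<comment> \<open>Any exponent between 0 and the ratio serves, since the goal is only that
    \<open>s'\<close> tends to 0 with \<open>s\<close>.\<close>
  define a where "a = ratio c0 / 2"
  have a: "0 < a" "a < ratio c0" "ratio c0 < ratio c0 + 1" using r by (auto simp: a_def)
  obtain d0 M k where d0: "0 < d0" "\<And>d. 0 < d \<Longrightarrow> d \<le> d0 \<Longrightarrow> \<forall>\<^sub>F c in nhds c0. stat c d M k \<and> slope c d M a (ratio c0 + 1)"
    by (rule stat_slope_exists[OF assms a]) blast
  have d04: "min d0 (1/4) > 0" "min d0 (1/4) \<le> d0" using d0 by auto
  show ?thesis
  proof (rule that[OF d04(1)])
    show "\<exists>M k. \<forall>\<^sub>F c in nhds c0. stat c d M k" if "0 < d" "d \<le> min d0 (1/4)" for d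
      using d0(2)[of d] that by (intro exI[of _ M] exI[of _ k]) (auto elim: eventually_mono)
    fix d e :: real assume d: "0 < d" "d \<le> min d0 (1/4)" and e: "e > 0"
    \<comment> \<open>The first entry of the minimum yields the hypothesis \<open>small\<close> of
      \<open>quarter_turn\<close>, the second one yields \<open>s' < e\<close>.\<close>
    define m where "m = min ((a + 1) * ln d) (ln e + a * ln (1/2)) - ln (1/2) - 2 * M - 1"
    define \<sigma> where "\<sigma> = min d (exp (m / a))"
    show "\<exists>\<sigma>>0. \<forall>\<^sub>F c in nhds c0. \<forall>s. 0 < s \<and> s < \<sigma> \<longrightarrow> (\<exists>s'. s' < e \<and> tr c d s s')"
    proof (intro exI conjI)
      show "\<sigma> > 0" using d by (simp add: \<sigma>_def)
      have "\<forall>\<^sub>F c in nhds c0. stat c d M k \<and> slope c d M a (ratio c0 + 1)" using d0(2)[of d] d by simp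
      then show "\<forall>\<^sub>F c in nhds c0. \<forall>s. 0 < s \<and> s < \<sigma> \<longrightarrow> (\<exists>s'. s' < e \<and> tr c d s s')"
      proof eventually_elim
        case (elim c)
        show ?case
        proof (intro allI impI)
          fix s assume s: "0 < s \<and> s < \<sigma>"
          then have "ln s < ln (exp (m / a))" by (subst ln_less_cancel_iff) (auto simp: \<sigma>_def)
          then have as: "a * ln s < m" using a by (simp add: field_simps)
          then have sm: "a * ln s + ln (1/2) + 2 * M < (a + 1) * ln d" unfolding m_def by linarith
          obtain s' where s': "tr c d s s'" "a * ln (1/2) + ln s' \<le> a * ln s + ln (1/2) + 2 * M"
            using quarter_turn[OF conjunct1[OF elim] conjunct2[OF elim] a(1) _ _ sm] s by (auto simp: \<sigma>_def)
          have "ln s' < ln e" using s'(2) as unfolding m_def by linarith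
          then have "s' < e" using tr_pos[OF s'(1)] e by simp
          then show "\<exists>s'. s' < e \<and> tr c d s s'" using s'(1) by blast
        qed
      qed
    qed
  qed auto
qed

lemma quarter_lower:
  assumes "good c" "ratio c < a2"
  obtains d0 where "d0 > 0" "\<And>d. 0 < d \<Longrightarrow> d \<le> d0 \<Longrightarrow> \<exists>C>0. \<forall>s s'. tr c d s s' \<longrightarrow> C * s powr a2 \<le> s'"
proof -
  have r: "ratio c > 0" by (rule ratio_pos[OF assms(1)])
  have a: "0 < ratio c / 2" "ratio c / 2 < ratio c" using r by auto
  obtain d0 M k where d0: "0 < d0" "\<And>d. 0 < d \<Longrightarrow> d \<le> d0 \<Longrightarrow> \<forall>\<^sub>F c' in nhds c. stat c' d M k \<and> slope c' d M (ratio c / 2) a2"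
    by (rule stat_slope_exists[OF assms(1) a assms(2)]) blast
  show ?thesis
  proof (rule that[OF d0(1)])
    fix d assume d: "0 < d" "d \<le> d0"
    have ss: "stat c d M k" "slope c d M (ratio c / 2) a2" using eventually_nhds_x_imp_x[OF d0(2)[OF d]] by auto
    have "exp (ln (1/2) - 2 * M - a2 * ln (1/2)) * s powr a2 \<le> s'" if t: "tr c d s s'" for s s'
    proof -
      have p: "0 < s" "0 < s'" using tr_pos[OF t] by auto
      have "exp (ln (1/2) - 2 * M - a2 * ln (1/2)) * s powr a2 = exp (ln (1/2) - 2 * M - a2 * ln (1/2) + a2 * ln s)"
        using p by (simp add: powr_def flip: exp_add)
      also have "\<dots> \<le> exp (ln s')" using quarter_turn_lower[OF ss t] by (intro iffD2[OF exp_le_cancel_iff]) linarith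
      finally show ?thesis using p by simp
    qed
    then show "\<exists>C>0. \<forall>s s'. tr c d s s' \<longrightarrow> C * s powr a2 \<le> s'"
      by (intro exI[of _ "exp (ln (1/2) - 2 * M - a2 * ln (1/2))"]) simp
  qed
qed

text \<open>The inverse coordinates: with p = (x - y) / (1 - x - y) and r = (1 - x - y) / 2 one has
  x = 1/2 + (p - 1) r and y = 1/2 - (1 + p) r. Here and in the next definitions minus signs are
  written as real coefficients, so that the \<open>cdd\<close> rules for sums, products and
  coefficients apply.\<close>

definition cx :: "real \<Rightarrow> complex \<Rightarrow> complex" where "cx p z = of_real (1/2) + of_real (p - 1) * z"
definition cy :: "real \<Rightarrow> complex \<Rightarrow> complex" where "cy p z = of_real (1/2) + of_real (- 1 - p) * z"
definition cA :: "quad \<times> quad \<Rightarrow> real \<Rightarrow> complex \<Rightarrow> complex" where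
  "cA c p z = (of_real (- 1) + cx p z) * qv (fst c) (cx p z) (cy p z)"
definition cB :: "quad \<times> quad \<Rightarrow> real \<Rightarrow> complex \<Rightarrow> complex" where
  "cB c p z = (of_real 1 + of_real (- 1) * cy p z) * qv (snd c) (cx p z) (cy p z)"

text \<open>The vector field in the coordinates \<open>p = pc (x, y)\<close> and \<open>r = (1 - x - y) / 2\<close> has the
  orbits \<open>dr / dp = cN / cD\<close>, which makes sense for complex \<open>r\<close>.\<close>

definition cN :: "quad \<times> quad \<Rightarrow> real \<Rightarrow> complex \<Rightarrow> complex" where
  "cN c p z = of_real (- 1) * (z * (cx p z * cA c p z + of_real (- 1) * (cy p z * cB c p z)))"
definition cD :: "quad \<times> quad \<Rightarrow> real \<Rightarrow> complex \<Rightarrow> complex" where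
  "cD c p z = of_real (1 + p) * (cx p z * cA c p z) + of_real (1 - p) * (cy p z * cB c p z)"

lemma cdd_cN: "cdd (cN c)" and cdd_cD: "cdd (cD c)"
  unfolding cN_def[abs_def] cD_def[abs_def] cA_def cB_def cx_def cy_def qv_def
  by (intro cdd_add cdd_mult cdd_id cdd_coeff continuous_intros)+

lemma cN_cD_of_real:
  assumes "x = 1/2 + (p - 1) * r" "y = 1/2 + (- 1 - p) * r"
  shows "cN c p (of_real r) = of_real (- (r * (x * Aq c x y - y * Bq c x y)))"
    "cD c p (of_real r) = of_real ((1 + p) * (x * Aq c x y) + (1 - p) * (y * Bq c x y))"
proof -
  have x: "cx p (of_real r) = of_real x" and y: "cy p (of_real r) = of_real y"
    by (simp_all add: cx_def cy_def assms)
  have q: "qv q (of_real x :: complex) (of_real y) = of_real (qv q x y)" for q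
    by (simp add: qv_def)
  have "cA c p (of_real r) = of_real (Aq c x y)" "cB c p (of_real r) = of_real (Bq c x y)"
    unfolding cA_def cB_def x y q Aq_def Bq_def by (simp_all add: algebra_simps)
  then show "cN c p (of_real r) = of_real (- (r * (x * Aq c x y - y * Bq c x y)))"
    "cD c p (of_real r) = of_real ((1 + p) * (x * Aq c x y) + (1 - p) * (y * Bq c x y))"
    unfolding cN_def cD_def x y by simp_all
qed

lemma quotient_field_exists:
  obtains Nd Dd where "quotient_field (cN c) (cD c) Nd Dd"
proof -
  obtain Nd where Nd: "continuous_on UNIV (\<lambda>u. Nd (fst u) (fst (snd u)) (snd (snd u)))"
    "\<And>p z1 z2. cN c p z1 - cN c p z2 = Nd p z1 z2 * (z1 - z2)" using cdd_cN[of c] unfolding cdd_def by blast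
  obtain Dd where Dd: "continuous_on UNIV (\<lambda>u. Dd (fst u) (fst (snd u)) (snd (snd u)))"
    "\<And>p z1 z2. cD c p z1 - cD c p z2 = Dd p z1 z2 * (z1 - z2)" using cdd_cD[of c] unfolding cdd_def by blast
  have "quotient_field (cN c) (cD c) Nd Dd"
    by unfold_locales (use Nd Dd cdd_cN[of c] cdd_cD[of c] in \<open>auto simp: cdd_def\<close>)
  then show ?thesis by (rule that)
qed

text \<open>The end points are included, with one-sided derivatives, because \<open>csol\<close> is
  a condition on a closed interval.\<close>

lemma inverse_function_derivative:
  fixes P P' :: "real \<Rightarrow> real"
  assumes ab: "a < b" and d: "\<And>t. t \<in> {a..b} \<Longrightarrow> (P has_real_derivative P' t) (at t within {a..b})"
    and pos: "\<And>t. t \<in> {a..b} \<Longrightarrow> P' t > 0"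
  obtains q where "\<And>p. p \<in> {P a..P b} \<Longrightarrow> q p \<in> {a..b} \<and> P (q p) = p" "q (P a) = a" "q (P b) = b"
    "\<And>p. p \<in> {P a..P b} \<Longrightarrow> (q has_real_derivative 1 / P' (q p)) (at p within {P a..P b})"
proof -
  have cP: "continuous_on {a..b} P"
    using d by (meson DERIV_continuous continuous_on_eq_continuous_within)
  have mono: "P s < P t" if "s \<in> {a..b}" "t \<in> {a..b}" "s < t" for s t
  proof (rule DERIV_pos_imp_increasing_open[OF that(3)])
    show "\<exists>y. (P has_real_derivative y) (at x) \<and> y > 0" if "s < x" "x < t" for x
    proof -
      have x: "x \<in> {a..b}" "x \<in> {a<..<b}" using that \<open>s \<in> {a..b}\<close> \<open>t \<in> {a..b}\<close> by auto
      then have "(P has_real_derivative P' x) (at x)" using d[OF x(1)] by (simp add: at_within_Icc_at)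
      then show ?thesis using pos[OF x(1)] by blast
    qed
    show "continuous_on {s..t} P" by (rule continuous_on_subset[OF cP]) (use that in auto)
  qed
  have inj: "inj_on P {a..b}" by (rule inj_onI) (metis mono linorder_neqE_linordered_idom less_irrefl)
  have le: "P s \<le> P t" if "s \<in> {a..b}" "t \<in> {a..b}" "s \<le> t" for s t
    using mono[of s t] that by (cases "s = t") auto
  have im: "P ` {a..b} = {P a..P b}"
  proof
    show "P ` {a..b} \<subseteq> {P a..P b}" using le ab by auto
    show "{P a..P b} \<subseteq> P ` {a..b}"
      using IVT'[of P a _ b] cP ab by (auto simp: image_iff) (metis atLeastAtMost_iff)
  qed
  define q where "q = the_inv_into {a..b} P"
  have qP: "q (P t) = t" if "t \<in> {a..b}" for t unfolding q_def by (rule the_inv_into_f_f[OF inj that])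
  have Pq: "q p \<in> {a..b} \<and> P (q p) = p" if "p \<in> {P a..P b}" for p using that qP unfolding im[symmetric] by auto
  have cq: "continuous_on {P a..P b} q"
    unfolding im[symmetric] by (rule continuous_on_inv[OF cP]) (use qP in auto)
  show ?thesis
  proof (rule that[OF Pq])
    show "q (P a) = a" "q (P b) = b" using qP ab by auto
    fix p assume p: "p \<in> {P a..P b}"
    let ?F = "at p within {P a..P b}"
    have "((\<lambda>t. (P t - P (q p)) / (t - q p)) \<longlongrightarrow> P' (q p)) (at (q p) within {a..b})"
      using d[of "q p"] Pq[OF p] by (simp add: has_field_derivative_iff)
    moreover have "filterlim q (at (q p) within {a..b}) ?F"
      unfolding filterlim_at
    proof
      show "(q \<longlongrightarrow> q p) ?F" using cq p by (simp add: continuous_on_def)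
      show "\<forall>\<^sub>F x in ?F. q x \<in> {a..b} \<and> q x \<noteq> q p"
        unfolding eventually_at_filter by (intro always_eventually) (metis Pq p)
    qed
    ultimately have "((\<lambda>x. (P (q x) - P (q p)) / (q x - q p)) \<longlongrightarrow> P' (q p)) ?F"
      by (rule filterlim_compose)
    then have "((\<lambda>x. 1 / ((P (q x) - P (q p)) / (q x - q p))) \<longlongrightarrow> 1 / P' (q p)) ?F"
      by (intro tendsto_intros) (use pos[OF conjunct1[OF Pq[OF p]]] in auto)
    moreover have "\<forall>\<^sub>F x in ?F. 1 / ((P (q x) - P (q p)) / (q x - q p)) = (q x - q p) / (x - p)"
      unfolding eventually_at_filter by (intro always_eventually) (use Pq p in auto)
    ultimately have "((\<lambda>x. (q x - q p) / (x - p)) \<longlongrightarrow> 1 / P' (q p)) ?F" by (rule Lim_transform_eventually)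
    then show "(q has_real_derivative 1 / P' (q p)) ?F" by (simp add: has_field_derivative_iff)
  qed
qed

text \<open>\<open>pc\<close> increases strictly from -1 on \<open>y = 1/2\<close> to 1 on
  \<open>x = 1/2\<close>, so it can replace the time. All passages are thereby parametrised by the
  same interval, whatever their duration.\<close>

lemma tr_csol:
  assumes st: "stat c d M k" and t: "tr c d s s'"
  obtains r where "csol (cN c) (cD c) (-1) 1 (\<lambda>p. of_real (r p))" "r (-1) = (1/2 - s) / 2" "r 1 = (1/2 - s') / 2"
proof -
  obtain \<phi> \<tau> where q: "qpass c d \<phi> \<tau>" "\<phi> 0 = (s, 1/2)" "\<phi> \<tau> = (1/2, s')" using t unfolding tr_def by blast
  then have o: "orbit c \<phi>" and L: "\<And>t. t \<in> {0..\<tau>} \<Longrightarrow> \<phi> t \<in> Lreg d" and \<tau>: "0 < \<tau>" by (auto simp: qpass_def)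
  have d: "d \<le> 1/4" using st by (simp add: stat_def)
  have s: "0 < s" "s < 1/2" "0 < s'" "s' < 1/2" using tr_pos[OF t] by auto
  define X Y where "X t = fst (\<phi> t)" and "Y t = snd (\<phi> t)" for t
  define P where "P t = pc (\<phi> t)" for t
  define P' where "P' t = 2 * om c (X t) (Y t) / (1 - X t - Y t)\<^sup>2" for t
  have g: "1 - X t - Y t > 0" "om c (X t) (Y t) > 0" if "t \<in> {0..\<tau>}" for t
    using pc_bounds(1)[OF L[OF that] d] orbitD(3,5)[OF o, of t] st L[OF that] unfolding stat_def X_def Y_def by auto
  have dP: "(P has_real_derivative P' t) (at t within {0..\<tau>})" if "t \<in> {0..\<tau>}" for t
    unfolding P_def P'_def X_def Y_def
    by (rule has_field_derivative_at_within[OF pc_deriv[OF o]]) (use g[OF that] in \<open>simp add: X_def Y_def\<close>)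
  have pP: "P' t > 0" if "t \<in> {0..\<tau>}" for t using g[OF that] by (simp add: P'_def)
  have Pe: "P 0 = -1" "P \<tau> = 1" using s q by (auto simp: P_def pc_def field_simps)
  obtain Q where Q: "\<And>p. p \<in> {-1..1} \<Longrightarrow> Q p \<in> {0..\<tau>} \<and> P (Q p) = p" "Q (-1) = 0" "Q 1 = \<tau>"
    "\<And>p. p \<in> {-1..1} \<Longrightarrow> (Q has_real_derivative 1 / P' (Q p)) (at p within {-1..1})"
    using inverse_function_derivative[OF \<tau> dP pP] unfolding Pe by blast
  define R where "R t = (1 - X t - Y t) / 2" for t
  have dR: "(R has_real_derivative - (X t * Aq c (X t) (Y t) - Y t * Bq c (X t) (Y t)) / 2) (at t)" for t
  proof -
    have "((\<lambda>t. (1 - X t - Y t) / 2) has_real_derivative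
        (0 - X t * Aq c (X t) (Y t) - - (Y t * Bq c (X t) (Y t))) / 2) (at t)"
      unfolding X_def Y_def by (intro DERIV_cdivide DERIV_diff DERIV_const orbitD o)
    then show ?thesis by (simp add: R_def[abs_def])
  qed
  define r where "r p = R (Q p)" for p
  have "csol (cN c) (cD c) (-1) 1 (\<lambda>p. of_real (r p))"
    unfolding csol_def
  proof
    fix p :: real assume p: "p \<in> {-1..1}"
    define t where "t = Q p"
    have t: "t \<in> {0..\<tau>}" "P t = p" using Q(1)[OF p] by (auto simp: t_def)
    define x y where "x = X t" and "y = Y t"
    define A B where "A = Aq c x y" and "B = Bq c x y"
    have gt: "1 - x - y > 0" "om c x y > 0" using g[OF t(1)] by (auto simp: x_def y_def)
    have rp: "r p = (1 - x - y) / 2" by (simp add: r_def R_def x_def y_def t_def)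
    have pr: "(1 - x - y) * p = x - y" using t(2) gt(1) by (simp add: P_def pc_def x_def y_def X_def Y_def field_simps)
    have xy: "x = 1/2 + (p - 1) * r p" "y = 1/2 + (- 1 - p) * r p"
      unfolding rp using pr by (simp_all add: field_simps)
    \<comment> \<open>The denominator \<open>cD\<close> is \<open>om\<close> divided by
      \<open>r\<close>, hence nonzero along the passage.\<close>
    have Dom: "(1 - x - y) / 2 * ((1 + p) * (x * A) + (1 - p) * (y * B)) = om c x y"
    proof -
      define h where "h = (1 - x - y) / 2"
      have hp: "h * p = (x - y) / 2" using pr by (simp add: h_def)
      have e: "h + h * p = 1/2 - y" "h - h * p = 1/2 - x" unfolding hp by (simp_all add: h_def field_simps)
      have "h * ((1 + p) * (x * A) + (1 - p) * (y * B)) = (h + h * p) * (x * A) + (h - h * p) * (y * B)"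
        by (simp add: algebra_simps)
      then show ?thesis unfolding e by (simp add: om_def A_def B_def h_def mult_ac)
    qed
    define Dv where "Dv = (1 + p) * (x * A) + (1 - p) * (y * B)"
    have Dv: "Dv \<noteq> 0" using Dom gt by (auto simp: Dv_def)
    have om: "om c x y = (1 - x - y) / 2 * Dv" using Dom by (simp add: Dv_def)
    have eN: "cN c p (of_real (r p)) = of_real (- (r p * (x * A - y * B)))"
      and eD: "cD c p (of_real (r p)) = of_real Dv"
      using cN_cD_of_real[OF xy, of c] by (simp_all add: A_def B_def Dv_def)
    have "(r has_real_derivative (- (x * A - y * B) / 2) * (1 / P' t)) (at p within {-1..1})"
      unfolding r_def using DERIV_chain2[OF dR[of "Q p"] Q(4)[OF p]] by (simp add: x_def y_def A_def B_def t_def)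
    moreover have "(- (x * A - y * B) / 2) * (1 / P' t) = - (r p * (x * A - y * B)) / Dv"
    proof -
      have "(- e / 2) * (1 / (2 * (h / 2 * Dv) / h\<^sup>2)) = - (h / 2 * e) / Dv" if "h > 0" for e h :: real
        using that Dv by (simp add: field_simps power2_eq_square)
      from this[OF gt(1), of "x * A - y * B"] show ?thesis
        unfolding P'_def x_def[symmetric] y_def[symmetric] om rp .
    qed
    ultimately have "(r has_real_derivative - (r p * (x * A - y * B)) / Dv) (at p within {-1..1})" by simp
    then have "((\<lambda>p. complex_of_real (r p)) has_vector_derivative of_real (- (r p * (x * A - y * B)) / Dv)) (at p within {-1..1})"
      by (rule has_vector_derivative_of_real)
    then show "cD c p (of_real (r p)) \<noteq> 0 \<and>
      ((\<lambda>p. complex_of_real (r p)) has_vector_derivative cN c p (of_real (r p)) / cD c p (of_real (r p))) (at p within {-1..1})"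
      unfolding eN eD using Dv by simp
  qed
  moreover have "r (-1) = (1/2 - s) / 2" "r 1 = (1/2 - s') / 2"
    using Q(2,3) q by (auto simp: r_def R_def X_def Y_def)
  ultimately show ?thesis by (rule that)
qed

lemma tr_analytic:
  assumes st: "stat c d M k" and t: "tr c d s0 s0'"
  shows "\<exists>e g. e > 0 \<and> g holomorphic_on ball (of_real s0) e \<and>
    (\<forall>s s'. tr c d s s' \<and> \<bar>s - s0\<bar> < e \<longrightarrow> g (of_real s) = of_real s')"
proof -
  obtain Nd Dd where "quotient_field (cN c) (cD c) Nd Dd" by (rule quotient_field_exists)
  then interpret quotient_field "cN c" "cD c" Nd Dd .
  obtain r where r: "csol (cN c) (cD c) (-1) 1 (\<lambda>p. of_real (r p))" "r (-1) = (1/2 - s0) / 2" "r 1 = (1/2 - s0') / 2"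
    by (rule tr_csol[OF st t])
  obtain e g where eg: "e > 0" "g holomorphic_on ball (of_real (r (-1))) e"
    "\<And>\<zeta>. csol (cN c) (cD c) (-1) 1 \<zeta> \<Longrightarrow> \<zeta> (-1) \<in> ball (of_real (r (-1))) e \<Longrightarrow> g (\<zeta> (-1)) = \<zeta> 1"
    using holomorphic_dependence[OF _ r(1)] by auto
  define G where "G s = 1/2 - 2 * g ((1/2 - s) / 2)" for s
  have "G holomorphic_on ball (of_real s0) (2 * e)"
    unfolding G_def
  proof (intro holomorphic_intros holomorphic_on_compose_gen[OF _ eg(2), unfolded o_def])
    show "(\<lambda>s. (1/2 - s) / 2) ` ball (of_real s0) (2 * e) \<subseteq> ball (complex_of_real (r (-1))) e"
    proof clarsimp
      fix s :: complex assume "dist (of_real s0) s < 2 * e"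
      moreover have "dist (complex_of_real (r (-1))) ((1/2 - s) / 2) = dist (of_real s0) s / 2"
      proof -
        have "complex_of_real (r (-1)) - (1/2 - s) / 2 = - (of_real s0 - s) / 2"
          by (simp add: r(2) field_simps)
        then show ?thesis by (simp only: dist_norm norm_divide norm_minus_cancel) simp
      qed
      ultimately show "dist (complex_of_real (r (-1))) ((1/2 - s) / 2) < e" by simp
    qed
  qed auto
  moreover have "G (of_real s) = of_real s'" if ss: "tr c d s s' \<and> \<bar>s - s0\<bar> < 2 * e" for s s'
  proof -
    obtain u where u: "csol (cN c) (cD c) (-1) 1 (\<lambda>p. of_real (u p))" "u (-1) = (1/2 - s) / 2" "u 1 = (1/2 - s') / 2"
      by (rule tr_csol[OF st conjunct1[OF ss]])
    have "dist (complex_of_real (r (-1))) (of_real (u (-1))) < e"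
      unfolding r(2) u(2) dist_of_real dist_real_def using ss by (auto simp: abs_if field_simps split: if_splits)
    then have "g (of_real (u (-1))) = of_real (u 1)" using eg(3)[OF u(1)] by simp
    moreover have "(1/2 - complex_of_real s) / 2 = of_real (u (-1))" unfolding u by simp
    ultimately have "G (of_real s) = 1/2 - 2 * of_real (u 1)" by (simp only: G_def)
    then show ?thesis unfolding u by (simp add: field_simps)
  qed
  ultimately show ?thesis using eg(1) by (intro exI[of _ "2 * e"] exI[of _ G]) auto
qed

text \<open>A reversal of order would make the two solutions meet at some \<open>p\<close>, and
  solutions that meet have the same initial value.\<close>

lemma tr_strict_mono:
  assumes st: "stat c d M k" and t: "tr c d s1 s1'" "tr c d s2 s2'" and s: "s1 < s2"
  shows "s1' < s2'"
proof (rule ccontr)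
  assume n: "\<not> s1' < s2'"
  obtain Nd Dd where "quotient_field (cN c) (cD c) Nd Dd" by (rule quotient_field_exists)
  then interpret quotient_field "cN c" "cD c" Nd Dd .
  obtain r1 where r1: "csol (cN c) (cD c) (-1) 1 (\<lambda>p. of_real (r1 p))" "r1 (-1) = (1/2 - s1) / 2" "r1 1 = (1/2 - s1') / 2"
    by (rule tr_csol[OF st t(1)])
  obtain r2 where r2: "csol (cN c) (cD c) (-1) 1 (\<lambda>p. of_real (r2 p))" "r2 (-1) = (1/2 - s2) / 2" "r2 1 = (1/2 - s2') / 2"
    by (rule tr_csol[OF st t(2)])
  have c: "continuous_on {-1..1} r1" "continuous_on {-1..1} r2"
    using csol_continuous[OF r1(1)] csol_continuous[OF r2(1)] continuous_on_Re by force+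
  have "\<exists>p\<ge>-1. p \<le> 1 \<and> r1 p - r2 p = 0"
    by (intro IVT2' continuous_intros c) (use n s r1 r2 in auto)
  then obtain p where "p \<in> {-1..1}" "complex_of_real (r1 p) = of_real (r2 p)" by auto
  from csol_unique[OF r1(1) r2(1) this] show False using s by (simp add: r1 r2)
qed

section \<open>The return map near the boundary\<close>

text \<open>\<open>rot\<close> takes the end point \<open>(1/2, s1)\<close> of a quarter turn to
  \<open>(s1, 1/2)\<close>, so every turn is read at the corner \<open>(0, 0)\<close> of a rotated
  field. Four turns give the return relation of the section \<open>y = 1/2\<close>.\<close>

fun rets :: "nat \<Rightarrow> quad \<times> quad \<Rightarrow> real \<Rightarrow> real \<Rightarrow> real \<Rightarrow> bool" where
  "rets 0 c d s s' \<longleftrightarrow> s' = s"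
| "rets (Suc n) c d s s' \<longleftrightarrow> (\<exists>s1. tr c d s s1 \<and> rets n (rotc c) d s1 s')"

fun stats :: "nat \<Rightarrow> quad \<times> quad \<Rightarrow> real \<Rightarrow> bool" where
  "stats 0 c d \<longleftrightarrow> True"
| "stats (Suc n) c d \<longleftrightarrow> (\<exists>M k. stat c d M k) \<and> stats n (rotc c) d"

fun ratios :: "nat \<Rightarrow> quad \<times> quad \<Rightarrow> real" where
  "ratios 0 c = 1"
| "ratios (Suc n) c = ratio c * ratios n (rotc c)"

lemma rets_unique: "rets n c d s s1 \<Longrightarrow> rets n c d s s2 \<Longrightarrow> s1 = s2"
proof (induction n arbitrary: c s)
  case (Suc n)
  obtain t1 t2 where "tr c d s t1" "rets n (rotc c) d t1 s1" "tr c d s t2" "rets n (rotc c) d t2 s2"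
    using Suc.prems by auto
  then show ?case using tr_unique[of c d s t1 t2] Suc.IH by blast
qed simp

lemma rets_mono: "rets n c d s s' \<Longrightarrow> d \<le> d' \<Longrightarrow> rets n c d' s s'"
proof (induction n arbitrary: c s)
  case (Suc n)
  obtain t where t: "tr c d s t" "rets n (rotc c) d t s'" using Suc.prems(1) by auto
  have "tr c d' s t" "rets n (rotc c) d' t s'" using tr_mono[OF t(1) Suc.prems(2)] Suc.IH[OF t(2) Suc.prems(2)] .
  then show ?case by auto
qed simp

lemma rets_strict_mono: "stats n c d \<Longrightarrow> rets n c d s1 s1' \<Longrightarrow> rets n c d s2 s2' \<Longrightarrow> s1 < s2 \<Longrightarrow> s1' < s2'"
proof (induction n arbitrary: c s1 s2)
  case (Suc n)
  obtain M k where st: "stat c d M k" "stats n (rotc c) d" using Suc.prems(1) by auto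
  obtain t1 t2 where t: "tr c d s1 t1" "rets n (rotc c) d t1 s1'" "tr c d s2 t2" "rets n (rotc c) d t2 s2'"
    using Suc.prems(2,3) by auto
  have "t1 < t2" by (rule tr_strict_mono[OF st(1) t(1,3) Suc.prems(4)])
  then show ?case by (rule Suc.IH[OF st(2) t(2,4)])
qed simp

lemma rets_analytic:
  assumes "stats n c d" "rets n c d s0 s0'"
  shows "\<exists>e g. e > 0 \<and> g holomorphic_on ball (of_real s0) e \<and>
    (\<forall>s s'. rets n c d s s' \<and> \<bar>s - s0\<bar> < e \<longrightarrow> g (of_real s) = of_real s')"
  using assms
proof (induction n arbitrary: c s0)
  case 0
  then show ?case by (intro exI[of _ 1] exI[of _ "\<lambda>z. z"]) (auto intro: holomorphic_intros)
next
  case (Suc n)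
  obtain M k where st: "stat c d M k" "stats n (rotc c) d" using Suc.prems(1) by auto
  obtain t0 where t0: "tr c d s0 t0" "rets n (rotc c) d t0 s0'" using Suc.prems(2) by auto
  obtain e1 g1 where 1: "e1 > 0" "g1 holomorphic_on ball (of_real s0) e1"
    "\<And>s s'. tr c d s s' \<Longrightarrow> \<bar>s - s0\<bar> < e1 \<Longrightarrow> g1 (of_real s) = of_real s'"
    using tr_analytic[OF st(1) t0(1)] by blast
  obtain e2 g2 where 2: "e2 > 0" "g2 holomorphic_on ball (of_real t0) e2"
    "\<And>s s'. rets n (rotc c) d s s' \<Longrightarrow> \<bar>s - t0\<bar> < e2 \<Longrightarrow> g2 (of_real s) = of_real s'"
    using Suc.IH[OF st(2) t0(2)] by blast
  have "g1 (of_real s0) = of_real t0" using 1(1) 1(3)[OF t0(1)] by simp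
  moreover have "isCont g1 (of_real s0)"
    using holomorphic_on_imp_continuous_on[OF 1(2)] 1(1) by (simp add: continuous_on_eq_continuous_at)
  ultimately obtain e3 where e3: "e3 > 0" "\<And>z. dist z (of_real s0) < e3 \<Longrightarrow> dist (g1 z) (of_real t0) < e2"
    using 2(1) unfolding continuous_at_eps_delta by metis
  define e where "e = min e1 e3"
  have "(g2 \<circ> g1) holomorphic_on ball (of_real s0) e"
  proof (rule holomorphic_on_compose_gen[OF _ 2(2)])
    show "g1 holomorphic_on ball (of_real s0) e" by (rule holomorphic_on_subset[OF 1(2)]) (auto simp: e_def)
    show "g1 ` ball (of_real s0) e \<subseteq> ball (of_real t0) e2"
      using e3(2) by (auto simp: e_def dist_commute)
  qed
  moreover have "(g2 \<circ> g1) (of_real s) = of_real s'" if ss: "rets (Suc n) c d s s' \<and> \<bar>s - s0\<bar> < e" for s s'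
  proof -
    obtain t where t: "tr c d s t" "rets n (rotc c) d t s'" using ss by auto
    have g: "g1 (of_real s) = of_real t" using 1(3)[OF t(1)] ss by (simp add: e_def)
    have "dist (complex_of_real s) (of_real s0) < e3" using ss by (simp add: e_def dist_real_def)
    from e3(2)[OF this] have "\<bar>t - t0\<bar> < e2" unfolding g by (simp add: dist_real_def)
    then show ?thesis using g 2(3)[OF t(2)] by simp
  qed
  moreover have "e > 0" using 1(1) e3(1) by (simp add: e_def)
  ultimately show ?case by blast
qed

lemma qrot_eq: "qrot c = (fst c + fst (snd c) + fst (snd (snd (snd c))), fst (snd (snd c)) + fst (snd (snd (snd (snd c)))),
   - fst (snd c) - 2 * fst (snd (snd (snd c))), snd (snd (snd (snd (snd c)))), - fst (snd (snd (snd (snd c)))), fst (snd (snd (snd c))))"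
  by (cases c) (simp add: qrot_def)

lemma filterlim_rotc: "filterlim rotc (nhds (rotc c0)) (nhds c0)"
proof -
  have "continuous_on UNIV rotc" unfolding rotc_def[abs_def] qrot_eq by (intro continuous_intros)
  then have "isCont rotc c0" using continuous_on_eq_continuous_at open_UNIV by blast
  then show ?thesis by (simp add: isCont_def tendsto_at_iff_tendsto_nhds)
qed

lemma rets_exists:
  assumes "good c0"
  shows "\<exists>d0>0. d0 \<le> 1/4 \<and> (\<forall>d. 0 < d \<and> d \<le> d0 \<longrightarrow> (\<forall>\<^sub>F c in nhds c0. stats n c d) \<and>
    (\<forall>e>0. \<exists>\<sigma>>0. \<forall>\<^sub>F c in nhds c0. \<forall>s. 0 < s \<and> s < \<sigma> \<longrightarrow> (\<exists>s'. s' < e \<and> rets n c d s s')))"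
  using assms
proof (induction n arbitrary: c0)
  case 0
  show ?case by (intro exI[of _ "1/4"]) auto
next
  case (Suc n)
  obtain d1 where d1: "d1 > 0" "d1 \<le> 1/4" "\<And>d. 0 < d \<Longrightarrow> d \<le> d1 \<Longrightarrow> (\<exists>M k. \<forall>\<^sub>F c in nhds c0. stat c d M k)"
    "\<And>d e. 0 < d \<Longrightarrow> d \<le> d1 \<Longrightarrow> e > 0 \<Longrightarrow>
       \<exists>\<sigma>>0. \<forall>\<^sub>F c in nhds c0. \<forall>s. 0 < s \<and> s < \<sigma> \<longrightarrow> (\<exists>s'. s' < e \<and> tr c d s s')"
    by (rule quarter_exists[OF Suc.prems]) blast
  obtain d2 where d2: "d2 > 0" "\<And>d. 0 < d \<Longrightarrow> d \<le> d2 \<Longrightarrow> (\<forall>\<^sub>F c in nhds (rotc c0). stats n c d)"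
    "\<And>d e. 0 < d \<Longrightarrow> d \<le> d2 \<Longrightarrow> e > 0 \<Longrightarrow> \<exists>\<sigma>>0. \<forall>\<^sub>F c in nhds (rotc c0). \<forall>s. 0 < s \<and> s < \<sigma> \<longrightarrow> (\<exists>s'. s' < e \<and> rets n c d s s')"
    using Suc.IH[OF good_rotc[OF Suc.prems]] by blast
  show ?case
  proof (rule exI[of _ "min d1 d2"], intro conjI allI impI)
    show "min d1 d2 > 0" "min d1 d2 \<le> 1/4" using d1 d2 by auto
    fix d assume "0 < d \<and> d \<le> min d1 d2"
    then have d: "0 < d" "d \<le> d1" "d \<le> d2" by auto
    have "\<forall>\<^sub>F c in nhds c0. stats n (rotc c) d"
      using eventually_compose_filterlim[OF d2(2)[OF d(1,3)] filterlim_rotc] .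
    moreover obtain M k where "\<forall>\<^sub>F c in nhds c0. stat c d M k" using d1(3)[OF d(1,2)] by blast
    ultimately show "\<forall>\<^sub>F c in nhds c0. stats (Suc n) c d" by eventually_elim auto
    fix e :: real assume e: "e > 0"
    \<comment> \<open>The radii are chosen from the last turn backwards: \<open>\<sigma>2\<close>
      becomes the target of the first turn.\<close>
    obtain \<sigma>2 where s2: "\<sigma>2 > 0" "\<forall>\<^sub>F c in nhds (rotc c0). \<forall>s. 0 < s \<and> s < \<sigma>2 \<longrightarrow> (\<exists>s'. s' < e \<and> rets n c d s s')"
      using d2(3)[OF d(1,3) e] by blast
    obtain \<sigma>1 where s1: "\<sigma>1 > 0" "\<forall>\<^sub>F c in nhds c0. \<forall>s. 0 < s \<and> s < \<sigma>1 \<longrightarrow> (\<exists>s'. s' < \<sigma>2 \<and> tr c d s s')"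
      using d1(4)[OF d(1,2) s2(1)] by blast
    have "\<forall>\<^sub>F c in nhds c0. \<forall>s. 0 < s \<and> s < \<sigma>1 \<longrightarrow> (\<exists>s'. s' < e \<and> rets (Suc n) c d s s')"
      using eventually_compose_filterlim[OF s2(2) filterlim_rotc] s1(2)
    proof eventually_elim
      case (elim c)
      show ?case
      proof (intro allI impI)
        fix s assume "0 < s \<and> s < \<sigma>1"
        then obtain t where t: "t < \<sigma>2" "tr c d s t" using elim(2) by blast
        obtain s' where "s' < e" "rets n (rotc c) d t s'" using t(1) elim(1) tr_pos[OF t(2)] by blast
        moreover from this(2) t(2) have "rets (Suc n) c d s s'" by auto
        ultimately show "\<exists>s'. s' < e \<and> rets (Suc n) c d s s'" by blast
      qed
    qed
    then show "\<exists>\<sigma>>0. \<forall>\<^sub>F c in nhds c0. \<forall>s. 0 < s \<and> s < \<sigma> \<longrightarrow> (\<exists>s'. s' < e \<and> rets (Suc n) c d s s')"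
      using s1(1) by blast
  qed
qed

lemma ratios_pos: "good c \<Longrightarrow> ratios n c > 0"
proof (induction n arbitrary: c)
  case (Suc n)
  then show ?case using ratio_pos[OF Suc.prems] Suc.IH[OF good_rotc[OF Suc.prems]] by simp
qed simp

lemma rets_lower:
  assumes "good c" "ratios n c < \<rho>"
  shows "\<exists>d0>0. \<forall>d. 0 < d \<and> d \<le> d0 \<longrightarrow> (\<exists>C>0. \<forall>s s'. 0 < s \<and> s < 1 \<and> rets n c d s s' \<longrightarrow> C * s powr \<rho> \<le> s')"
  using assms
proof (induction n arbitrary: c \<rho>)
  case 0
  have "s powr \<rho> \<le> s" if "0 < s" "s < 1" for s
    using powr_mono'[of 1 \<rho> s] that 0 by simp
  then show ?case by (intro exI[of _ 1]) (auto intro!: exI[of _ 1])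
next
  case (Suc n)
  define R where "R = ratios n (rotc c)"
  have R: "R > 0" unfolding R_def by (rule ratios_pos[OF good_rotc[OF Suc.prems(1)]])
  have r: "ratio c > 0" by (rule ratio_pos[OF Suc.prems(1)])
  \<comment> \<open>On the logarithmic scale, half of the excess of \<open>\<rho>\<close> over the
    product goes to this corner and half to the remaining ones.\<close>
  define t where "t = sqrt (\<rho> / (ratio c * R))"
  have \<rho>: "\<rho> > ratio c * R" using Suc.prems(2) by (simp add: R_def)
  have t: "t > 1" unfolding t_def using \<rho> R r by simp
  have "\<rho> > 0" using \<rho> R r by (meson less_trans mult_pos_pos)
  then have tt: "t * t = \<rho> / (ratio c * R)" unfolding t_def using R r by simp
  have a2: "ratio c < ratio c * t" and r2: "ratios n (rotc c) < R * t" using r R t by (auto simp flip: R_def)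
  have prod: "(ratio c * t) * (R * t) = \<rho>"
  proof -
    have "(ratio c * t) * (R * t) = (ratio c * R) * (t * t)" by (simp add: mult_ac)
    then show ?thesis unfolding tt using r R by simp
  qed
  obtain d1 where d1: "d1 > 0" "\<And>d. 0 < d \<Longrightarrow> d \<le> d1 \<Longrightarrow> \<exists>C>0. \<forall>s s'. tr c d s s' \<longrightarrow> C * s powr (ratio c * t) \<le> s'"
    by (rule quarter_lower[OF Suc.prems(1) a2]) blast
  obtain d2 where d2: "d2 > 0" "\<And>d. 0 < d \<and> d \<le> d2 \<Longrightarrow> \<exists>C>0. \<forall>s s'. 0 < s \<and> s < 1 \<and> rets n (rotc c) d s s' \<longrightarrow> C * s powr (R * t) \<le> s'"
    using Suc.IH[OF good_rotc[OF Suc.prems(1)] r2] by blast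
  show ?case
  proof (rule exI[of _ "min d1 d2"], intro conjI allI impI)
    show "min d1 d2 > 0" using d1 d2 by simp
    fix d assume "0 < d \<and> d \<le> min d1 d2"
    then have d: "0 < d" "d \<le> d1" "0 < d \<and> d \<le> d2" by auto
    obtain C1 where C1: "C1 > 0" "\<And>s s'. tr c d s s' \<Longrightarrow> C1 * s powr (ratio c * t) \<le> s'" using d1(2)[OF d(1,2)] by blast
    obtain C2 where C2: "C2 > 0" "\<And>s s'. 0 < s \<and> s < 1 \<and> rets n (rotc c) d s s' \<Longrightarrow> C2 * s powr (R * t) \<le> s'" using d2(2)[OF d(3)] by blast
    have "(C2 * C1 powr (R * t)) * s powr \<rho> \<le> s'" if s: "0 < s \<and> s < 1 \<and> rets (Suc n) c d s s'" for s s'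
    proof -
      obtain s1 where s1: "tr c d s s1" "rets n (rotc c) d s1 s'" using s by auto
      have p: "0 < s1" "s1 < 1" using tr_pos[OF s1(1)] by auto
      have "(C2 * C1 powr (R * t)) * s powr \<rho> = C2 * (C1 * s powr (ratio c * t)) powr (R * t)"
      proof -
        have "(s powr (ratio c * t)) powr (R * t) = s powr \<rho>" by (simp only: powr_powr prod)
        then show ?thesis using C1(1) by (simp add: powr_mult)
      qed
      also have "\<dots> \<le> C2 * s1 powr (R * t)"
        using C1 C2(1) s1(1) R t by (intro mult_left_mono powr_mono2) auto
      also have "\<dots> \<le> s'" using C2(2)[of s1 s'] p s1(2) by simp
      finally show ?thesis .
    qed
    then show "\<exists>C>0. \<forall>s s'. 0 < s \<and> s < 1 \<and> rets (Suc n) c d s s' \<longrightarrow> C * s powr \<rho> \<le> s'"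
      using C1(1) C2(1) by (intro exI[of _ "C2 * C1 powr (R * t)"]) (auto simp del: rets.simps)
  qed
qed

section \<open>Orbits during a full turn\<close>

definition collar :: "real \<Rightarrow> (real \<times> real) set" where
  "collar d = {z \<in> usq. fst z < d \<or> snd z < d \<or> 1 - fst z < d \<or> 1 - snd z < d}"

definition ledge :: "(real \<times> real) set" where
  "ledge = {0} \<times> {0..1/2} \<union> {0..1/2} \<times> {0}"

definition section_half :: "(real \<times> real) set" where
  "section_half = {0<..<1/2} \<times> {1/2}"

lemma rets_pos: "rets (Suc n) c d s s' \<Longrightarrow> 0 < s \<and> s < 1/2 \<and> 0 < s' \<and> s' < 1/2"
proof (induction n arbitrary: c s)
  case 0
  then show ?case using tr_pos[of c d s s'] by simp
next
  case (Suc n)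
  then obtain s1 where "tr c d s s1" "rets (Suc n) (rotc c) d s1 s'" unfolding rets.simps(2)[of "Suc n"] by blast
  then show ?case using tr_pos[of c d s s1] Suc.IH[of "rotc c" s1] by blast
qed

lemma rot_collar: "rot z \<in> collar d \<longleftrightarrow> z \<in> collar d"
  by (auto simp: rot_def collar_def usq_def mem_Times_iff)

lemma dist_rot: "dist (rot a) (rot b) = dist a b"
  by (simp add: rot_def dist_prod_def dist_real_def add.commute power2_commute)

lemma rot4: "rot (rot (rot (rot z))) = z"
  by (simp add: rot_def)

lemma square_boundary_eq: "square_boundary = {0..1} \<times> {0..1} - usq"
  unfolding square_boundary_def usq_def frontier_def by (simp add: closure_Times interior_Times)

lemma square_boundary_frames:
  assumes "b \<in> square_boundary"
  shows "b \<in> ledge \<or> rot b \<in> ledge \<or> rot (rot b) \<in> ledge \<or> rot (rot (rot b)) \<in> ledge"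
proof -
  obtain x y where b: "b = (x, y)" by (cases b)
  have r: "0 \<le> x" "x \<le> 1" "0 \<le> y" "y \<le> 1" using assms by (auto simp: square_boundary_eq b)
  have "\<not> (0 < x \<and> x < 1 \<and> 0 < y \<and> y < 1)" using assms by (auto simp: square_boundary_eq b usq_def)
  then consider "x = 0" | "x = 1" | "y = 0" | "y = 1" using r by linarith
  then show ?thesis
  proof cases
    case 1 with r show ?thesis by (cases "y \<le> 1/2") (simp_all add: b ledge_def rot_def)
  next
    case 2 with r show ?thesis by (cases "y \<le> 1/2") (simp_all add: b ledge_def rot_def)
  next
    case 3 with r show ?thesis by (cases "x \<le> 1/2") (simp_all add: b ledge_def rot_def)
  next
    case 4 with r show ?thesis by (cases "x \<le> 1/2") (simp_all add: b ledge_def rot_def)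
  qed
qed

text \<open>The last clause prepares the Hausdorff distance: during the passage each coordinate
  takes all values between \<open>d\<close> and \<open>1/2\<close>, and while one coordinate is at
  least \<open>d\<close> the other is below \<open>d\<close>.\<close>

lemma quarter_traj:
  assumes t: "tr c d s s'" and o: "orbit c \<phi>" and \<phi>: "\<phi> t0 = (s, 1/2)" and d: "0 < d" "d \<le> 1/4"
  obtains \<tau> where "\<tau> > t0" "\<phi> \<tau> = (1/2, s')"
    "\<And>t. t0 \<le> t \<Longrightarrow> t \<le> \<tau> \<Longrightarrow> \<phi> t \<in> Lreg d \<and> (fst (\<phi> t) < d \<or> snd (\<phi> t) < d)"
    "\<And>t. t0 \<le> t \<Longrightarrow> t < \<tau> \<Longrightarrow> fst (\<phi> t) < 1/2" "\<And>t. t0 < t \<Longrightarrow> t \<le> \<tau> \<Longrightarrow> snd (\<phi> t) < 1/2"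
    "\<And>b. b \<in> ledge \<Longrightarrow> \<exists>t. t0 \<le> t \<and> t \<le> \<tau> \<and> dist b (\<phi> t) \<le> 2 * d"
proof -
  obtain \<psi> \<sigma> where q: "qpass c d \<psi> \<sigma>" "\<psi> 0 = (s, 1/2)" "\<psi> \<sigma> = (1/2, s')" using t unfolding tr_def by blast
  have eq: "\<phi> (t + t0) = \<psi> t" for t
    using orbit_unique[OF orbit_shift[OF o, of t0], of \<psi> 0 t] q \<phi> by (auto simp: qpass_def)
  then have eq': "\<phi> t = \<psi> (t - t0)" for t by (metis diff_add_cancel)
  define \<tau> where "\<tau> = t0 + \<sigma>"
  have s1: "\<tau> > t0" "\<phi> \<tau> = (1/2, s')" using q by (auto simp: \<tau>_def eq' qpass_def)
  have s2: "\<phi> t \<in> Lreg d \<and> (fst (\<phi> t) < d \<or> snd (\<phi> t) < d)" if "t0 \<le> t" "t \<le> \<tau>" for t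
    using q(1) that by (auto simp: \<tau>_def eq' qpass_def)
  have s3: "fst (\<phi> t) < 1/2" if "t0 \<le> t" "t < \<tau>" for t
    using q(1) that by (auto simp: \<tau>_def eq' qpass_def)
  have s4: "snd (\<phi> t) < 1/2" if "t0 < t" "t \<le> \<tau>" for t
    using q(1) that by (auto simp: \<tau>_def eq' qpass_def)
  have sd: "s < d" "s' < d" using s2[of t0] s2[of \<tau>] s1 \<phi> d by auto
  have c1: "continuous_on {t0..\<tau>} (\<lambda>t. fst (\<phi> t))" "continuous_on {t0..\<tau>} (\<lambda>t. snd (\<phi> t))"
    by (intro continuous_intros orbit_continuous[OF o])+
  have dp: "dist b z \<le> \<bar>fst b - fst z\<bar> + \<bar>snd b - snd z\<bar>" for b z :: "real \<times> real"
    unfolding dist_prod_def dist_real_def by (simp add: sqrt_sum_squares_le_sum_abs)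
  have s5: "\<exists>t. t0 \<le> t \<and> t \<le> \<tau> \<and> dist b (\<phi> t) \<le> 2 * d" if b: "b \<in> ledge" for b
  proof (cases "fst b = 0")
    case True
    \<comment> \<open>Clipped at \<open>d\<close>, because the orbit descends only to some
      \<open>s' < d\<close> and because \<open>x\<close> is small only as long as \<open>y\<close>
      is at least \<open>d\<close>.\<close>
    define y where "y = max d (snd b)"
    have y: "d \<le> y" "y \<le> 1/2" "\<bar>snd b - y\<bar> \<le> d" using b d by (auto simp: y_def ledge_def)
    have "\<exists>t\<ge>t0. t \<le> \<tau> \<and> snd (\<phi> t) = y"
      by (rule IVT2'[OF _ _ _ c1(2)]) (use s1 \<phi> sd y in auto)
    then obtain t where t: "t0 \<le> t" "t \<le> \<tau>" "snd (\<phi> t) = y" by blast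
    have "0 \<le> fst (\<phi> t)" "fst (\<phi> t) \<le> d" using s2[OF t(1,2)] t(3) y(1) by (auto simp: Lreg_def)
    then have "dist b (\<phi> t) \<le> 2 * d" using dp[of b "\<phi> t"] True t(3) y(3) by simp
    then show ?thesis using t by blast
  next
    case False
    then have b0: "snd b = 0" "0 \<le> fst b" "fst b \<le> 1/2" using b by (auto simp: ledge_def)
    define x where "x = max d (fst b)"
    have x: "d \<le> x" "x \<le> 1/2" "\<bar>fst b - x\<bar> \<le> d" using b0 d by (auto simp: x_def)
    have "\<exists>t\<ge>t0. t \<le> \<tau> \<and> fst (\<phi> t) = x"
      by (rule IVT'[OF _ _ _ c1(1)]) (use s1 \<phi> sd x in auto)
    then obtain t where t: "t0 \<le> t" "t \<le> \<tau>" "fst (\<phi> t) = x" by blast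
    have "0 \<le> snd (\<phi> t)" "snd (\<phi> t) \<le> d" using s2[OF t(1,2)] t(3) x(1) by (auto simp: Lreg_def)
    then have "dist b (\<phi> t) \<le> 2 * d" using dp[of b "\<phi> t"] b0 t(3) x(3) by simp
    then show ?thesis using t by blast
  qed
  show ?thesis by (rule that[OF s1 s2 s3 s4 s5])
qed

lemma return_traj:
  assumes r: "rets 4 c d s s'" and o: "orbit c \<phi>" and \<phi>: "\<phi> t0 = (s, 1/2)" and d: "0 < d" "d \<le> 1/4"
  obtains \<tau> where "\<tau> > t0" "\<phi> \<tau> = (s', 1/2)" "\<And>t. t0 \<le> t \<Longrightarrow> t \<le> \<tau> \<Longrightarrow> \<phi> t \<in> collar d"
    "\<And>t. t0 < t \<Longrightarrow> t < \<tau> \<Longrightarrow> \<phi> t \<notin> section_half"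
    "\<And>b. b \<in> square_boundary \<Longrightarrow> \<exists>t. t0 \<le> t \<and> t \<le> \<tau> \<and> dist b (\<phi> t) \<le> 2 * d"
proof -
  obtain s1 s2 s3 where t: "tr c d s s1" "tr (rotc c) d s1 s2" "tr (rotc (rotc c)) d s2 s3" "tr (rotc (rotc (rotc c))) d s3 s'"
    using r by (auto simp: numeral_eq_Suc)
  define f1 f2 f3 where "f1 t = rot (\<phi> t)" and "f2 t = rot (rot (\<phi> t))" and "f3 t = rot (rot (rot (\<phi> t)))" for t
  have o1: "orbit (rotc c) f1" using orbit_rot[OF o] by (simp add: f1_def[abs_def])
  have o2: "orbit (rotc (rotc c)) f2" using orbit_rot[OF o1] by (simp add: f1_def[abs_def] f2_def[abs_def])
  have o3: "orbit (rotc (rotc (rotc c))) f3" using orbit_rot[OF o2] by (simp add: f3_def[abs_def] f2_def[abs_def])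
  obtain a where a: "a > t0" "\<phi> a = (1/2, s1)"
    "\<And>t. t0 \<le> t \<Longrightarrow> t \<le> a \<Longrightarrow> \<phi> t \<in> Lreg d \<and> (fst (\<phi> t) < d \<or> snd (\<phi> t) < d)"
    "\<And>t. t0 \<le> t \<Longrightarrow> t < a \<Longrightarrow> fst (\<phi> t) < 1/2" "\<And>t. t0 < t \<Longrightarrow> t \<le> a \<Longrightarrow> snd (\<phi> t) < 1/2"
    "\<And>b. b \<in> ledge \<Longrightarrow> \<exists>t. t0 \<le> t \<and> t \<le> a \<and> dist b (\<phi> t) \<le> 2 * d"
    by (rule quarter_traj[OF t(1) o \<phi> d]) blast
  have i1: "f1 a = (s1, 1/2)" by (simp add: f1_def a(2) rot_def)
  obtain a1 where a1: "a1 > a" "f1 a1 = (1/2, s2)"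
    "\<And>t. a \<le> t \<Longrightarrow> t \<le> a1 \<Longrightarrow> f1 t \<in> Lreg d \<and> (fst (f1 t) < d \<or> snd (f1 t) < d)"
    "\<And>t. a \<le> t \<Longrightarrow> t < a1 \<Longrightarrow> fst (f1 t) < 1/2" "\<And>t. a < t \<Longrightarrow> t \<le> a1 \<Longrightarrow> snd (f1 t) < 1/2"
    "\<And>b. b \<in> ledge \<Longrightarrow> \<exists>t. a \<le> t \<and> t \<le> a1 \<and> dist b (f1 t) \<le> 2 * d"
    by (rule quarter_traj[OF t(2) o1 i1 d]) blast
  have "f2 t = rot (f1 t)" "f3 t = rot (f2 t)" "\<phi> t = rot (f3 t)" for t by (simp_all add: f1_def f2_def f3_def rot4)
  note ff = this
  have i2: "f2 a1 = (s2, 1/2)" unfolding ff a1(2) by (simp add: rot_def)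
  obtain a2 where a2: "a2 > a1" "f2 a2 = (1/2, s3)"
    "\<And>t. a1 \<le> t \<Longrightarrow> t \<le> a2 \<Longrightarrow> f2 t \<in> Lreg d \<and> (fst (f2 t) < d \<or> snd (f2 t) < d)"
    "\<And>t. a1 \<le> t \<Longrightarrow> t < a2 \<Longrightarrow> fst (f2 t) < 1/2" "\<And>t. a1 < t \<Longrightarrow> t \<le> a2 \<Longrightarrow> snd (f2 t) < 1/2"
    "\<And>b. b \<in> ledge \<Longrightarrow> \<exists>t. a1 \<le> t \<and> t \<le> a2 \<and> dist b (f2 t) \<le> 2 * d"
    by (rule quarter_traj[OF t(3) o2 i2 d]) blast
  have i3: "f3 a2 = (s3, 1/2)" unfolding ff(2) a2(2) by (simp add: rot_def)
  obtain a3 where a3: "a3 > a2" "f3 a3 = (1/2, s')"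
    "\<And>t. a2 \<le> t \<Longrightarrow> t \<le> a3 \<Longrightarrow> f3 t \<in> Lreg d \<and> (fst (f3 t) < d \<or> snd (f3 t) < d)"
    "\<And>t. a2 \<le> t \<Longrightarrow> t < a3 \<Longrightarrow> fst (f3 t) < 1/2" "\<And>t. a2 < t \<Longrightarrow> t \<le> a3 \<Longrightarrow> snd (f3 t) < 1/2"
    "\<And>b. b \<in> ledge \<Longrightarrow> \<exists>t. a2 \<le> t \<and> t \<le> a3 \<and> dist b (f3 t) \<le> 2 * d"
    by (rule quarter_traj[OF t(4) o3 i3 d]) blast
  have sq: "\<phi> t \<in> usq" "f1 t \<in> usq" "f2 t \<in> usq" "f3 t \<in> usq" for t using o o1 o2 o3 by (auto simp: orbit_def)
  show ?thesis
  proof (rule that)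
    show "a3 > t0" using a a1 a2 a3 by simp
    show "\<phi> a3 = (s', 1/2)" unfolding ff(3) a3(2) by (simp add: rot_def)
    show "\<phi> t \<in> collar d" if "t0 \<le> t" "t \<le> a3" for t
    proof -
      consider "t \<le> a" | "a \<le> t" "t \<le> a1" | "a1 \<le> t" "t \<le> a2" | "a2 \<le> t" using that by linarith
      then have "\<phi> t \<in> collar d \<or> f1 t \<in> collar d \<or> f2 t \<in> collar d \<or> f3 t \<in> collar d"
        using a(3)[of t] a1(3)[of t] a2(3)[of t] a3(3)[of t] sq[of t] that
        by cases (auto simp: collar_def)
      then show ?thesis by (auto simp: f1_def f2_def f3_def rot_collar)
    qed
    \<comment> \<open>In the first frame the section is excluded by \<open>y < 1/2\<close> after the
      start, in the next two because it lies outside the quarter square, and in the last one by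
      \<open>x < 1/2\<close> before the end.\<close>
    show "\<phi> t \<notin> section_half" if "t0 < t" "t < a3" for t
    proof
      assume "\<phi> t \<in> section_half"
      then obtain \<sigma> where \<sigma>: "\<phi> t = (\<sigma>, 1/2)" "0 < \<sigma>" "\<sigma> < 1/2" by (auto simp: section_half_def)
      have e: "f1 t = (1/2, 1 - \<sigma>)" "f2 t = (1 - \<sigma>, 1/2)" "f3 t = (1/2, \<sigma>)"
        by (simp_all add: f1_def f2_def f3_def \<sigma>(1) rot_def)
      consider "t \<le> a" | "a \<le> t" "t \<le> a1" | "a1 \<le> t" "t \<le> a2" | "a2 \<le> t" using that by linarith
      then show False
        using a(5)[of t] a1(3)[of t] a2(3)[of t] a3(4)[of t] that \<sigma> e by cases (auto simp: Lreg_def)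
    qed
    show "\<exists>t. t0 \<le> t \<and> t \<le> a3 \<and> dist b (\<phi> t) \<le> 2 * d" if b: "b \<in> square_boundary" for b
    proof -
      have dr: "dist (rot b) (f1 t) = dist b (\<phi> t)" "dist (rot (rot b)) (f2 t) = dist b (\<phi> t)"
        "dist (rot (rot (rot b))) (f3 t) = dist b (\<phi> t)" for t by (simp_all add: f1_def f2_def f3_def dist_rot)
      have m: "\<exists>t. t0 \<le> t \<and> t \<le> a3 \<and> P t" if "\<exists>t. u \<le> t \<and> t \<le> v \<and> P t" "t0 \<le> u" "v \<le> a3" for u v P
        using that by (meson order_trans)
      from square_boundary_frames[OF b] consider "b \<in> ledge" | "rot b \<in> ledge" | "rot (rot b) \<in> ledge" | "rot (rot (rot b)) \<in> ledge"
        by blast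
      then show ?thesis
      proof cases
        case 1 show ?thesis by (rule m[OF a(6)[OF 1]]) (use a a1 a2 a3 in auto)
      next
        case 2 show ?thesis by (rule m[OF a1(6)[OF 2, unfolded dr]]) (use a a1 a2 a3 in auto)
      next
        case 3 show ?thesis by (rule m[OF a2(6)[OF 3, unfolded dr]]) (use a a1 a2 a3 in auto)
      next
        case 4 show ?thesis by (rule m[OF a3(6)[OF 4, unfolded dr]]) (use a a1 a2 a3 in auto)
      qed
    qed
  qed
qed

section \<open>The boundary of the square as a polycycle\<close>

definition coef :: "param \<Rightarrow> quad \<times> quad" where
  "coef \<mu> = (case \<mu> of (l1, l2, l3, l4, m1) \<Rightarrow>
     ((- 1, - (l3 - 1), 1, 0, - (l1 - l3), l1), (l2, - (l2 + m1), - (l2 - 1), m1 - 1, l2 - l4, 0)))"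

lemma vfield_eq: "vfield \<mu> = kf (coef \<mu>)"
proof
  fix z
  obtain l1 l2 l3 l4 m1 where \<mu>: "\<mu> = (l1, l2, l3, l4, m1)" by (metis prod.exhaust)
  show "vfield \<mu> z = kf (coef \<mu>) z"
    by (cases z) (simp add: \<mu> kf_def coef_def qv_def power2_eq_square algebra_simps)
qed

text \<open>On each edge the cofactor is affine, with modulus 1 at one end and one of the parameters
  at the other. So positive parameters orient the boundary, and the four hyperbolicity ratios are
  \<open>l2\<close>, \<open>l3\<close>, \<open>l4\<close> and \<open>l1\<close>.\<close>

lemma coef_edges:
  fixes t :: real
  shows "qv (fst (coef (l1, l2, l3, l4, m1))) t 0 = - ((1 - t) + l3 * t)"
    "qv (fst (coef (l1, l2, l3, l4, m1))) t 1 = l1 * (1 - t) + t"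
    "qv (snd (coef (l1, l2, l3, l4, m1))) 0 t = l2 * (1 - t) + t"
    "qv (snd (coef (l1, l2, l3, l4, m1))) 1 t = - ((1 - t) + l4 * t)"
  by (simp_all add: coef_def qv_def algebra_simps)

lemma convex_pos: "a > 0 \<Longrightarrow> 0 \<le> t \<Longrightarrow> t \<le> 1 \<Longrightarrow> a * (1 - t) + t > (0::real)"
  and convex_pos': "a > 0 \<Longrightarrow> 0 \<le> t \<Longrightarrow> t \<le> 1 \<Longrightarrow> (1 - t) + a * t > (0::real)"
  by (cases "t = 1"; auto intro!: add_pos_nonneg mult_pos_pos)
    (cases "t = 0"; auto intro!: add_nonneg_pos mult_pos_pos)

lemma good_coef:
  assumes "\<mu> \<in> param_set" shows "good (coef \<mu>)"
proof -
  obtain l1 l2 l3 l4 m1 where \<mu>: "\<mu> = (l1, l2, l3, l4, m1)" by (metis prod.exhaust)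
  have "l1 > 0" "l2 > 0" "l3 > 0" "l4 > 0" using assms by (auto simp: \<mu> param_set_def)
  then have "0 < l1 * (1 - t) + t" "0 < l2 * (1 - t) + t" "0 < (1 - t) + l3 * t" "0 < (1 - t) + l4 * t"
    if "0 \<le> t \<and> t \<le> 1" for t using that by (auto intro: convex_pos convex_pos' simp del: less_diff_eq)
  then show ?thesis unfolding \<mu> good_def coef_edges by force
qed

lemma ratios_coef: "ratios 4 (coef (l1, l2, l3, l4, m1)) = l2 * l3 * l4 * l1"
  by (simp add: numeral_eq_Suc ratio_def rotc_def qv_qrot qv_uminus coef_edges mult.assoc)

lemma nonneg_preserved:
  fixes w w' :: "real \<Rightarrow> real"
  assumes der: "\<And>t. t \<in> {a..b} \<Longrightarrow> (w has_vector_derivative w' t) (at t within {a..b})"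
    and bd: "\<And>t. t \<in> {a..b} \<Longrightarrow> \<bar>w' t\<bar> \<le> C * \<bar>w t\<bar>"
    and s: "s \<in> {a..b}" "w s \<ge> 0" and t: "t \<in> {a..b}"
  shows "w t \<ge> 0"
proof (rule ccontr)
  assume n: "\<not> w t \<ge> 0"
  have c: "continuous_on {a..b} w"
    using der by (meson continuous_on_eq_continuous_within has_vector_derivative_continuous)
  have "\<exists>r\<in>{min s t..max s t}. w r = 0"
  proof (cases "s \<le> t")
    case True
    then show ?thesis using IVT2'[of w t 0 s] continuous_on_subset[OF c, of "{s..t}"] n s t by (force simp: min_def max_def)
  next
    case False
    then show ?thesis using IVT'[of w t 0 s] continuous_on_subset[OF c, of "{t..s}"] n s t by (force simp: min_def max_def)
  qed
  then obtain r where r: "r \<in> {min s t..max s t}" "w r = 0" by blast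
  then have rab: "r \<in> {a..b}" using s t by auto
  have "w t = 0" by (rule zero_preserved[OF der bd rab t r(2)])
  then show False using n by simp
qed

text \<open>Each of \<open>x\<close>, \<open>1 - x\<close>, \<open>y\<close>, \<open>1 - y\<close>
  divides its own derivative, with a quotient that is bounded on the compact interval between the
  two times. So its zeros and its sign persist in both time directions.\<close>

lemma invariant_square_boundary: "invariant_set (kf c) square_boundary"
  unfolding invariant_set_def
proof (intro allI impI image_subsetI)
  fix I \<phi> t0 t assume *: "is_interval I \<and> solution_on (kf c) I \<phi> \<and> t0 \<in> I \<and> \<phi> t0 \<in> square_boundary" and t: "t \<in> I"
  define a b where "a = min t0 t" and "b = max t0 t"
  have ab: "t0 \<in> {a..b}" "t \<in> {a..b}" by (auto simp: a_def b_def)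
  have sub: "{a..b} \<subseteq> I" using * t unfolding a_def b_def is_interval_1 by (auto simp: min_def max_def split: if_splits)
  have d: "(\<phi> has_vector_derivative kf c (\<phi> r)) (at r within {a..b})" if "r \<in> {a..b}" for r
    using * that sub unfolding solution_on_def by (blast intro: has_vector_derivative_within_subset)
  have c\<phi>: "continuous_on {a..b} \<phi>"
    using d by (meson continuous_on_eq_continuous_within has_vector_derivative_continuous)
  have "compact ((\<lambda>r. (\<bar>fst (\<phi> r)\<bar> + \<bar>snd (\<phi> r)\<bar> + 1) * (\<bar>qv (fst c) (fst (\<phi> r)) (snd (\<phi> r))\<bar> + \<bar>qv (snd c) (fst (\<phi> r)) (snd (\<phi> r))\<bar>)) ` {a..b})"
    by (intro compact_continuous_image continuous_intros c\<phi>) auto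
  then obtain C where C: "\<And>r. r \<in> {a..b} \<Longrightarrow> (\<bar>fst (\<phi> r)\<bar> + \<bar>snd (\<phi> r)\<bar> + 1) * (\<bar>qv (fst c) (fst (\<phi> r)) (snd (\<phi> r))\<bar> + \<bar>qv (snd c) (fst (\<phi> r)) (snd (\<phi> r))\<bar>) \<le> C"
    unfolding compact_eq_bounded_closed bounded_iff by fastforce
  have mb: "\<bar>x * y * q\<bar> \<le> C * \<bar>x\<bar>" if "\<bar>y\<bar> \<le> A" "\<bar>q\<bar> \<le> Bd" "A * Bd \<le> C" for x y q A Bd :: real
  proof -
    have "\<bar>y\<bar> * \<bar>q\<bar> \<le> A * Bd" using that by (intro mult_mono) auto
    then have "\<bar>x\<bar> * (\<bar>y\<bar> * \<bar>q\<bar>) \<le> \<bar>x\<bar> * C" using that by (intro mult_left_mono) auto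
    then show ?thesis by (simp add: abs_mult mult_ac)
  qed
  have kx: "\<bar>fst (kf c (\<phi> r))\<bar> \<le> C * \<bar>fst (\<phi> r)\<bar>" "\<bar>- fst (kf c (\<phi> r))\<bar> \<le> C * \<bar>1 - fst (\<phi> r)\<bar>"
    "\<bar>snd (kf c (\<phi> r))\<bar> \<le> C * \<bar>snd (\<phi> r)\<bar>" "\<bar>- snd (kf c (\<phi> r))\<bar> \<le> C * \<bar>1 - snd (\<phi> r)\<bar>" if r: "r \<in> {a..b}" for r
  proof -
    have k1: "fst (kf c z) = fst z * (fst z - 1) * qv (fst c) (fst z) (snd z)"
      "- fst (kf c z) = (1 - fst z) * fst z * qv (fst c) (fst z) (snd z)"
      "snd (kf c z) = snd z * (snd z - 1) * qv (snd c) (fst z) (snd z)"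
      "- snd (kf c z) = (1 - snd z) * snd z * qv (snd c) (fst z) (snd z)" for z
      by (simp_all add: kf_def algebra_simps)
    show "\<bar>fst (kf c (\<phi> r))\<bar> \<le> C * \<bar>fst (\<phi> r)\<bar>" unfolding k1(1) by (rule mb[OF _ _ C[OF r]]) auto
    show "\<bar>- fst (kf c (\<phi> r))\<bar> \<le> C * \<bar>1 - fst (\<phi> r)\<bar>" unfolding k1(2) by (rule mb[OF _ _ C[OF r]]) auto
    show "\<bar>snd (kf c (\<phi> r))\<bar> \<le> C * \<bar>snd (\<phi> r)\<bar>" unfolding k1(3) by (rule mb[OF _ _ C[OF r]]) auto
    show "\<bar>- snd (kf c (\<phi> r))\<bar> \<le> C * \<bar>1 - snd (\<phi> r)\<bar>" unfolding k1(4) by (rule mb[OF _ _ C[OF r]]) auto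
  qed
  have d1: "((\<lambda>t. fst (\<phi> t)) has_vector_derivative fst (kf c (\<phi> r))) (at r within {a..b})"
    and d2: "((\<lambda>t. snd (\<phi> t)) has_vector_derivative snd (kf c (\<phi> r))) (at r within {a..b})" if r: "r \<in> {a..b}" for r
    by (intro bounded_linear.has_vector_derivative[OF bounded_linear_fst d[OF r]]
        bounded_linear.has_vector_derivative[OF bounded_linear_snd d[OF r]])+
  have d1': "((\<lambda>t. 1 - fst (\<phi> t)) has_vector_derivative - fst (kf c (\<phi> r))) (at r within {a..b})"
    and d2': "((\<lambda>t. 1 - snd (\<phi> t)) has_vector_derivative - snd (kf c (\<phi> r))) (at r within {a..b})" if r: "r \<in> {a..b}" for r
    using has_vector_derivative_diff[OF has_vector_derivative_const d1[OF r], of 1]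
      has_vector_derivative_diff[OF has_vector_derivative_const d2[OF r], of 1] by simp_all
  have sb: "z \<in> square_boundary \<longleftrightarrow> 0 \<le> fst z \<and> 0 \<le> 1 - fst z \<and> 0 \<le> snd z \<and> 0 \<le> 1 - snd z \<and>
      (fst z = 0 \<or> 1 - fst z = 0 \<or> snd z = 0 \<or> 1 - snd z = 0)" for z
    by (cases z) (auto simp: square_boundary_eq usq_def)
  have s: "0 \<le> fst (\<phi> t0)" "0 \<le> 1 - fst (\<phi> t0)" "0 \<le> snd (\<phi> t0)" "0 \<le> 1 - snd (\<phi> t0)"
    "fst (\<phi> t0) = 0 \<or> 1 - fst (\<phi> t0) = 0 \<or> snd (\<phi> t0) = 0 \<or> 1 - snd (\<phi> t0) = 0" using * sb by auto
  have "0 \<le> fst (\<phi> t)" by (rule nonneg_preserved[OF d1 kx(1) ab(1) s(1) ab(2)])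
  moreover have "0 \<le> 1 - fst (\<phi> t)" by (rule nonneg_preserved[OF d1' kx(2) ab(1) s(2) ab(2)])
  moreover have "0 \<le> snd (\<phi> t)" by (rule nonneg_preserved[OF d2 kx(3) ab(1) s(3) ab(2)])
  moreover have "0 \<le> 1 - snd (\<phi> t)" by (rule nonneg_preserved[OF d2' kx(4) ab(1) s(4) ab(2)])
  moreover have "fst (\<phi> t) = 0 \<or> 1 - fst (\<phi> t) = 0 \<or> snd (\<phi> t) = 0 \<or> 1 - snd (\<phi> t) = 0"
    using s(5) zero_preserved[OF d1 kx(1) ab(1) ab(2)] zero_preserved[OF d1' kx(2) ab(1) ab(2)]
      zero_preserved[OF d2 kx(3) ab(1) ab(2)] zero_preserved[OF d2' kx(4) ab(1) ab(2)] by blast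
  ultimately show "\<phi> t \<in> square_boundary" using sb by simp
qed

text \<open>At a corner both prefactors \<open>x * (x - 1)\<close> and \<open>y * (y - 1)\<close>
  vanish, so the derivatives of the cofactors drop out and the linear part is diagonal.\<close>

lemma kf_corner_derivative:
  assumes i: "i * (i - 1) = 0" and j: "j * (j - 1) = 0"
  shows "(kf c has_derivative (\<lambda>h. ((2 * i - 1) * qv (fst c) i j * fst h, (2 * j - 1) * qv (snd c) i j * snd h))) (at (i, j))"
proof -
  have qd: "\<exists>D. ((\<lambda>z. qv q (fst z) (snd z)) has_derivative D) (at (i, j))" for q :: quad
    unfolding qv_def by (rule exI) (rule derivative_intros)+
  obtain D1 where D1: "((\<lambda>z. qv (fst c) (fst z) (snd z)) has_derivative D1) (at (i, j))" using qd by blast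
  obtain D2 where D2: "((\<lambda>z. qv (snd c) (fst z) (snd z)) has_derivative D2) (at (i, j))" using qd by blast
  have u: "((\<lambda>z. fst z * (fst z - 1)) has_derivative (\<lambda>h. (2 * i - 1) * fst h)) (at (i, j))"
    and w: "((\<lambda>z. snd z * (snd z - 1)) has_derivative (\<lambda>h. (2 * j - 1) * snd h)) (at (i, j))"
    by (auto intro!: derivative_eq_intros simp: algebra_simps)
  show ?thesis
    unfolding kf_def[abs_def]
    using has_derivative_Pair[OF has_derivative_mult[OF u D1] has_derivative_mult[OF w D2]] i j
    by (simp add: mult_ac)
qed

lemma hyperbolic_saddle_kf:
  assumes g: "good c" and ij: "i = 0 \<or> i = 1" "j = 0 \<or> j = 1"
  shows "hyperbolic_saddle (kf c) (i, j)"
proof -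
  have i0: "i * (i - 1) = 0" and j0: "j * (j - 1) = 0" using ij by auto
  define p q where "p = (2 * i - 1) * qv (fst c) i j" and "q = (2 * j - 1) * qv (snd c) i j"
  have g4: "qv (fst c) (0::real) 0 < 0" "qv (snd c) (0::real) 0 > 0" "qv (fst c) (1::real) 0 < 0" "qv (snd c) (1::real) 0 < 0"
    "qv (fst c) (0::real) 1 > 0" "qv (snd c) (0::real) 1 > 0" "qv (fst c) (1::real) 1 > 0" "qv (snd c) (1::real) 1 < 0"
    using g by (auto simp: good_def)
  have pq: "p < 0 \<and> 0 < q \<or> q < 0 \<and> 0 < p" using ij g4 by (auto simp: p_def q_def)
  let ?A = "\<lambda>h. (p * fst h, q * snd h)"
  have A: "(kf c has_derivative ?A) (at (i, j))"
    unfolding p_def q_def by (rule kf_corner_derivative[OF i0 j0])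
  have X0: "kf c (i, j) = 0" using i0 j0 by (simp add: kf_def zero_prod_def)
  have ev: "?A (1, 0) = p *\<^sub>R (1, 0)" "?A (0, 1) = q *\<^sub>R (0, 1)" "(1::real, 0::real) \<noteq> 0" "(0::real, 1::real) \<noteq> 0"
    by (auto simp: zero_prod_def)
  have "\<exists>a b u v. a < 0 \<and> 0 < b \<and> u \<noteq> 0 \<and> v \<noteq> 0 \<and> ?A u = a *\<^sub>R u \<and> ?A v = b *\<^sub>R v"
    using pq
  proof
    assume "p < 0 \<and> 0 < q"
    then show ?thesis using ev by (intro exI[of _ p] exI[of _ q] exI[of _ "(1, 0)"] exI[of _ "(0, 1)"]) simp
  next
    assume "q < 0 \<and> 0 < p"
    then show ?thesis using ev by (intro exI[of _ q] exI[of _ p] exI[of _ "(0, 1)"] exI[of _ "(1, 0)"]) simp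
  qed
  then show ?thesis unfolding hyperbolic_saddle_def
    using X0 A by (intro conjI exI[of _ ?A]) simp_all
qed

lemma usq_component: "usq \<in> components (- square_boundary)"
  unfolding in_components_maximal
proof (intro conjI allI impI)
  show "usq \<noteq> {}" by (auto simp: usq_def)
  show "usq \<subseteq> - square_boundary" by (auto simp: square_boundary_eq)
  show "connected usq" unfolding usq_def by (intro convex_connected convex_Times) auto
  fix D assume D: "D \<noteq> {} \<and> usq \<subseteq> D \<and> D \<subseteq> - square_boundary \<and> connected D"
  let ?S = "{0..1} \<times> {0..1} :: (real \<times> real) set"
  have "(1/2, 1/2) \<in> usq" by (simp add: usq_def)
  then have "(1/2, 1/2) \<in> D \<inter> ?S" using D by auto
  then have "D \<inter> ?S \<noteq> {}" by blast
  moreover have "D \<inter> frontier ?S = {}" using D by (auto simp: square_boundary_def)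
  ultimately have "D - ?S = {}" using connected_Int_frontier[of D ?S] D by blast
  then have "D \<subseteq> usq" using D unfolding square_boundary_eq by blast
  then show "D = usq" using D by blast
qed

lemma has_return_map_kf:
  assumes g: "good c"
  shows "has_return_map (kf c) usq square_boundary"
proof -
  have g0: "qv (snd c) (0::real) (1/2) > 0" using g unfolding good_def by simp
  have "continuous_on UNIV (\<lambda>s::real. qv (snd c) s (1/2))" by (intro continuous_intros)
  then have "isCont (\<lambda>s::real. qv (snd c) s (1/2)) 0" by (simp add: continuous_on_eq_continuous_at)
  then have "\<forall>\<^sub>F s in nhds (0::real). qv (snd c) s (1/2) > 0"
    using g0 by (metis isCont_def order_tendstoD(1) tendsto_at_iff_tendsto_nhds)
  then obtain r0 where r0: "r0 > 0" "\<And>s::real. \<bar>s\<bar> < r0 \<Longrightarrow> qv (snd c) s (1/2) > 0"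
    unfolding eventually_nhds_metric by (auto simp: dist_real_def)
  \<comment> \<open>\<open>r0\<close> ensures transversality, and \<open>1/2\<close> keeps the
    segment within \<open>section_half\<close>.\<close>
  define r where "r = min r0 (1/2)"
  have r: "r > 0" "r \<le> 1/2" using r0 by (auto simp: r_def)
  let ?q = "(0, 1/2) :: real \<times> real" and ?v = "(1, 0) :: real \<times> real"
  have qv: "?q + s *\<^sub>R ?v = (s, 1/2)" for s by simp
  obtain d0 where d0: "d0 > 0" "d0 \<le> 1/4" "\<And>e. e > 0 \<Longrightarrow> \<exists>\<sigma>>0. \<forall>\<^sub>F c' in nhds c. \<forall>s. 0 < s \<and> s < \<sigma> \<longrightarrow> (\<exists>s'. s' < e \<and> rets 4 c' d0 s s')"
    using rets_exists[OF g, of 4] by blast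
  have ex: "\<exists>\<sigma>>0. \<forall>s. 0 < s \<and> s < \<sigma> \<longrightarrow> (\<exists>s'. s' < e \<and> rets 4 c d0 s s')" if "e > 0" for e
    using d0(3)[OF that] eventually_nhds_x_imp_x by blast
  define P where "P s = (SOME s'. rets 4 c d0 s s')" for s
  have P: "rets 4 c d0 s s' \<Longrightarrow> P s = s'" for s s' unfolding P_def by (metis rets_unique someI)
  have pos: "s' > 0" if "rets 4 c d0 s s'" for s s' using rets_pos[of 3 c d0 s s'] that by (simp add: numeral_eq_Suc)
  have ev: "\<forall>\<^sub>F s in at_right 0. rets 4 c d0 s (P s) \<and> 0 < P s \<and> P s < e \<and> 0 < s \<and> s < r" if e: "e > 0" for e
  proof -
    obtain \<sigma> where \<sigma>: "\<sigma> > 0" "\<And>s. 0 < s \<and> s < \<sigma> \<Longrightarrow> \<exists>s'. s' < e \<and> rets 4 c d0 s s'" using ex[OF e] by blast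
    show ?thesis unfolding eventually_at_right_field
    proof (intro exI[of _ "min \<sigma> r"] conjI allI impI)
      show "0 < min \<sigma> r" using \<sigma> r by simp
      fix s :: real assume s: "0 < s" "s < min \<sigma> r"
      then obtain s' where s': "s' < e" "rets 4 c d0 s s'" using \<sigma>(2)[of s] by auto
      show "rets 4 c d0 s (P s)" "0 < P s" "P s < e" using s' P[OF s'(2)] pos[OF s'(2)] by auto
    qed (auto intro: less_le_trans)
  qed
  have fr: "first_return (kf c) ((\<lambda>s. ?q + s *\<^sub>R ?v) ` {0<..<r}) (?q + s *\<^sub>R ?v) (?q + P s *\<^sub>R ?v)"
    if s: "rets 4 c d0 s (P s) \<and> 0 < P s \<and> P s < r \<and> 0 < s \<and> s < r" for s
  proof -
    have "(s, 1/2) \<in> usq" using s r by (auto simp: usq_def)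
    then obtain \<phi> where o: "orbit c \<phi>" and \<phi>0: "\<phi> 0 = (s, 1/2)" by (rule orbit_exists) blast
    obtain \<tau> where \<tau>: "\<tau> > 0" "\<phi> \<tau> = (P s, 1/2)" "\<And>t. 0 < t \<Longrightarrow> t < \<tau> \<Longrightarrow> \<phi> t \<notin> section_half"
      by (rule return_traj[OF conjunct1[OF s] o \<phi>0 d0(1,2)]) blast
    have sub: "(\<lambda>s. ?q + s *\<^sub>R ?v) ` {0<..<r} \<subseteq> section_half" using r by (auto simp: section_half_def)
    have "solution_on (kf c) {0..\<tau>} \<phi>" using o by (auto simp: solution_on_def orbit_def intro: has_vector_derivative_at_within)
    then show ?thesis unfolding first_return_def qv using \<tau> \<phi>0 sub s
      by (intro conjI exI[of _ \<phi>] exI[of _ \<tau>]) (auto simp: image_iff)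
  qed
  show ?thesis unfolding has_return_map_def
  proof (intro bexI[of _ ?q] exI[of _ ?v] exI[of _ r] conjI allI impI)
    show "?q \<in> square_boundary" by (auto simp: square_boundary_eq usq_def)
    show "?v \<noteq> 0" by (simp add: zero_prod_def)
    show "r > 0" by (rule r)
    show "kf c (?q + s *\<^sub>R ?v) \<notin> span {?v}" if "0 \<le> s \<and> s < r" for s
    proof
      assume "kf c (?q + s *\<^sub>R ?v) \<in> span {?v}"
      then have "snd (kf c (s, 1/2)) = 0" by (auto simp: span_singleton)
      moreover have "qv (snd c) s (1/2) > 0" using r0(2)[of s] that by (simp add: r_def)
      ultimately show False by (simp add: kf_def)
    qed
    show "?q + s *\<^sub>R ?v \<in> usq" if "0 < s \<and> s < r" for s using that r by (auto simp: usq_def)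
    show "\<exists>P. (\<forall>\<^sub>F s in at_right 0. first_return (kf c) ((\<lambda>s. ?q + s *\<^sub>R ?v) ` {0<..<r}) (?q + s *\<^sub>R ?v) (?q + P s *\<^sub>R ?v)) \<and>
        (P \<longlongrightarrow> 0) (at_right 0)"
    proof (intro exI[of _ P] conjI)
      show "\<forall>\<^sub>F s in at_right 0. first_return (kf c) ((\<lambda>s. ?q + s *\<^sub>R ?v) ` {0<..<r}) (?q + s *\<^sub>R ?v) (?q + P s *\<^sub>R ?v)"
        using ev[OF r(1)] by (rule eventually_mono) (rule fr)
      show "(P \<longlongrightarrow> 0) (at_right 0)"
      proof (rule tendstoI)
        fix e :: real assume "e > 0"
        from ev[OF this] show "\<forall>\<^sub>F s in at_right 0. dist (P s) 0 < e" by (rule eventually_mono) simp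
      qed
    qed
  qed
qed

text \<open>The flow on an edge, in a coordinate that runs from saddle to saddle, obeys this
  equation with \<open>b\<close> one of the four positive parameters. By separation of variables the
  solution is the inverse of the time \<open>T\<close>, which is unbounded in both
  directions.\<close>

lemma edge_solution:
  assumes b: "(b::real) > 0"
  obtains y where "\<And>t. 0 < y t" "\<And>t. y t < 1"
    "\<And>t. (y has_real_derivative y t * (1 - y t) * ((1 - y t) + b * y t)) (at t)"
    "(y \<longlongrightarrow> 0) at_bot" "(y \<longlongrightarrow> 1) at_top" "range y = {0<..<1}"
proof -
  define q where "q z = (1 - z) + b * z" for z
  have q: "q z > 0" if "0 \<le> z" "z \<le> 1" for z unfolding q_def by (rule convex_pos'[OF b that])
  \<comment> \<open>The primitive of \<open>1 / F\<close>, by partial fractions.\<close>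
  define T where "T z = ln z - ln (1 - z) / b - ((b - 1) / b) * ln (q z)" for z
  define F where "F z = z * (1 - z) * q z" for z
  have F: "F z > 0" if "0 < z" "z < 1" for z using that q[of z] by (simp add: F_def)
  have dT: "(T has_real_derivative 1 / F z) (at z)" if z: "0 < z" "z < 1" for z
  proof -
    have dq: "(q has_real_derivative (b - 1)) (at z)"
      unfolding q_def[abs_def] by (auto intro!: derivative_eq_intros)
    have "(T has_real_derivative (1 / z - (- 1 / (1 - z)) / b - ((b - 1) / b) * ((b - 1) / q z))) (at z)"
      unfolding T_def[abs_def]
    proof (intro DERIV_diff DERIV_cdivide DERIV_cmult)
      show "(ln has_real_derivative 1 / z) (at z)" using z by (auto intro!: derivative_eq_intros)
      show "((\<lambda>x. ln (1 - x)) has_real_derivative - 1 / (1 - z)) (at z)"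
        using z by (auto intro!: derivative_eq_intros)
      show "((\<lambda>x. ln (q x)) has_real_derivative (b - 1) / q z) (at z)"
        using DERIV_chain2[OF DERIV_ln[OF q] dq] z by (simp add: field_simps)
    qed
    moreover have "1 / z - (- 1 / (1 - z)) / b - ((b - 1) / b) * ((b - 1) / q z) = 1 / F z"
    proof -
      have "q z \<noteq> 0" "z \<noteq> 0" "1 - z \<noteq> 0" using z q[of z] by auto
      then have "1 / z - (- 1 / (1 - z)) / b - ((b - 1) / b) * ((b - 1) / q z) =
          (b * (1 - z) * q z + z * q z - (b - 1) * (b - 1) * z * (1 - z)) / (b * F z)"
        using b unfolding F_def by (simp add: divide_simps) (simp add: algebra_simps)
      also have "b * (1 - z) * q z + z * q z - (b - 1) * (b - 1) * z * (1 - z) = b"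
        unfolding q_def by (simp add: algebra_simps)
      finally show ?thesis using b by simp
    qed
    ultimately show ?thesis by simp
  qed
  have mono: "T z < T w" if "0 < z" "z < w" "w < 1" for z w
    by (rule DERIV_pos_imp_increasing[OF that(2)])
      (use dT F that in \<open>meson divide_pos_pos less_le_trans le_less_trans zero_less_one\<close>)
  have inj: "z = w" if "0 < z" "z < 1" "0 < w" "w < 1" "T z = T w" for z w
    using mono[of z w] mono[of w z] that by (cases z w rule: linorder_cases) auto
  obtain K where K: "\<And>z. 0 \<le> z \<Longrightarrow> z \<le> 1 \<Longrightarrow> \<bar>((b - 1) / b) * ln (q z)\<bar> \<le> K"
  proof -
    have "continuous_on {0..1} (\<lambda>z. ((b - 1) / b) * ln (q z))"
    proof (intro continuous_intros)
      show "continuous_on {0..1} q" unfolding q_def[abs_def] by (intro continuous_intros)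
      show "\<forall>x\<in>{0..1}. q x \<noteq> 0" using q by fastforce
    qed
    then have "compact ((\<lambda>z. ((b - 1) / b) * ln (q z)) ` {0..1})" by (rule compact_continuous_image) simp
    then show ?thesis using that unfolding compact_eq_bounded_closed bounded_iff by force
  qed
  have low: "\<exists>a. 0 < a \<and> a \<le> 1/2 \<and> T a < t" for t
  proof -
    define a where "a = min (1/2) (exp (t - ln 2 / b - K - 1))"
    have a: "0 < a" "a \<le> 1/2" by (auto simp: a_def)
    have "ln a \<le> ln (exp (t - ln 2 / b - K - 1))" using a by (subst ln_le_cancel_iff) (auto simp: a_def)
    then have "ln a \<le> t - ln 2 / b - K - 1" by simp
    moreover have "- ln (1 - a) \<le> ln 2"
    proof -
      have "- ln 2 = ln (1/2::real)" by (simp add: ln_div)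
      also have "\<dots> \<le> ln (1 - a)" using a by (subst ln_le_cancel_iff) auto
      finally show ?thesis by simp
    qed
    then have "- ln (1 - a) / b \<le> ln 2 / b" using b by (intro divide_right_mono) auto
    then have "- (ln (1 - a) / b) \<le> ln 2 / b" by simp
    moreover have "\<bar>((b - 1) / b) * ln (q a)\<bar> \<le> K" using K[of a] a by simp
    ultimately have "T a \<le> t - 1" unfolding T_def by linarith
    then show ?thesis using a by (intro exI[of _ a]) auto
  qed
  have high: "\<exists>a. 1/2 \<le> a \<and> a < 1 \<and> T a > t" for t
  proof -
    define v where "v = min (1/2) (exp (- b * (t + ln 2 + K + 1)))"
    have v: "0 < v" "v \<le> 1/2" by (auto simp: v_def)
    have "ln v \<le> ln (exp (- b * (t + ln 2 + K + 1)))" using v by (subst ln_le_cancel_iff) (auto simp: v_def)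
    then have "t + ln 2 + K + 1 \<le> - ln v / b" using b by (simp add: field_simps)
    moreover have "- ln 2 \<le> ln (1 - v)"
    proof -
      have "- ln 2 = ln (1/2::real)" by (simp add: ln_div)
      also have "\<dots> \<le> ln (1 - v)" using v by (subst ln_le_cancel_iff) auto
      finally show ?thesis .
    qed
    moreover have "- ln v / b = - (ln v / b)" by simp
    moreover have "\<bar>((b - 1) / b) * ln (q (1 - v))\<bar> \<le> K" using K[of "1 - v"] v by simp
    moreover have "T (1 - v) = ln (1 - v) - ln v / b - ((b - 1) / b) * ln (q (1 - v))" by (simp add: T_def)
    ultimately have "T (1 - v) \<ge> t + 1" by linarith
    then show ?thesis using v by (intro exI[of _ "1 - v"]) auto
  qed
  have cT: "continuous_on {a..c} T" if "0 < a" "c < 1" for a c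
    by (rule DERIV_continuous_on[of _ _ "\<lambda>z. 1 / F z"]) (use dT that in \<open>auto intro: has_field_derivative_at_within\<close>)
  have surj: "\<exists>z. 0 < z \<and> z < 1 \<and> T z = t" for t
  proof -
    obtain a c where ac: "0 < a" "a \<le> 1/2" "T a < t" "1/2 \<le> c" "c < 1" "t < T c" using low high by meson
    have "\<exists>z\<ge>a. z \<le> c \<and> T z = t" by (rule IVT'[OF _ _ _ cT]) (use ac in auto)
    then obtain z where z: "a \<le> z" "z \<le> c" "T z = t" by blast
    then have "0 < z" "z < 1" using ac by auto
    then show ?thesis using z(3) by blast
  qed
  define y where "y t = (SOME z. 0 < z \<and> z < 1 \<and> T z = t)" for t
  have y: "0 < y t \<and> y t < 1 \<and> T (y t) = t" for t unfolding y_def by (rule someI_ex[OF surj])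
  have yT: "y (T z) = z" if "0 < z" "z < 1" for z using inj[of "y (T z)" z] y[of "T z"] that by simp
  have dy: "(y has_real_derivative F (y t)) (at t)" for t
  proof -
    obtain a where a: "0 < a" "a < 1/2" "T a < t"
    proof -
      obtain a' where a': "0 < a'" "a' \<le> 1/2" "T a' < t" using low by blast
      have "T (a' / 2) < T a'" by (rule mono) (use a' in auto)
      then show ?thesis using a' that[of "a' / 2"] by simp
    qed
    obtain c where c: "1/2 \<le> c" "c < 1" "t < T c" using high by blast
    have ac: "a < c" using a c by simp
    obtain Q where Q: "\<And>p. p \<in> {T a..T c} \<Longrightarrow> Q p \<in> {a..c} \<and> T (Q p) = p"
      "\<And>p. p \<in> {T a..T c} \<Longrightarrow> (Q has_real_derivative 1 / (1 / F (Q p))) (at p within {T a..T c})"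
    proof (rule inverse_function_derivative[OF ac, of T "\<lambda>z. 1 / F z"])
      show "(T has_real_derivative 1 / F z) (at z within {a..c})" if "z \<in> {a..c}" for z
        using dT[of z] that a c by (auto intro: has_field_derivative_at_within)
      show "0 < 1 / F z" if "z \<in> {a..c}" for z using F[of z] that a c by simp
    qed blast
    have eq: "Q p = y p" if "p \<in> {T a..T c}" for p
    proof (rule inj)
      have "a \<le> Q p" "Q p \<le> c" "T (Q p) = p" using Q(1)[OF that] by simp_all
      then show "0 < Q p" "Q p < 1" "0 < y p" "y p < 1" "T (Q p) = T (y p)" using y[of p] a(1) c(2) by linarith+
    qed
    have t: "t \<in> {T a..T c}" using a c by simp
    have "(Q has_real_derivative F (y t)) (at t)"
      using Q(2)[OF t] a c eq[OF t] by (simp add: at_within_Icc_at)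
    then show ?thesis
      by (rule has_field_derivative_transform_within_open[where S = "{T a<..<T c}"]) (use a c eq in auto)
  qed
  show ?thesis
  proof (rule that)
    show "0 < y t" "y t < 1" for t using y by auto
    show "(y has_real_derivative y t * (1 - y t) * ((1 - y t) + b * y t)) (at t)" for t
      using dy[of t] by (simp add: F_def q_def)
    show "(y \<longlongrightarrow> 0) at_bot"
    proof (rule tendstoI)
      fix e :: real assume e: "e > 0"
      define e' where "e' = min e (1/2)"
      have e': "0 < e'" "e' < 1" "e' \<le> e" using e by (auto simp: e'_def)
      have "y t < e" if "t < T e'" for t
      proof (rule ccontr)
        assume "\<not> y t < e"
        then have "T e' \<le> T (y t)" using mono[of e' "y t"] y[of t] e' by (cases "e' = y t") auto
        then show False using y[of t] that by simp
      qed
      then show "\<forall>\<^sub>F t in at_bot. dist (y t) 0 < e"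
        using y unfolding eventually_at_bot_dense by (intro exI[of _ "T e'"]) (auto simp: dist_real_def abs_of_pos)
    qed
    show "(y \<longlongrightarrow> 1) at_top"
    proof (rule tendstoI)
      fix e :: real assume e: "e > 0"
      define e' where "e' = 1 - min e (1/2)"
      have e': "0 < e'" "e' < 1" "1 - e \<le> e'" using e by (auto simp: e'_def)
      have "y t > 1 - e" if "t > T e'" for t
      proof (rule ccontr)
        assume "\<not> y t > 1 - e"
        then have "T (y t) \<le> T e'" using mono[of "y t" e'] y[of t] e' by (cases "e' = y t") auto
        then show False using y[of t] that by simp
      qed
      then have "\<bar>y t - 1\<bar> < e" if "t > T e'" for t using that y[of t] by force
      then show "\<forall>\<^sub>F t in at_top. dist (y t) 1 < e"
        unfolding eventually_at_top_dense by (intro exI[of _ "T e'"]) (auto simp: dist_real_def)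
    qed
    show "range y = {0<..<1}"
    proof
      show "{0<..<1} \<subseteq> range y" using yT by (metis greaterThanLessThan_iff rangeI subsetI)
    qed (use y in auto)
  qed
qed

lemma polycycle_vfield:
  assumes "\<mu> \<in> param_set"
  shows "polycycle (vfield \<mu>) [(0, 1), (0, 0), (1, 0), (1, 1)] ({0<..<1} \<times> {0<..<1}) square_boundary"
proof -
  obtain l1 l2 l3 l4 m1 where \<mu>: "\<mu> = (l1, l2, l3, l4, m1)" by (metis prod.exhaust)
  have l: "l1 > 0" "l2 > 0" "l3 > 0" "l4 > 0" using assms by (auto simp: \<mu> param_set_def)
  have g: "good (coef \<mu>)" by (rule good_coef[OF assms])
  obtain y0 where y0: "\<And>t. 0 < y0 t" "\<And>t. y0 t < 1"
    "\<And>t. (y0 has_real_derivative y0 t * (1 - y0 t) * ((1 - y0 t) + l2 * y0 t)) (at t)"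
    "(y0 \<longlongrightarrow> 0) at_bot" "(y0 \<longlongrightarrow> 1) at_top" "range y0 = {0<..<1}" by (rule edge_solution[OF l(2)]) blast
  obtain y1 where y1: "\<And>t. 0 < y1 t" "\<And>t. y1 t < 1"
    "\<And>t. (y1 has_real_derivative y1 t * (1 - y1 t) * ((1 - y1 t) + l3 * y1 t)) (at t)"
    "(y1 \<longlongrightarrow> 0) at_bot" "(y1 \<longlongrightarrow> 1) at_top" "range y1 = {0<..<1}" by (rule edge_solution[OF l(3)]) blast
  obtain y2 where y2: "\<And>t. 0 < y2 t" "\<And>t. y2 t < 1"
    "\<And>t. (y2 has_real_derivative y2 t * (1 - y2 t) * ((1 - y2 t) + l4 * y2 t)) (at t)"
    "(y2 \<longlongrightarrow> 0) at_bot" "(y2 \<longlongrightarrow> 1) at_top" "range y2 = {0<..<1}" by (rule edge_solution[OF l(4)]) blast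
  obtain y3 where y3: "\<And>t. 0 < y3 t" "\<And>t. y3 t < 1"
    "\<And>t. (y3 has_real_derivative y3 t * (1 - y3 t) * ((1 - y3 t) + l1 * y3 t)) (at t)"
    "(y3 \<longlongrightarrow> 0) at_bot" "(y3 \<longlongrightarrow> 1) at_top" "range y3 = {0<..<1}" by (rule edge_solution[OF l(1)]) blast
  let ?X = "kf (coef \<mu>)"
  note edges = coef_edges[of l1 l2 l3 l4 m1, folded \<mu>]
  define \<phi> where "\<phi> i t = (if i = 0 then (0, 1 - y0 t) else if i = 1 then (y1 t, 0)
     else if i = 2 then (1, y2 t) else (1 - y3 t, 1))" for i :: nat and t
  have \<phi>': "\<phi> 0 = (\<lambda>t. (0, 1 - y0 t))" "\<phi> 1 = (\<lambda>t. (y1 t, 0))" "\<phi> 2 = (\<lambda>t. (1, y2 t))" "\<phi> 3 = (\<lambda>t. (1 - y3 t, 1))"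
    by (auto simp: \<phi>_def)
  have neg: "((\<lambda>t. 1 - z t) has_real_derivative - D) (at t)" if "(z has_real_derivative D) (at t)" for z D t
    using DERIV_diff[OF DERIV_const that, of 1] by simp
  have pairl: "((\<lambda>t. (k, z t)) has_vector_derivative (0, D)) (at t)" and
    pairr: "((\<lambda>t. (z t, k)) has_vector_derivative (D, 0)) (at t)" if "(z has_real_derivative D) (at t)" for z D t and k :: real
    using that by (auto simp: has_real_derivative_iff_has_vector_derivative intro!: has_vector_derivative_Pair has_vector_derivative_const)
  have c0: "connecting_orbit ?X (\<phi> 0) (0, 1) (0, 0)"
    unfolding connecting_orbit_def solution_on_def \<phi>'
  proof (intro conjI ballI allI)
    have k: "?X (0, 1 - y0 t) = (0, - (y0 t * (1 - y0 t) * ((1 - y0 t) + l2 * y0 t)))" for t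
      by (simp add: kf_def edges algebra_simps)
    show "((\<lambda>t. (0, 1 - y0 t)) has_vector_derivative ?X (0, 1 - y0 t)) (at t)" for t unfolding k by (rule pairl[OF neg[OF y0(3)]])
    show "?X (0, 1 - y0 t) \<noteq> 0" for t
      unfolding k zero_prod_def using y0(1,2)[of t] convex_pos'[OF l(2), of "y0 t"] by simp
    show "((\<lambda>t. (0, 1 - y0 t)) \<longlongrightarrow> (0, 1)) at_bot" "((\<lambda>t. (0, 1 - y0 t)) \<longlongrightarrow> (0, 0)) at_top"
      using tendsto_Pair[OF tendsto_const tendsto_diff[OF tendsto_const y0(4)], of 0 1]
        tendsto_Pair[OF tendsto_const tendsto_diff[OF tendsto_const y0(5)], of 0 1] by simp_all
  qed
  have c1: "connecting_orbit ?X (\<phi> 1) (0, 0) (1, 0)"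
    unfolding connecting_orbit_def solution_on_def \<phi>'
  proof (intro conjI ballI allI)
    have k: "?X (y1 t, 0) = (y1 t * (1 - y1 t) * ((1 - y1 t) + l3 * y1 t), 0)" for t
      by (simp add: kf_def edges algebra_simps)
    show "((\<lambda>t. (y1 t, 0)) has_vector_derivative ?X (y1 t, 0)) (at t)" for t unfolding k by (rule pairr[OF y1(3)])
    show "?X (y1 t, 0) \<noteq> 0" for t
      unfolding k zero_prod_def using y1(1,2)[of t] convex_pos'[OF l(3), of "y1 t"] by simp
    show "((\<lambda>t. (y1 t, 0)) \<longlongrightarrow> (0, 0)) at_bot" "((\<lambda>t. (y1 t, 0)) \<longlongrightarrow> (1, 0)) at_top"
      by (intro tendsto_intros y1)+
  qed
  have c2: "connecting_orbit ?X (\<phi> 2) (1, 0) (1, 1)"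
    unfolding connecting_orbit_def solution_on_def \<phi>'
  proof (intro conjI ballI allI)
    have k: "?X (1, y2 t) = (0, y2 t * (1 - y2 t) * ((1 - y2 t) + l4 * y2 t))" for t
      by (simp add: kf_def edges algebra_simps)
    show "((\<lambda>t. (1, y2 t)) has_vector_derivative ?X (1, y2 t)) (at t)" for t unfolding k by (rule pairl[OF y2(3)])
    show "?X (1, y2 t) \<noteq> 0" for t
      unfolding k zero_prod_def using y2(1,2)[of t] convex_pos'[OF l(4), of "y2 t"] by simp
    show "((\<lambda>t. (1, y2 t)) \<longlongrightarrow> (1, 0)) at_bot" "((\<lambda>t. (1, y2 t)) \<longlongrightarrow> (1, 1)) at_top"
      by (intro tendsto_intros y2)+
  qed
  have c3: "connecting_orbit ?X (\<phi> 3) (1, 1) (0, 1)"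
    unfolding connecting_orbit_def solution_on_def \<phi>'
  proof (intro conjI ballI allI)
    have k: "?X (1 - y3 t, 1) = (- (y3 t * (1 - y3 t) * ((1 - y3 t) + l1 * y3 t)), 0)" for t
      by (simp add: kf_def edges algebra_simps)
    show "((\<lambda>t. (1 - y3 t, 1)) has_vector_derivative ?X (1 - y3 t, 1)) (at t)" for t unfolding k by (rule pairr[OF neg[OF y3(3)]])
    show "?X (1 - y3 t, 1) \<noteq> 0" for t
      unfolding k zero_prod_def using y3(1,2)[of t] convex_pos'[OF l(1), of "y3 t"] by simp
    show "((\<lambda>t. (1 - y3 t, 1)) \<longlongrightarrow> (1, 1)) at_bot" "((\<lambda>t. (1 - y3 t, 1)) \<longlongrightarrow> (0, 1)) at_top"
      using tendsto_Pair[OF tendsto_diff[OF tendsto_const y3(4)] tendsto_const, of 1 1]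
        tendsto_Pair[OF tendsto_diff[OF tendsto_const y3(5)] tendsto_const, of 1 1] by simp_all
  qed
  have r: "range (\<phi> 0) = {0} \<times> {0<..<1}" "range (\<phi> 1) = {0<..<1} \<times> {0}"
    "range (\<phi> 2) = {1} \<times> {0<..<1}" "range (\<phi> 3) = {0<..<1} \<times> {1}"
  proof -
    have im: "(\<lambda>t. 1 - z t) ` UNIV = {0<..<1}" if "range z = {0<..<1}" for z :: "real \<Rightarrow> real"
    proof -
      have "(\<lambda>t. 1 - z t) ` UNIV = (\<lambda>v. 1 - v) ` {0<..<1}" unfolding that[symmetric] by (simp add: image_image)
      also have "\<dots> = {0<..<1}"
      proof
        show "{0<..<1} \<subseteq> (\<lambda>v::real. 1 - v) ` {0<..<1}"
        proof
          fix v :: real assume "v \<in> {0<..<1}"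
          then show "v \<in> (\<lambda>v. 1 - v) ` {0<..<1}" by (intro image_eqI[of _ _ "1 - v"]) auto
        qed
      qed auto
      finally show ?thesis .
    qed
    have pr: "range (\<lambda>t. (k, z t)) = {k} \<times> range z" "range (\<lambda>t. (z t, k)) = range z \<times> {k}" for z :: "real \<Rightarrow> real" and k :: real
      by auto
    show "range (\<phi> 0) = {0} \<times> {0<..<1}" "range (\<phi> 1) = {0<..<1} \<times> {0}"
      "range (\<phi> 2) = {1} \<times> {0<..<1}" "range (\<phi> 3) = {0<..<1} \<times> {1}"
      unfolding \<phi>' pr im[OF y0(6)] im[OF y3(6)] y1(6) y2(6) by simp_all
  qed
  have four: "{..<length [(0::real, 1::real), (0, 0), (1, 0), (1, 1)]} = {0, 1, 2, 3}" by (auto simp: numeral_eq_Suc)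
  let ?ps = "[(0::real, 1::real), (0, 0), (1, 0), (1, 1)]"
  have co: "connecting_orbit ?X (\<phi> i) (?ps ! i) (?ps ! (Suc i mod length ?ps))" if "i < length ?ps" for i
  proof -
    have "i = 0 \<or> i = 1 \<or> i = 2 \<or> i = 3" using that by auto
    then show ?thesis
    proof (elim disjE)
      assume "i = 0" then show ?thesis using c0 by simp
    next
      assume "i = 1" then show ?thesis using c1 by simp
    next
      assume "i = 2" then show ?thesis using c2 by simp
    next
      assume "i = 3" then show ?thesis using c3 by simp
    qed
  qed
  have dj: "disjoint_family_on (\<lambda>i. range (\<phi> i)) {..<length ?ps}"
  proof -
    \<comment> \<open>Reads off the index of the edge from a point, which settles the disjointness
      of all pairs at once.\<close>
    define tag :: "real \<times> real \<Rightarrow> nat" where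
      "tag z = (if fst z = 0 then 0 else if snd z = 0 then 1 else if fst z = 1 then 2 else 3)" for z
    have "tag (\<phi> i t) = i" if "i < 4" for i t
    proof -
      have nz: "y1 t \<noteq> 0" "y2 t \<noteq> 0" "y3 t \<noteq> 0" "y3 t \<noteq> 1" using y1(1) y2(1) y3(1,2) by (metis less_irrefl)+
      have "i = 0 \<or> i = 1 \<or> i = 2 \<or> i = 3" using that by auto
      then show ?thesis using nz by (elim disjE) (simp_all add: \<phi>_def tag_def)
    qed
    then have "i = j" if "i < 4" "j < 4" "\<phi> i t = \<phi> j t'" for i j t t' using that by metis
    then have "range (\<phi> i) \<inter> range (\<phi> j) = {}" if "i < 4" "j < 4" "i \<noteq> j" for i j using that by blast
    then show ?thesis unfolding disjoint_family_on_def by simp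
  qed
  have un: "square_boundary = set ?ps \<union> (\<Union>i<length ?ps. range (\<phi> i))"
  proof -
    have e1: "(\<Union>i<length ?ps. range (\<phi> i)) = {0} \<times> {0<..<1} \<union> {0<..<1} \<times> {0} \<union> {1} \<times> {0<..<1} \<union> {0<..<1} \<times> {1}"
      unfolding four UN_insert r by auto
    have e2: "z \<in> square_boundary \<longleftrightarrow> z \<in> set ?ps \<union> ({0} \<times> {0<..<1} \<union> {0<..<1} \<times> {0} \<union> {1} \<times> {0<..<1} \<union> {0<..<1} \<times> {1})" for z
    proof -
      obtain x y where z: "z = (x, y)" by (cases z)
      have a: "z \<in> square_boundary \<longleftrightarrow> 0 \<le> x \<and> x \<le> 1 \<and> 0 \<le> y \<and> y \<le> 1 \<and> (x = 0 \<or> x = 1 \<or> y = 0 \<or> y = 1)"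
        by (auto simp: square_boundary_eq usq_def z)
      have b: "z \<in> set ?ps \<union> ({0} \<times> {0<..<1} \<union> {0<..<1} \<times> {0} \<union> {1} \<times> {0<..<1} \<union> {0<..<1} \<times> {1}) \<longleftrightarrow>
          (x = 0 \<and> y = 1 \<or> x = 0 \<and> y = 0 \<or> x = 1 \<and> y = 0 \<or> x = 1 \<and> y = 1) \<or>
          ((x = 0 \<and> 0 < y \<and> y < 1 \<or> 0 < x \<and> x < 1 \<and> y = 0) \<or> x = 1 \<and> 0 < y \<and> y < 1) \<or> 0 < x \<and> x < 1 \<and> y = 1"
        unfolding z by (simp del: disj_not1)
      show ?thesis unfolding a b by argo
    qed
    show ?thesis unfolding e1 by (rule set_eqI, rule e2)
  qed
  have cp: "compact square_boundary"
    unfolding square_boundary_def by (intro compact_frontier compact_Times) auto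
  have hs: "\<forall>p\<in>set ?ps. hyperbolic_saddle ?X p" using hyperbolic_saddle_kf[OF g] by simp
  have ex: "\<exists>\<phi>. (\<forall>i<length ?ps. connecting_orbit ?X (\<phi> i) (?ps ! i) (?ps ! (Suc i mod length ?ps))) \<and>
      disjoint_family_on (\<lambda>i. range (\<phi> i)) {..<length ?ps} \<and> square_boundary = set ?ps \<union> (\<Union>i<length ?ps. range (\<phi> i))"
    by (rule exI[of _ \<phi>], intro conjI allI impI co dj un)
  have ne: "?ps \<noteq> []" by simp
  show ?thesis
    unfolding polycycle_def vfield_eq usq_def[symmetric]
    by (intro conjI cp invariant_square_boundary ne hs ex usq_component has_return_map_kf[OF g])
qed

section \<open>Limit cycles from fixed points of the return map\<close>

lemma range_periodic:
  fixes f :: "real \<Rightarrow> 'a"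
  assumes T: "T > 0" and p: "\<And>t. f (t + T) = f t"
  shows "range f = f ` {0..T}"
proof
  have n: "f (t + real k * T) = f t" for t k
  proof (induction k)
    case (Suc k)
    then show ?case using p[of "t + real k * T"] by (simp add: algebra_simps)
  qed simp
  show "range f \<subseteq> f ` {0..T}"
  proof
    fix z assume "z \<in> range f"
    then obtain t where t: "z = f t" by blast
    define m where "m = \<lfloor>t / T\<rfloor>"
    define u where "u = t - of_int m * T"
    have "of_int m \<le> t / T" "t / T < of_int m + 1" by (auto simp: m_def)
    then have u: "u \<in> {0..T}" using T by (auto simp: u_def field_simps)
    have "f t = f u"
    proof (cases "m \<ge> 0")
      case True
      then have "t = u + real (nat m) * T" by (simp add: u_def)
      then show ?thesis using n by metis
    next
      case False
      then have "u = t + real (nat (- m)) * T" by (simp add: u_def)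
      then show ?thesis using n by metis
    qed
    then show "z \<in> f ` {0..T}" using t u by blast
  qed
qed auto

section \<open>Orbits in a collar reach the section\<close>

lemma open_collar: "open (collar d)"
proof -
  have "collar d = usq \<inter> ({z. fst z < d} \<union> {z. snd z < d} \<union> {z. 1 - fst z < d} \<union> {z. 1 - snd z < d})"
    by (auto simp: collar_def)
  moreover have "open usq" unfolding usq_def by (intro open_Times) auto
  moreover have "open ({z. fst z < d} \<union> {z. snd z < d} \<union> {z. 1 - fst z < d} \<union> {z. 1 - snd z < d} :: (real \<times> real) set)"
    by (intro open_Un open_Collect_less continuous_intros)
  ultimately show ?thesis by auto
qed

lemma collar_Lreg:
  assumes "z \<in> collar d" "d \<le> 1/4"
  shows "z \<in> Lreg d \<or> rot z \<in> Lreg d \<or> rot (rot z) \<in> Lreg d \<or> rot (rot (rot z)) \<in> Lreg d"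
proof -
  obtain x y where z: "z = (x, y)" by (cases z)
  have r: "0 < x" "x < 1" "0 < y" "y < 1" "x < d \<or> y < d \<or> 1 - x < d \<or> 1 - y < d"
    using assms(1) by (auto simp: z collar_def usq_def)
  show ?thesis
  proof (cases "x \<le> 1/2")
    case True
    show ?thesis
    proof (cases "y \<le> 1/2")
      case True
      with \<open>x \<le> 1/2\<close> r assms(2) have "z \<in> Lreg d" by (auto simp: z Lreg_def)
      then show ?thesis by blast
    next
      case False
      with True r assms(2) have "rot (rot (rot z)) \<in> Lreg d" by (auto simp: z Lreg_def rot_def)
      then show ?thesis by blast
    qed
  next
    case False
    show ?thesis
    proof (cases "y \<le> 1/2")
      case True
      with False r assms(2) have "rot z \<in> Lreg d" by (auto simp: z Lreg_def rot_def)
      then show ?thesis by blast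
    next
      case F: False
      with False r assms(2) have "rot (rot z) \<in> Lreg d" by (auto simp: z Lreg_def rot_def)
      then show ?thesis by blast
    qed
  qed
qed

text \<open>For an orbit confined to the collar the estimate \<open>stays\<close> is automatic, so
  it passes the corner wherever in \<open>Lreg d\<close> it starts.\<close>

lemma reach_section_step:
  assumes o: "orbit c \<psi>" and col: "range \<psi> \<subseteq> collar d" and st: "stat c d M k" and L: "\<psi> t0 \<in> Lreg d"
  shows "\<exists>t. rot (\<psi> t) \<in> section_half \<and> rot (\<psi> t) \<in> Lreg d"
proof -
  have d: "0 < d" "d \<le> 1/4" using st by (auto simp: stat_def)
  have H: "stays \<psi> d t0"
    unfolding stays_def
  proof (intro allI impI)
    fix t assume t: "t0 \<le> t" "\<forall>s. t0 \<le> s \<and> s \<le> t \<longrightarrow> \<psi> s \<in> Lreg d"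
    then have "\<psi> t \<in> Lreg d" "\<psi> t \<in> collar d" using col by auto
    then show "fst (\<psi> t) < d \<or> snd (\<psi> t) < d" using d by (auto simp: Lreg_def collar_def)
  qed
  obtain \<tau> where \<tau>: "t0 \<le> \<tau>" "fst (\<psi> \<tau>) = 1/2" "\<And>t. t0 \<le> t \<Longrightarrow> t \<le> \<tau> \<Longrightarrow> \<psi> t \<in> Lreg d"
    "\<And>t. t0 \<le> t \<Longrightarrow> t \<le> \<tau> \<Longrightarrow> fst (\<psi> t) < d \<or> snd (\<psi> t) < d"
    by (rule quarter_passage[OF o st H L]) blast
  have "0 < snd (\<psi> \<tau>)" "snd (\<psi> \<tau>) < d" using orbitD(5)[OF o, of \<tau>] \<tau>(4)[of \<tau>] \<tau>(1,2) d by auto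
  then have "rot (\<psi> \<tau>) \<in> section_half \<and> rot (\<psi> \<tau>) \<in> Lreg d"
    using d \<tau>(2) by (simp add: rot_def section_half_def Lreg_def mem_Times_iff)
  then show ?thesis by blast
qed

text \<open>The orbit lies in the corner region of one of the four frames and then passes to the
  next one; the passage in the last frame ends on the section. So every periodic orbit in the collar
  is seen by the return map.\<close>

lemma reach_section:
  assumes o: "orbit c \<psi>" and col: "range \<psi> \<subseteq> collar d" and st: "stats 4 c d" and d: "d \<le> 1/4"
  shows "\<exists>t. \<psi> t \<in> section_half"
proof -
  obtain M0 k0 M1 k1 M2 k2 M3 k3 where s: "stat c d M0 k0" "stat (rotc c) d M1 k1"
    "stat (rotc (rotc c)) d M2 k2" "stat (rotc (rotc (rotc c))) d M3 k3"
    using st by (auto simp: numeral_eq_Suc)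
  define f1 f2 f3 where "f1 t = rot (\<psi> t)" and "f2 t = rot (rot (\<psi> t))" and "f3 t = rot (rot (rot (\<psi> t)))" for t
  have o1: "orbit (rotc c) f1" using orbit_rot[OF o] by (simp add: f1_def[abs_def])
  have o2: "orbit (rotc (rotc c)) f2" using orbit_rot[OF o1] by (simp add: f1_def[abs_def] f2_def[abs_def])
  have o3: "orbit (rotc (rotc (rotc c))) f3" using orbit_rot[OF o2] by (simp add: f3_def[abs_def] f2_def[abs_def])
  have c1: "range f1 \<subseteq> collar d" "range f2 \<subseteq> collar d" "range f3 \<subseteq> collar d"
    using col by (auto simp: f1_def f2_def f3_def rot_collar)
  have a0: "\<exists>t. f1 t \<in> Lreg d" if "\<psi> t \<in> Lreg d" for t
    using reach_section_step[OF o col s(1) that] by (auto simp: f1_def)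
  have a1: "\<exists>t. f2 t \<in> Lreg d" if "f1 t \<in> Lreg d" for t
    using reach_section_step[OF o1 c1(1) s(2) that] by (auto simp: f1_def f2_def)
  have a2: "\<exists>t. f3 t \<in> Lreg d" if "f2 t \<in> Lreg d" for t
    using reach_section_step[OF o2 c1(2) s(3) that] by (auto simp: f3_def f2_def)
  have a3: "\<exists>t. \<psi> t \<in> section_half" if "f3 t \<in> Lreg d" for t
    using reach_section_step[OF o3 c1(3) s(4) that] by (auto simp: f3_def rot4)
  have "\<psi> 0 \<in> collar d" using col by auto
  from collar_Lreg[OF this d] have "\<psi> 0 \<in> Lreg d \<or> f1 0 \<in> Lreg d \<or> f2 0 \<in> Lreg d \<or> f3 0 \<in> Lreg d"
    by (simp add: f1_def f2_def f3_def)
  then show ?thesis using a0 a1 a2 a3 by blast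
qed

section \<open>Fixed points of the analytic return map\<close>

locale return_map =
  fixes c :: "quad \<times> quad" and d \<sigma> :: real and P :: "real \<Rightarrow> real"
  assumes d: "0 < d" "d \<le> 1/4" and st: "stats 4 c d"
    and P: "\<And>s. 0 < s \<Longrightarrow> s < \<sigma> \<Longrightarrow> rets 4 c d s (P s)"
begin

lemma P_eq: "rets 4 c d s s' \<Longrightarrow> 0 < s \<Longrightarrow> s < \<sigma> \<Longrightarrow> P s = s'"
  using P rets_unique by blast

lemma P_mono: "0 < s1 \<Longrightarrow> s1 < s2 \<Longrightarrow> s2 < \<sigma> \<Longrightarrow> P s1 < P s2"
  by (rule rets_strict_mono[OF st P P]) auto

lemma local_extension:
  assumes s: "0 < s0" "s0 < \<sigma>"
  obtains e g where "e > 0" "g holomorphic_on ball (of_real s0) e" "\<And>s. \<bar>s - s0\<bar> < e \<Longrightarrow> 0 < s \<and> s < \<sigma> \<and> g (of_real s) = of_real (P s)"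
proof -
  obtain e g where eg: "e > 0" "g holomorphic_on ball (of_real s0) e"
    "\<And>s s'. rets 4 c d s s' \<Longrightarrow> \<bar>s - s0\<bar> < e \<Longrightarrow> g (of_real s) = of_real s'"
    using rets_analytic[OF st P[OF s]] by blast
  define e' where "e' = Min {e, s0, \<sigma> - s0}"
  have e': "e' > 0" "e' \<le> e" "e' \<le> s0" "e' \<le> \<sigma> - s0" using eg s by (auto simp: e'_def)
  show ?thesis
  proof (rule that[OF e'(1)])
    show "g holomorphic_on ball (of_real s0) e'" by (rule holomorphic_on_subset[OF eg(2)]) (use e' in auto)
    fix s assume s: "\<bar>s - s0\<bar> < e'"
    then have *: "0 < s" "s < \<sigma>" using e' by auto
    then show "0 < s \<and> s < \<sigma> \<and> g (of_real s) = of_real (P s)" using eg(3)[OF P[OF *]] s e' by auto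
  qed
qed

lemma P_isCont: "0 < s \<Longrightarrow> s < \<sigma> \<Longrightarrow> isCont P s"
proof -
  assume s: "0 < s" "s < \<sigma>"
  obtain e g where eg: "e > 0" "g holomorphic_on ball (of_real s) e" "\<And>t. \<bar>t - s\<bar> < e \<Longrightarrow> 0 < t \<and> t < \<sigma> \<and> g (of_real t) = of_real (P t)"
    by (rule local_extension[OF s]) blast
  have "isCont g (of_real s)"
    using holomorphic_on_imp_continuous_on[OF eg(2)] eg(1) by (simp add: continuous_on_eq_continuous_at)
  then have "isCont (\<lambda>t. g (of_real t)) s"
    by (intro isCont_o2[where f = of_real and g = g]) (auto intro!: continuous_intros)
  then have "isCont (\<lambda>t. Re (g (of_real t))) s" unfolding isCont_def by (rule tendsto_Re)
  moreover have "\<forall>\<^sub>F t in nhds s. Re (g (of_real t)) = P t"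
    unfolding eventually_nhds_metric using eg(1,3) by (intro exI[of _ e]) (auto simp: dist_real_def)
  ultimately show ?thesis using isCont_cong[of "\<lambda>t. Re (g (of_real t))" P s] by blast
qed

text \<open>A holomorphic extension of \<open>P s - s\<close> near \<open>s0\<close> either vanishes
  identically or has isolated zeros. The extensions are local, around points of the open interval
  from 0 to \<open>\<sigma>\<close>.\<close>

lemma fixed_dichotomy:
  assumes s: "0 < s0" "s0 < \<sigma>"
  shows "\<exists>e>0. (\<forall>s. \<bar>s - s0\<bar> < e \<longrightarrow> P s = s) \<or> (\<forall>s. \<bar>s - s0\<bar> < e \<and> s \<noteq> s0 \<longrightarrow> P s \<noteq> s)"
proof -
  obtain e g where eg: "e > 0" "g holomorphic_on ball (of_real s0) e" "\<And>s. \<bar>s - s0\<bar> < e \<Longrightarrow> 0 < s \<and> s < \<sigma> \<and> g (of_real s) = of_real (P s)"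
    by (rule local_extension[OF s]) blast
  define f where "f z = g z - z" for z
  have hf: "f holomorphic_on ball (of_real s0) e" unfolding f_def by (intro holomorphic_intros eg)
  have fP: "f (of_real s) = 0 \<longleftrightarrow> P s = s" if "\<bar>s - s0\<bar> < e" for s
    using eg(3)[OF that] by (simp add: f_def flip: of_real_diff)
  have bl: "of_real s \<in> ball (complex_of_real s0) r \<longleftrightarrow> \<bar>s - s0\<bar> < r" for s r by (auto simp: dist_real_def)
  show ?thesis
  proof (cases "\<forall>z\<in>ball (of_real s0) e. f z = 0")
    case True
    then have "P s = s" if "\<bar>s - s0\<bar> < e" for s using fP[OF that] bl[of s e] that by blast
    then show ?thesis using eg(1) by blast
  next
    case False
    then obtain b where b: "b \<in> ball (of_real s0) e" "f b \<noteq> 0" by blast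
    have c0: "complex_of_real s0 \<in> ball (of_real s0) e" using eg(1) by simp
    show ?thesis
    proof (cases "f (of_real s0) = 0")
      case True
      obtain r where r: "0 < r" "ball (complex_of_real s0) r \<subseteq> ball (of_real s0) e"
        "\<And>z. z \<in> ball (of_real s0) r - {of_real s0} \<Longrightarrow> f z \<noteq> 0"
        by (rule isolated_zeros[OF hf open_ball connected_ball c0 True b], rule that)
      have "P s \<noteq> s" if "\<bar>s - s0\<bar> < r" "s \<noteq> s0" for s
      proof -
        have "complex_of_real s \<in> ball (of_real s0) r" using that bl by blast
        moreover from this have "complex_of_real s \<in> ball (of_real s0) e" using r(2) by blast
        moreover have "complex_of_real s \<noteq> of_real s0" using that by simp
        ultimately show ?thesis using r(3)[of "of_real s"] fP[of s] bl[of s e] by blast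
      qed
      then show ?thesis using r(1) by blast
    next
      case F: False
      have "P s0 \<noteq> s0" using fP[of s0] F eg(1) by simp
      moreover have "isCont (\<lambda>s. P s - s) s0" using P_isCont[OF s] by (intro continuous_intros)
      ultimately obtain r where "r > 0" "\<forall>s. dist s0 s < r \<longrightarrow> P s - s \<noteq> 0"
        using continuous_at_avoid[of s0 "\<lambda>s. P s - s" 0] by auto
      then show ?thesis by (intro exI[of _ r]) (auto simp: dist_real_def abs_minus_commute)
    qed
  qed
qed

text \<open>The two alternatives of \<open>fixed_dichotomy\<close> define disjoint open sets that
  cover the interval, which is connected. A single point \<open>s1\<close> that is not fixed rules
  out the first alternative everywhere.\<close>

lemma fixed_isolated:
  assumes s1: "0 < s1" "s1 < \<sigma>" "P s1 \<noteq> s1" and s: "0 < s0" "s0 < \<sigma>"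
  shows "\<exists>e>0. \<forall>s. \<bar>s - s0\<bar> < e \<and> s \<noteq> s0 \<longrightarrow> P s \<noteq> s"
proof (rule ccontr)
  assume n: "\<not> ?thesis"
  define A where "A = {s. \<exists>e>0. \<forall>s'. \<bar>s' - s\<bar> < e \<longrightarrow> P s' = s'}"
  define B where "B = {s. \<exists>e>0. \<forall>s'. \<bar>s' - s\<bar> < e \<and> s' \<noteq> s \<longrightarrow> P s' \<noteq> s'}"
  have AB: "A \<inter> B = {}"
  proof -
    have False if "s \<in> A" "s \<in> B" for s
    proof -
      obtain e1 where e1: "e1 > 0" "\<And>s'. \<bar>s' - s\<bar> < e1 \<Longrightarrow> P s' = s'" using \<open>s \<in> A\<close> by (auto simp: A_def)
      obtain e2 where e2: "e2 > 0" "\<And>s'. \<bar>s' - s\<bar> < e2 \<Longrightarrow> s' \<noteq> s \<Longrightarrow> P s' \<noteq> s'" using \<open>s \<in> B\<close> by (auto simp: B_def)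
      define t where "t = s + min e1 e2 / 2"
      have "\<bar>t - s\<bar> < e1" "\<bar>t - s\<bar> < e2" "t \<noteq> s" using e1(1) e2(1) by (auto simp: t_def)
      then show False using e1 e2 by blast
    qed
    then show ?thesis by blast
  qed
  have oA: "open A" unfolding open_dist
  proof
    fix s assume "s \<in> A"
    then obtain e where e: "e > 0" "\<And>s'. \<bar>s' - s\<bar> < e \<Longrightarrow> P s' = s'" by (auto simp: A_def)
    show "\<exists>e>0. \<forall>y. dist y s < e \<longrightarrow> y \<in> A"
    proof (intro exI[of _ "e/2"] conjI allI impI)
      fix y assume y: "dist y s < e / 2"
      have "P s' = s'" if "\<bar>s' - y\<bar> < e/2" for s'
      proof (rule e(2))
        show "\<bar>s' - s\<bar> < e" using that y unfolding dist_real_def by arith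
      qed
      then show "y \<in> A" unfolding A_def using e(1) by (intro CollectI exI[of _ "e/2"]) auto
    qed (use e in simp)
  qed
  have oB: "open B" unfolding open_dist
  proof
    fix s assume "s \<in> B"
    then obtain e where e: "e > 0" "\<And>s'. \<bar>s' - s\<bar> < e \<Longrightarrow> s' \<noteq> s \<Longrightarrow> P s' \<noteq> s'" by (auto simp: B_def)
    show "\<exists>e>0. \<forall>y. dist y s < e \<longrightarrow> y \<in> B"
    proof (intro exI[of _ e] conjI allI impI)
      fix y assume y: "dist y s < e"
      show "y \<in> B"
      proof (cases "y = s")
        case True then show ?thesis using \<open>s \<in> B\<close> by simp
      next
        case False
        define e' where "e' = min (e - \<bar>y - s\<bar>) \<bar>y - s\<bar>"
        have "e' > 0" using False y by (auto simp: e'_def dist_real_def)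
        moreover have "P s' \<noteq> s'" if s': "\<bar>s' - y\<bar> < e'" for s'
        proof (rule e(2))
          have "\<bar>s' - y\<bar> < e - \<bar>y - s\<bar>" "\<bar>s' - y\<bar> < \<bar>y - s\<bar>" using s' by (auto simp: e'_def)
          then show "\<bar>s' - s\<bar> < e" "s' \<noteq> s" by arith+
        qed
        ultimately show ?thesis unfolding B_def by blast
      qed
    qed (use e in simp)
  qed
  have cov: "{0<..<\<sigma>} \<subseteq> A \<union> B"
  proof
    fix s assume "s \<in> {0<..<\<sigma>}"
    then show "s \<in> A \<union> B" using fixed_dichotomy[of s] unfolding A_def B_def by auto
  qed
  have "s0 \<notin> B" using n by (auto simp: B_def)
  moreover have "s1 \<notin> A" using s1(3) unfolding A_def by fastforce
  moreover have "s0 \<in> {0<..<\<sigma>}" "s1 \<in> {0<..<\<sigma>}" using s1 s by auto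
  ultimately have "A \<inter> {0<..<\<sigma>} \<noteq> {}" "B \<inter> {0<..<\<sigma>} \<noteq> {}" using cov by blast+
  then show False using connectedD[OF connected_Ioo oA oB _ cov] AB by blast
qed

text \<open>Isolation of the orbit comes from isolation of the fixed point. \<open>U\<close> is the
  collar with the section blocked except near \<open>s0\<close>. For a periodic orbit in
  \<open>U\<close> the iterates of a crossing under the increasing map \<open>P\<close> form a
  monotone bounded sequence, so they converge to a fixed point, which must be \<open>s0\<close>; the
  orbit is closed and contains the limit. The last conjunct serves to tell two such cycles
  apart.\<close>

theorem limit_cycle_of_fixed_point:
  assumes s0: "0 < s0" "s0 < \<sigma>" "P s0 = s0" and s1: "0 < s1" "s1 < \<sigma>" "P s1 \<noteq> s1"
    and o: "orbit c \<phi>" and \<phi>0: "\<phi> 0 = (s0, 1/2)"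
  shows "limit_cycle (kf c) (range \<phi>) \<and> hausdorff_distance (range \<phi>) square_boundary \<le> 2 * d \<and>
    (\<forall>x. (x, 1/2) \<in> range \<phi> \<and> x < 1/2 \<longrightarrow> x = s0)"
proof -
  have r0: "rets 4 c d s0 s0" using P[OF s0(1,2)] s0(3) by simp
  have s0h: "s0 < 1/2" using rets_pos[of 3 c d s0 s0] r0 by (simp add: numeral_eq_Suc)
  obtain \<tau> where \<tau>: "\<tau> > 0" "\<phi> \<tau> = (s0, 1/2)" "\<And>t. 0 \<le> t \<Longrightarrow> t \<le> \<tau> \<Longrightarrow> \<phi> t \<in> collar d"
    "\<And>t. 0 < t \<Longrightarrow> t < \<tau> \<Longrightarrow> \<phi> t \<notin> section_half"
    "\<And>b. b \<in> square_boundary \<Longrightarrow> \<exists>t. 0 \<le> t \<and> t \<le> \<tau> \<and> dist b (\<phi> t) \<le> 2 * d"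
    by (rule return_traj[OF r0 o \<phi>0 d]) blast
  have per: "\<phi> (t + \<tau>) = \<phi> t" for t
    using orbit_unique[OF orbit_shift[OF o, of \<tau>] o, of 0 t] by (simp add: \<tau>(2) \<phi>0)
  have rng: "range \<phi> = \<phi> ` {0..\<tau>}" by (rule range_periodic[of \<tau> \<phi>, OF \<tau>(1) per])
  have col: "range \<phi> \<subseteq> collar d" unfolding rng using \<tau>(3) by auto
  have sol: "solution_on (kf c) UNIV \<psi>" if "orbit c \<psi>" for \<psi> using that by (auto simp: solution_on_def orbit_def)
  have sbne: "(1, 1/2) \<in> square_boundary" by (simp add: square_boundary_eq usq_def)
  have nonconst: "\<exists>t. \<phi> t \<noteq> \<phi> 0"
  proof (rule ccontr)
    assume "\<not> ?thesis"
    then have "dist (1, 1/2) (s0, 1/2 :: real) \<le> 2 * d" using \<tau>(5)[OF sbne] \<phi>0 by auto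
    then show False using s0h d by (simp add: dist_Pair_Pair dist_real_def)
  qed
  have po: "periodic_orbit (kf c) (range \<phi>)"
    unfolding periodic_orbit_def using \<tau>(1) sol[OF o] per nonconst by blast
  have haus: "hausdorff_distance (range \<phi>) square_boundary \<le> 2 * d"
    unfolding hausdorff_distance_def
  proof (rule max.boundedI)
    show "(SUP b\<in>square_boundary. infdist b (range \<phi>)) \<le> 2 * d"
    proof (rule cSUP_least)
      fix b assume "b \<in> square_boundary"
      then obtain t where "dist b (\<phi> t) \<le> 2 * d" using \<tau>(5) by blast
      then show "infdist b (range \<phi>) \<le> 2 * d" by (meson infdist_le2 rangeI)
    qed (use sbne in blast)
    show "(SUP a\<in>range \<phi>. infdist a square_boundary) \<le> 2 * d"
    proof (rule cSUP_least)
      fix a assume "a \<in> range \<phi>"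
      then have "a \<in> collar d" using col by blast
      then obtain x y where a: "a = (x, y)" "0 < x" "x < 1" "0 < y" "y < 1" "x < d \<or> y < d \<or> 1 - x < d \<or> 1 - y < d"
        by (cases a) (auto simp: collar_def usq_def)
      have b: "(0, y) \<in> square_boundary" "(x, 0) \<in> square_boundary" "(1, y) \<in> square_boundary" "(x, 1) \<in> square_boundary"
        using a by (auto simp: square_boundary_eq usq_def)
      have "\<exists>b\<in>square_boundary. dist a b \<le> 2 * d"
        using a(6)
      proof (elim disjE)
        assume "x < d" then show ?thesis using b(1) a d by (intro bexI[of _ "(0, y)"]) (auto simp: dist_Pair_Pair dist_real_def)
      next
        assume "y < d" then show ?thesis using b(2) a d by (intro bexI[of _ "(x, 0)"]) (auto simp: dist_Pair_Pair dist_real_def)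
      next
        assume "1 - x < d" then show ?thesis using b(3) a d by (intro bexI[of _ "(1, y)"]) (auto simp: dist_Pair_Pair dist_real_def)
      next
        assume "1 - y < d" then show ?thesis using b(4) a d by (intro bexI[of _ "(x, 1)"]) (auto simp: dist_Pair_Pair dist_real_def)
      qed
      then show "infdist a square_boundary \<le> 2 * d" by (meson infdist_le2)
    qed simp
  qed
  have cross: "x = s0" if x: "(x, 1/2) \<in> range \<phi>" "x < 1/2" for x
  proof -
    obtain t where t: "(x, 1/2) = \<phi> t" "0 \<le> t" "t \<le> \<tau>" using x(1) unfolding rng by auto
    have "0 < x" using x(1) col by (auto simp: collar_def usq_def)
    then have "\<phi> t \<in> section_half" using x(2) by (simp add: section_half_def flip: t(1))
    then have "\<not> (0 < t \<and> t < \<tau>)" using \<tau>(4) by blast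
    then show ?thesis using t \<tau>(2) \<phi>0 by (cases "t = 0") auto
  qed
  obtain e where e: "e > 0" "\<And>s. \<bar>s - s0\<bar> < e \<Longrightarrow> s \<noteq> s0 \<Longrightarrow> P s \<noteq> s"
    using fixed_isolated[OF s1 s0(1,2)] by blast
  define \<rho> where "\<rho> = Min {e, s0, \<sigma> - s0} / 2"
  have \<rho>: "\<rho> > 0" "\<rho> < e" "\<rho> < s0" "\<rho> < \<sigma> - s0"
    using e(1) s0 by (auto simp: \<rho>_def min_def)
  \<comment> \<open>The barrier on the section; the ends 0 and 1/2 are included to make it
    closed.\<close>
  define K where "K = {x. 0 \<le> x \<and> x \<le> 1/2 \<and> \<rho> \<le> \<bar>x - s0\<bar>} \<times> {1/2::real}"
  define U where "U = collar d - K"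
  have cK: "closed K" unfolding K_def
    by (intro closed_Times closed_Collect_conj closed_Collect_le continuous_intros) simp
  have oU: "open U" unfolding U_def by (intro open_Diff open_collar cK)
  have CU: "range \<phi> \<subseteq> U"
  proof
    fix z assume z: "z \<in> range \<phi>"
    have zc: "z \<in> collar d" using z col by blast
    have "z \<notin> K"
    proof
      assume "z \<in> K"
      then obtain x where x: "z = (x, 1/2)" "x \<le> 1/2" "\<rho> \<le> \<bar>x - s0\<bar>" by (auto simp: K_def)
      have "x \<noteq> 1/2" using zc d by (auto simp: x(1) collar_def usq_def)
      then have "x = s0" using cross[of x] z x by simp
      then show False using x \<rho> by simp
    qed
    then show "z \<in> U" using zc by (simp add: U_def)
  qed
  have uniq: "C' = range \<phi>" if C': "periodic_orbit (kf c) C'" "C' \<subseteq> U" for C'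
  proof -
    obtain \<psi> T where \<psi>: "T > 0" "solution_on (kf c) UNIV \<psi>" "\<And>t. \<psi> (t + T) = \<psi> t" "C' = range \<psi>"
      using C'(1) unfolding periodic_orbit_def by blast
    have \<psi>c: "range \<psi> \<subseteq> collar d" using C'(2) \<psi>(4) by (auto simp: U_def)
    have o\<psi>: "orbit c \<psi>" unfolding orbit_def
      using \<psi>(2) \<psi>c by (auto simp: solution_on_def collar_def)
    have onS: "\<bar>x - s0\<bar> < \<rho>" if "\<psi> t = (x, 1/2)" "0 < x" "x < 1/2" for t x
    proof (rule ccontr)
      assume "\<not> \<bar>x - s0\<bar> < \<rho>"
      then have "(x, 1/2) \<in> K" using that by (auto simp: K_def)
      moreover have "(x, 1/2) \<in> U" using that(1) C'(2) \<psi>(4) by (metis rangeI subsetD)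
      ultimately show False by (simp add: U_def)
    qed
    obtain t1 where "\<psi> t1 \<in> section_half" using reach_section[OF o\<psi> \<psi>c st d(2)] by blast
    then obtain x1 where x1: "\<psi> t1 = (x1, 1/2)" "0 < x1" "x1 < 1/2" by (auto simp: section_half_def)
    define S where "S n = (P ^^ n) x1" for n
    have S: "(\<exists>t. \<psi> t = (S n, 1/2)) \<and> \<bar>S n - s0\<bar> < \<rho>" for n
    proof (induction n)
      case 0 then show ?case using x1 onS[OF x1] by (auto simp: S_def)
    next
      case (Suc n)
      then obtain t where t: "\<psi> t = (S n, 1/2)" by blast
      have b: "0 < S n" "S n < \<sigma>" using Suc \<rho> by auto
      have r: "rets 4 c d (S n) (S (Suc n))" using P[OF b] by (simp add: S_def)
      have p: "0 < S (Suc n)" "S (Suc n) < 1/2" using rets_pos[of 3 c d "S n" "S (Suc n)"] r by (simp_all add: numeral_eq_Suc)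
      obtain t' where "\<psi> t' = (S (Suc n), 1/2)" by (rule return_traj[OF r o\<psi> t d]) blast
      then show ?case using onS p by blast
    qed
    have b: "0 < S n" "S n < \<sigma>" for n using S[of n] \<rho> by auto
    have SS: "S (Suc n) = P (S n)" for n by (simp add: S_def)
    have mono: "P a \<le> P b" if "0 < a" "a \<le> b" "b < \<sigma>" for a b using P_mono[of a b] that by (cases "a = b") auto
    have "convergent S"
    proof (cases "S 0 \<le> S 1")
      case True
      have "S n \<le> S (Suc n)" for n
      proof (induction n)
        case (Suc n)
        have "P (S n) \<le> P (S (Suc n))" by (rule mono[OF b(1) Suc b(2)])
        then show ?case by (simp only: SS)
      qed (use True in simp)
      then have "incseq S" by (rule incseq_SucI)
      moreover have "S n \<le> s0 + \<rho>" for n using S[of n] by auto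
      ultimately show ?thesis by (meson incseq_convergent convergentI)
    next
      case False
      have "S (Suc n) \<le> S n" for n
      proof (induction n)
        case (Suc n)
        have "P (S (Suc n)) \<le> P (S n)" by (rule mono[OF b(1) Suc b(2)])
        then show ?case by (simp only: SS)
      qed (use False in simp)
      then have "decseq S" by (rule decseq_SucI)
      moreover have "s0 - \<rho> \<le> S n" for n using conjunct2[OF S[of n]] by linarith
      ultimately obtain L where "S \<longlonglongrightarrow> L" using decseq_convergent[of S "s0 - \<rho>"] by metis
      then show ?thesis by (rule convergentI)
    qed
    then obtain L where L: "S \<longlonglongrightarrow> L" by (auto simp: convergent_def)
    have lo: "s0 - \<rho> \<le> S n" "S n \<le> s0 + \<rho>" for n using conjunct2[OF S[of n]] by linarith+
    have "s0 - \<rho> \<le> L" by (rule LIMSEQ_le_const[OF L]) (use lo in blast)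
    moreover have "L \<le> s0 + \<rho>" by (rule LIMSEQ_le_const2[OF L]) (use lo in blast)
    ultimately have Lb: "\<bar>L - s0\<bar> \<le> \<rho>" by auto
    have "(\<lambda>n. P (S n)) \<longlonglongrightarrow> P L"
      by (rule isCont_tendsto_compose[OF P_isCont L]) (use Lb \<rho> in auto)
    then have "(\<lambda>n. S (Suc n)) \<longlonglongrightarrow> P L" by (simp add: SS)
    then have "P L = L" using LIMSEQ_Suc[OF L] LIMSEQ_unique by blast
    then have "L = s0" using e(2)[of L] Lb \<rho>(2) by auto
    then have "S \<longlonglongrightarrow> s0" using L by simp
    then have lim: "(\<lambda>n. (S n, 1/2)) \<longlonglongrightarrow> (s0, 1/2::real)" by (intro tendsto_intros)
    have "closed (range \<psi>)"
      unfolding range_periodic[of T \<psi>, OF \<psi>(1,3)]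
      by (intro compact_imp_closed compact_continuous_image orbit_continuous[OF o\<psi>]) auto
    moreover have "(S n, 1/2) \<in> range \<psi>" for n
    proof -
      obtain t where "\<psi> t = (S n, 1/2)" using S[of n] by blast
      then show ?thesis by (metis rangeI)
    qed
    ultimately have "(s0, 1/2) \<in> range \<psi>" by (rule closed_sequentially[OF _ _ lim])
    then obtain t2 where t2: "\<psi> t2 = (s0, 1/2)" by (metis rangeE)
    have eq: "\<psi> (t + t2) = \<phi> t" for t
      using orbit_unique[OF orbit_shift[OF o\<psi>, of t2] o, of 0 t] by (simp add: t2 \<phi>0)
    have "range \<psi> = range \<phi>"
    proof
      show "range \<phi> \<subseteq> range \<psi>" using eq by (metis image_subsetI rangeI)
      show "range \<psi> \<subseteq> range \<phi>"
      proof
        fix z assume "z \<in> range \<psi>"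
        then obtain t where "z = \<psi> t" by blast
        then have "z = \<phi> (t - t2)" using eq[of "t - t2"] by simp
        then show "z \<in> range \<phi>" by blast
      qed
    qed
    then show ?thesis using \<psi>(4) by simp
  qed
  show ?thesis using po haus oU CU uniq cross unfolding limit_cycle_def by blast
qed

lemma fixed_point_between:
  assumes "0 < a" "a < b" "b < \<sigma>" "(P a < a \<and> P b > b) \<or> (P a > a \<and> P b < b)"
  obtains s where "a < s" "s < b" "P s = s"
proof -
  have c: "continuous_on {a..b} (\<lambda>s. P s - s)"
    by (intro continuous_at_imp_continuous_on ballI continuous_intros P_isCont) (use assms in auto)
  have "\<exists>s\<ge>a. s \<le> b \<and> P s - s = 0"
    using assms(4)
  proof
    assume "P a < a \<and> P b > b"
    then show ?thesis using assms by (intro IVT' c) auto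
  next
    assume "P a > a \<and> P b < b"
    then show ?thesis using assms by (intro IVT2' c) auto
  qed
  then obtain s where s: "a \<le> s" "s \<le> b" "P s = s" by auto
  have "s \<noteq> a" "s \<noteq> b" using s(3) assms(4) by auto
  show ?thesis by (rule that[of s]) (use s \<open>s \<noteq> a\<close> \<open>s \<noteq> b\<close> in auto)
qed

end

section \<open>The perturbed parameters\<close>

text \<open>\<open>Ft\<close> and \<open>Gt\<close> are the two cofactors of the field at
  \<open>mup h k\<close>, with \<open>r\<close> for \<open>1 / (1 + h)\<close>
  (\<open>vfield_mup\<close>).\<close>

definition Ft :: "real \<Rightarrow> real \<Rightarrow> real \<Rightarrow> real" where
  "Ft r x y = - 1 + (1 - r) * x + y + r * y\<^sup>2"

definition Gt :: "real \<Rightarrow> real \<Rightarrow> real \<Rightarrow> real \<Rightarrow> real" where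
  "Gt h k x y = (1 + h) - (2 + h) * x - h * y + (1 + h) * k * x * y"

text \<open>For \<open>h = k = 0\<close> the field has the first integral \<open>x (1 - x) y (1 - y) exp y\<close>; the product of
  the four hyperbolicity ratios is \<open>1 - k\<close>.\<close>

definition mup :: "real \<Rightarrow> real \<Rightarrow> param" where
  "mup h k = (1 / (1 + h), 1 + h, 1 / (1 + h), (1 + h) * (1 - k), 1)"

text \<open>At each corner the linear part has a monomial as first integral, with exponents
  determined by the hyperbolicity ratio. For \<open>k = 0\<close> the weights \<open>1 + h\<close>
  and \<open>1\<close> fit all four corners, and the derivative of \<open>Lf\<close> along orbits
  vanishes there.\<close>

definition Lf :: "real \<Rightarrow> real \<Rightarrow> real \<Rightarrow> real" where
  "Lf h x y = (1 + h) * (ln x + ln (1 - x)) + (ln y + ln (1 - y))"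

text \<open>Along orbits \<open>xi x\<close> has the derivative \<open>- Ft\<close>
  (\<open>Lf_deriv\<close>), so it can cancel a multiple of this cofactor.\<close>

definition xi :: "real \<Rightarrow> real" where "xi x = ln x - ln (1 - x)"

text \<open>The corrections of the first integral. For \<open>k = 0\<close> and fixed small \<open>h\<close>, the derivative \<open>E2\<close> of
  \<open>Lf + Ph2\<close> is negative in a collar whose width depends on \<open>h\<close>; the first-order part in \<open>h\<close> of the
  derivative \<open>E3\<close> of \<open>Lf + Ph3\<close> is positive in a fixed collar.\<close>

definition Ph2 :: "real \<Rightarrow> real \<Rightarrow> real \<Rightarrow> real" where
  "Ph2 h x y = y + h * (y + y\<^sup>2 / 2 + 2 * x - 3 * x * y - x * y\<^sup>2) + h\<^sup>2 * (y\<^sup>2 / 2 - 3 * y / 4 - x / 4 + x * y / 2)"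

definition Ph3 :: "real \<Rightarrow> real \<Rightarrow> real \<Rightarrow> real" where
  "Ph3 h x y = y + h * (y + y\<^sup>2 / 2 + 2 * x - 3 * x * y - x * y\<^sup>2
     - x * (1 - x) * (y * (1 - y)) * (xi x + (x - 1/2) * (2 * y - 1)))"

text \<open>\<open>Phx\<close> and \<open>Phy\<close> are the partial derivatives of the coefficient
  of \<open>h\<close> in \<open>Ph3\<close>.\<close>

definition Phx :: "real \<Rightarrow> real \<Rightarrow> real \<Rightarrow> real" where
  "Phx x y z = 2 - 3 * y - y\<^sup>2 - y * (1 - y) * ((1 - 2 * x) * z + 1)
     - y * (1 - y) * (2 * y - 1) * ((1 - 2 * x) * (x - 1/2) + x * (1 - x))"

definition Phy :: "real \<Rightarrow> real \<Rightarrow> real \<Rightarrow> real" where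
  "Phy x y z = 1 + y - 3 * x - 2 * x * y
     - x * (1 - x) * ((1 - 2 * y) * z + (x - 1/2) * ((1 - 2 * y) * (2 * y - 1) + 2 * (y * (1 - y))))"

text \<open>The quantities \<open>r = 1 / (1 + h)\<close> and \<open>z = xi x\<close> are separate variables here, so that \<open>E3p\<close> is a
  polynomial and hence continuous up to the boundary.\<close>

definition E3p :: "real \<Rightarrow> real \<Rightarrow> real \<Rightarrow> real \<Rightarrow> real \<Rightarrow> real" where
  "E3p h r x y z =
     (let F = y\<^sup>2 + y - 1; G = 1 - 2 * x; a = G + x * (1 - x) * Phx x y z; b = y * (1 - y) * Phy x y z;
          f = x - y\<^sup>2; g = 1 - x - y
      in - (a * F) - G * f * r + F * g - b * G - h * a * f * r - h * b * g)"

definition E3 :: "real \<Rightarrow> real \<Rightarrow> real \<Rightarrow> real \<Rightarrow> real" where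
  "E3 h k x y = h * E3p h (1 / (1 + h)) x y (xi x) +
     k * ((1 + h) * x * y * ((2 * y - 1) - y * (1 - y) * (1 + h * Phy x y (xi x))))"

text \<open>\<open>px2\<close> and \<open>py2\<close> are the partial derivatives of
  \<open>Ph2\<close>.\<close>

definition px2 :: "real \<Rightarrow> real \<Rightarrow> real \<Rightarrow> real" where
  "px2 h x y = h * (2 - 3 * y - y\<^sup>2) + h\<^sup>2 * (y / 2 - 1/4)"

definition py2 :: "real \<Rightarrow> real \<Rightarrow> real \<Rightarrow> real" where
  "py2 h x y = 1 + h * (1 + y - 3 * x - 2 * x * y) + h\<^sup>2 * (y - 3/4 + x / 2)"

text \<open>\<open>J1\<close> and \<open>J2\<close> split the derivative for \<open>k = 0\<close>
  according to the edges: along \<open>y = 0\<close> and \<open>y = 1\<close>, away from the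
  corners, the sign of \<open>J1\<close> decides, along the other two edges that of
  \<open>J2\<close>, and near the corners both count.\<close>

definition J1 :: "real \<Rightarrow> real \<Rightarrow> real \<Rightarrow> real" where
  "J1 h x y = - (2 * h) - Ft (1 / (1 + h)) x y * px2 h x y"

definition J2 :: "real \<Rightarrow> real \<Rightarrow> real \<Rightarrow> real" where
  "J2 h x y = 1 - 2 * x + 2 * h - Gt h 0 x y * py2 h x y"

definition E2 :: "real \<Rightarrow> real \<Rightarrow> real \<Rightarrow> real \<Rightarrow> real" where
  "E2 h k x y = x * (1 - x) * J1 h x y + y * (1 - y) * J2 h x y +
     k * ((1 + h) * x * y * ((2 * y - 1) - y * (1 - y) * py2 h x y))"

section \<open>Derivatives of the modified first integrals along orbits\<close>

lemma vfield_mup: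
  assumes "1 + h \<noteq> 0"
  shows "qv (fst (coef (mup h k))) x y = Ft (1 / (1 + h)) x y" "qv (snd (coef (mup h k))) x y = Gt h k x y"
  using assms by (simp_all add: coef_def mup_def qv_def Ft_def Gt_def field_simps power2_eq_square)

lemma orbit_mup:
  assumes o: "orbit (coef (mup h k)) \<phi>" and h: "1 + h > 0"
  defines "x \<equiv> \<lambda>t. fst (\<phi> t)" and "y \<equiv> \<lambda>t. snd (\<phi> t)"
  shows "(x has_real_derivative - (x t * (1 - x t) * Ft (1 / (1 + h)) (x t) (y t))) (at t)"
    "(y has_real_derivative - (y t * (1 - y t) * Gt h k (x t) (y t))) (at t)"
    "0 < x t" "x t < 1" "0 < y t" "y t < 1"
  using orbitD[OF o, of t] h unfolding x_def y_def Aq_def Bq_def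
  by (simp_all add: vfield_mup algebra_simps)

lemma Lf_deriv:
  assumes dx: "(x has_real_derivative - (x t * (1 - x t) * f)) (at t)" and dy: "(y has_real_derivative - (y t * (1 - y t) * g)) (at t)"
    and r: "0 < x t" "x t < 1" "0 < y t" "y t < 1"
  shows "((\<lambda>t. Lf h (x t) (y t)) has_real_derivative (1 + h) * ((2 * x t - 1) * f) + (2 * y t - 1) * g) (at t)"
    "((\<lambda>t. xi (x t)) has_real_derivative - f) (at t)"
proof -
  have l: "((\<lambda>t. ln (z t)) has_real_derivative - ((1 - z t) * q)) (at t)"
    "((\<lambda>t. ln (1 - z t)) has_real_derivative z t * q) (at t)"
    if "(z has_real_derivative - (z t * (1 - z t) * q)) (at t)" "0 < z t" "z t < 1" for z q
    by (rule DERIV_cong[OF DERIV_chain2[OF DERIV_ln that(1)]], use that in \<open>auto simp: field_simps\<close>)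
      (rule DERIV_cong[OF DERIV_chain2[OF DERIV_ln DERIV_diff[OF DERIV_const that(1)]]], use that in \<open>auto simp: field_simps\<close>)
  note lx = l[OF dx r(1,2)] and ly = l[OF dy r(3,4)]
  show "((\<lambda>t. Lf h (x t) (y t)) has_real_derivative (1 + h) * ((2 * x t - 1) * f) + (2 * y t - 1) * g) (at t)"
    unfolding Lf_def
    by (rule DERIV_cong[OF DERIV_add[OF DERIV_cmult[OF DERIV_add[OF lx]] DERIV_add[OF ly]]]) (simp add: algebra_simps)
  show "((\<lambda>t. xi (x t)) has_real_derivative - f) (at t)"
    unfolding xi_def by (rule DERIV_cong[OF DERIV_diff[OF lx]]) (simp add: algebra_simps)
qed

lemma W2_deriv:
  assumes o: "orbit (coef (mup h k)) \<phi>" and h: "1 + h > 0"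
  shows "((\<lambda>t. Lf h (fst (\<phi> t)) (snd (\<phi> t)) + Ph2 h (fst (\<phi> t)) (snd (\<phi> t))) has_real_derivative
    E2 h k (fst (\<phi> t)) (snd (\<phi> t))) (at t)"
proof -
  define x y where "x t = fst (\<phi> t)" and "y t = snd (\<phi> t)" for t
  note om = orbit_mup[OF o h, folded x_def[abs_def] y_def[abs_def]]
  define r where "r = 1 / (1 + h)"
  have r: "(1 + h) * r = 1" using h by (simp add: r_def)
  define f g where "f = Ft r (x t) (y t)" and "g = Gt h k (x t) (y t)"
  have dx: "(x has_real_derivative - (x t * (1 - x t) * f)) (at t)" and dy: "(y has_real_derivative - (y t * (1 - y t) * g)) (at t)"
    using om(1,2)[of t] unfolding f_def g_def r_def x_def[abs_def] y_def[abs_def] by simp_all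
  have rg: "0 < x t" "x t < 1" "0 < y t" "y t < 1" using om(3-6)[of t] by (simp_all add: x_def y_def)
  have dP: "((\<lambda>t. Ph2 h (x t) (y t)) has_real_derivative
      px2 h (x t) (y t) * (- (x t * (1 - x t) * f)) + py2 h (x t) (y t) * (- (y t * (1 - y t) * g))) (at t)"
    unfolding Ph2_def px2_def py2_def
    by (rule derivative_eq_intros dx dy refl | simp)+ (simp add: field_simps power2_eq_square)
  have "(1 + h) * ((2 * x t - 1) * f) + (2 * y t - 1) * g + (px2 h (x t) (y t) * (- (x t * (1 - x t) * f)) + py2 h (x t) (y t) * (- (y t * (1 - y t) * g))) =
    E2 h k (x t) (y t)"
  proof -
    \<comment> \<open>After multiplication by \<open>1 + h\<close> the cofactor is polynomial in
      \<open>h\<close>; the weight in \<open>Lf\<close> supplies this factor.\<close>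
    have lf: "(1 + h) * f = - (1 + h) + h * x t + (1 + h) * y t + (y t)\<^sup>2"
    proof -
      have "(1 + h) * f = - (1 + h) + ((1 + h) - (1 + h) * r) * x t + (1 + h) * y t + ((1 + h) * r) * (y t)\<^sup>2"
        unfolding f_def Ft_def by (simp add: algebra_simps)
      then show ?thesis unfolding r by simp
    qed
    have e: "(1 + h) * ((2 * x t - 1) * f) = (2 * x t - 1) * ((1 + h) * f)" by (simp add: mult_ac)
    show ?thesis
      unfolding e lf E2_def J1_def J2_def r_def[symmetric] f_def[symmetric] unfolding g_def Gt_def
      by (simp add: algebra_simps power2_eq_square)
  qed
  then show ?thesis
    using DERIV_add[OF Lf_deriv(1)[OF dx dy rg, of h] dP] unfolding x_def y_def by simp
qed

lemma W3_deriv: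
  assumes o: "orbit (coef (mup h k)) \<phi>" and h: "1 + h > 0"
  shows "((\<lambda>t. Lf h (fst (\<phi> t)) (snd (\<phi> t)) + Ph3 h (fst (\<phi> t)) (snd (\<phi> t))) has_real_derivative
    E3 h k (fst (\<phi> t)) (snd (\<phi> t))) (at t)"
proof -
  define x y where "x t = fst (\<phi> t)" and "y t = snd (\<phi> t)" for t
  note om = orbit_mup[OF o h, folded x_def[abs_def] y_def[abs_def]]
  define r where "r = 1 / (1 + h)"
  have r: "(1 + h) * r = 1" using h by (simp add: r_def)
  define f g where "f = Ft r (x t) (y t)" and "g = Gt h k (x t) (y t)"
  have dx: "(x has_real_derivative - (x t * (1 - x t) * f)) (at t)" and dy: "(y has_real_derivative - (y t * (1 - y t) * g)) (at t)"
    using om(1,2)[of t] unfolding f_def g_def r_def x_def[abs_def] y_def[abs_def] by simp_all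
  have rg: "0 < x t" "x t < 1" "0 < y t" "y t < 1" using om(3-6)[of t] by (simp_all add: x_def y_def)
  note dxi = Lf_deriv(2)[OF dx dy rg]
  have dP: "((\<lambda>t. Ph3 h (x t) (y t)) has_real_derivative
      h * Phx (x t) (y t) (xi (x t)) * (- (x t * (1 - x t) * f)) + (1 + h * Phy (x t) (y t) (xi (x t))) * (- (y t * (1 - y t) * g))) (at t)"
    unfolding Ph3_def Phx_def Phy_def
    by (rule derivative_eq_intros dx dy dxi refl | simp)+ (simp add: field_simps power2_eq_square)
  have "(1 + h) * ((2 * x t - 1) * f) + (2 * y t - 1) * g +
      (h * Phx (x t) (y t) (xi (x t)) * (- (x t * (1 - x t) * f)) + (1 + h * Phy (x t) (y t) (xi (x t))) * (- (y t * (1 - y t) * g))) =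
    E3 h k (x t) (y t)"
  proof -
    define X Y where "X = Phx (x t) (y t) (xi (x t))" and "Y = Phy (x t) (y t) (xi (x t))"
    define F G where "F = (y t)\<^sup>2 + y t - 1" and "G = 1 - 2 * x t"
    have hr: "h * r = 1 - r" using r by (simp add: algebra_simps)
    have fe: "f = F + (h * r) * (x t - (y t)\<^sup>2)" unfolding f_def Ft_def F_def hr by (simp add: algebra_simps)
    have ge: "g = G + h * (1 - x t - y t) + k * ((1 + h) * x t * y t)" unfolding g_def Gt_def G_def by (simp add: algebra_simps)
    have "(1 + h) * ((2 * x t - 1) * f) + (2 * y t - 1) * g + (h * X * (- (x t * (1 - x t) * f)) + (1 + h * Y) * (- (y t * (1 - y t) * g))) =
        - (G + h * (G + x t * (1 - x t) * X)) * f + (F - h * (y t * (1 - y t) * Y)) * g"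
      unfolding F_def G_def by (simp add: algebra_simps power2_eq_square)
    also have "\<dots> = h * (- ((G + x t * (1 - x t) * X) * F) - G * (x t - (y t)\<^sup>2) * r + F * (1 - x t - y t) - (y t * (1 - y t) * Y) * G
        - h * (G + x t * (1 - x t) * X) * (x t - (y t)\<^sup>2) * r - h * (y t * (1 - y t) * Y) * (1 - x t - y t)) +
        k * ((1 + h) * x t * y t * (F - h * (y t * (1 - y t) * Y)))"
      unfolding fe ge by (simp add: algebra_simps)
    also have "F - h * (y t * (1 - y t) * Y) = (2 * y t - 1) - y t * (1 - y t) * (1 + h * Y)"
      unfolding F_def by (simp add: algebra_simps power2_eq_square)
    finally show ?thesis unfolding E3_def E3p_def Let_def X_def[symmetric] Y_def[symmetric] F_def[symmetric] G_def[symmetric] r_def[symmetric] .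
  qed
  then show ?thesis
    using DERIV_add[OF Lf_deriv(1)[OF dx dy rg, of h] dP] unfolding x_def y_def by simp
qed

text \<open>A function whose derivative is positive whenever it equals its initial value never comes
  back to that value. So the sign of \<open>E\<close> is required on a single level curve, which
  later confines the estimates to a compact part of the open square.\<close>

lemma level_increase:
  fixes W E :: "real \<Rightarrow> real \<Rightarrow> real"
  assumes r: "rets 4 c d s s'" and d: "0 < d" "d \<le> 1/4"
    and W: "\<And>\<phi> t. orbit c \<phi> \<Longrightarrow> ((\<lambda>t. W (fst (\<phi> t)) (snd (\<phi> t))) has_real_derivative E (fst (\<phi> t)) (snd (\<phi> t))) (at t)"
    and E: "\<And>x y. (x, y) \<in> collar d \<Longrightarrow> W x y = W s (1/2) \<Longrightarrow> E x y > 0"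
  shows "W s (1/2) < W s' (1/2)"
proof -
  have s: "0 < s" "s < 1/2" "0 < s'" "s' < 1/2" using rets_pos[of 3 c d s s'] r by (simp_all add: numeral_eq_Suc)
  have "(s, 1/2) \<in> usq" using s by (auto simp: usq_def)
  then obtain \<phi> where o: "orbit c \<phi>" and \<phi>0: "\<phi> 0 = (s, 1/2)" by (rule orbit_exists) blast
  obtain \<tau> where \<tau>: "\<tau> > 0" "\<phi> \<tau> = (s', 1/2)" "\<And>t. 0 \<le> t \<Longrightarrow> t \<le> \<tau> \<Longrightarrow> \<phi> t \<in> collar d"
    by (rule return_traj[OF r o \<phi>0 d]) blast
  define v where "v t = W (fst (\<phi> t)) (snd (\<phi> t))" for t
  define v' where "v' t = E (fst (\<phi> t)) (snd (\<phi> t))" for t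
  have dv: "(v has_real_derivative v' t) (at t)" for t unfolding v_def v'_def by (rule W[OF o])
  have v0: "v 0 = W s (1/2)" by (simp add: v_def \<phi>0)
  have pos: "v' t > 0" if "0 \<le> t" "t \<le> \<tau>" "v t = v 0" for t
    unfolding v'_def by (rule E) (use \<tau>(3)[OF that(1,2)] that(3) v0 in \<open>auto simp: v_def\<close>)
  have cv: "continuous_on A v" for A using dv by (meson DERIV_isCont continuous_at_imp_continuous_on)
  have "v \<tau> > v 0"
  proof (rule ccontr)
    assume n: "\<not> v \<tau> > v 0"
    obtain e where e: "e > 0" "\<And>h. h > 0 \<Longrightarrow> h < e \<Longrightarrow> v 0 < v (0 + h)"
      using DERIV_pos_inc_right[OF dv[of 0] pos[of 0]] \<tau>(1) by auto
    define q where "q = min (e/2) (\<tau>/2)"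
    have q: "0 < q" "q < e" "q < \<tau>" using e \<tau>(1) by (auto simp: q_def)
    \<comment> \<open>Its least element \<open>t2\<close> is the first return to the initial value
      after the initial increase; there the derivative would have to be at most 0.\<close>
    define S where "S = {t \<in> {q..\<tau>}. v t \<le> v 0}"
    have "closed S" unfolding S_def by (intro closed_Collect_conj closed_Collect_le cv continuous_intros | simp)+
    moreover have "bounded S" by (rule bounded_subset[of "{q..\<tau>}"]) (auto simp: S_def)
    ultimately have cS: "compact S" by (simp add: compact_eq_bounded_closed)
    have "\<tau> \<in> S" using n q by (auto simp: S_def)
    then obtain t2 where t2: "t2 \<in> S" "\<And>t. t \<in> S \<Longrightarrow> t2 \<le> t" using compact_attains_inf[OF cS] by blast
    have above: "v t > v 0" if "0 < t" "t < t2" for t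
    proof (cases "t < e")
      case True then show ?thesis using e(2)[of t] that by simp
    next
      case False
      have "t \<notin> S" using t2(2)[of t] that by auto
      then show ?thesis using False that q t2(1) by (auto simp: S_def)
    qed
    have t2q: "0 < t2" "t2 \<le> \<tau>" "v t2 \<le> v 0" using t2(1) q by (auto simp: S_def)
    have "v t2 = v 0"
    proof (rule ccontr)
      assume "v t2 \<noteq> v 0"
      then have "v t2 < v 0" using t2q by simp
      have a: "v (min (e/2) (t2/2)) > v 0" using above[of "min (e/2) (t2/2)"] t2q e by auto
      have "\<exists>t\<ge>min (e/2) (t2/2). t \<le> t2 \<and> v t = v 0"
        by (rule IVT2'[OF _ _ _ cv]) (use a \<open>v t2 < v 0\<close> t2q in auto)
      then obtain t where "t \<ge> min (e/2) (t2/2)" "t \<le> t2" "v t = v 0" by blast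
      moreover from this have "t \<noteq> t2" using \<open>v t2 < v 0\<close> by auto
      ultimately show False using above[of t] e(1) t2q by (auto simp: min_def split: if_splits)
    qed
    then have "v' t2 > 0" using pos t2q by simp
    from DERIV_pos_inc_left[OF dv this] obtain m where m: "m > 0" "\<And>h. h > 0 \<Longrightarrow> h < m \<Longrightarrow> v (t2 - h) < v t2" by auto
    define p where "p = min (m/2) (t2/2)"
    have p: "0 < p" "p < m" "p < t2" using m t2q by (auto simp: p_def)
    show False using m(2)[OF p(1,2)] above[of "t2 - p"] p \<open>v t2 = v 0\<close> by simp
  qed
  then show ?thesis by (simp add: v_def \<tau>(2) \<phi>0)
qed

section \<open>Bounds and monotonicity of the corrections\<close>

lemma xi_deriv: "0 < x \<Longrightarrow> x < 1 \<Longrightarrow> (xi has_real_derivative 1 / (x * (1 - x))) (at x)"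
  unfolding xi_def by (rule derivative_eq_intros refl | simp)+ (simp add: field_simps)

lemma four_mult_le: "4 * (x * (1 - x)) \<le> (1::real)"
  using sum_squares_ge_zero[of "2 * x - 1" 0] by (simp add: algebra_simps power2_eq_square)

text \<open>The subtracted line is the tangent of \<open>xi\<close> at 1/2, of slope 4, and the
  slope of \<open>xi\<close> is nowhere smaller.\<close>

lemma xi_mono:
  assumes "0 < a" "a \<le> b" "b < 1"
  shows "xi a - 2 * (2 * a - 1) \<le> xi b - 2 * (2 * b - 1)"
proof (rule DERIV_nonneg_imp_nondecreasing[OF assms(2)])
  fix x assume "a \<le> x" "x \<le> b"
  then have x: "0 < x" "x < 1" using assms by auto
  have "((\<lambda>x. xi x - 2 * (2 * x - 1)) has_real_derivative 1 / (x * (1 - x)) - 4) (at x)"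
    by (rule derivative_eq_intros xi_deriv x refl | simp)+
  moreover have "0 \<le> 1 / (x * (1 - x)) - 4" using four_mult_le[of x] x by (simp add: field_simps)
  ultimately show "\<exists>y. ((\<lambda>x. xi x - 2 * (2 * x - 1)) has_real_derivative y) (at x) \<and> 0 \<le> y" by blast
qed

lemma xi_lower: "(2 * x - 1) * xi x \<ge> 2 * (2 * x - 1)\<^sup>2" if "0 < x" "x < 1"
proof -
  have h: "xi (1/2) = 0" by (simp add: xi_def)
  have "0 \<le> (2 * x - 1) * (xi x - 2 * (2 * x - 1))"
  proof (cases "x \<le> 1/2")
    case True
    then show ?thesis using xi_mono[of x "1/2"] that h by (intro mult_nonpos_nonpos) auto
  next
    case False
    then show ?thesis using xi_mono[of "1/2" x] that h by (intro mult_nonneg_nonneg) auto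
  qed
  then show ?thesis by (simp add: algebra_simps power2_eq_square)
qed

lemma x_xi_bound:
  assumes "0 < x" "x < 1"
  shows "\<bar>x * (1 - x) * xi x\<bar> \<le> 1"
proof -
  have b: "\<bar>z * ln z\<bar> \<le> 1 - z" if "0 < z" "z < 1" for z :: real
  proof -
    have "ln (1 / z) \<le> 1 / z - 1" using that by (intro ln_le_minus_one) auto
    then have "z * - ln z \<le> z * (1 / z - 1)" using that by (intro mult_left_mono) (auto simp: ln_div)
    moreover have "z * ln z \<le> 0" using that by (simp add: mult_le_0_iff)
    ultimately show ?thesis using that by (simp add: algebra_simps)
  qed
  have "\<bar>x * (1 - x) * xi x\<bar> = \<bar>(1 - x) * (x * ln x) - x * ((1 - x) * ln (1 - x))\<bar>"
    by (simp add: xi_def algebra_simps)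
  also have "\<dots> \<le> (1 - x) * \<bar>x * ln x\<bar> + x * \<bar>(1 - x) * ln (1 - x)\<bar>"
    using assms by (intro order.trans[OF abs_triangle_ineq4]) (simp add: abs_mult)
  also have "\<dots> \<le> (1 - x) * (1 - x) + x * (1 - (1 - x))"
    using assms by (intro add_mono mult_left_mono b) auto
  also have "\<dots> \<le> 1" using mult_nonneg_nonneg[of x "1 - x"] assms by (simp add: algebra_simps)
  finally show ?thesis .
qed

lemma unit_products:
  fixes x y :: real
  assumes "0 < x" "x < 1" "0 < y" "y < 1"
  shows "0 \<le> x * y" "x * y \<le> 1" "0 \<le> y\<^sup>2" "y\<^sup>2 \<le> 1" "0 \<le> x * y\<^sup>2" "x * y\<^sup>2 \<le> 1"
  using assms by (auto simp: power_le_one mult_le_one)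

lemma abs_mult_le: "\<bar>h * (a::real)\<bar> \<le> A" if "0 < h" "h < 1" "\<bar>a\<bar> \<le> A"
  using mult_mono[of "\<bar>h\<bar>" 1 "\<bar>a\<bar>" A] that by (simp add: abs_mult)

lemma Ph2_bound:
  assumes "0 < h" "h < 1" "0 < x" "x < 1" "0 < y" "y < 1"
  shows "\<bar>Ph2 h x y\<bar> \<le> 12"
proof -
  note u = unit_products[OF assms(3-6)]
  have "\<bar>h * (y + y\<^sup>2 / 2 + 2 * x - 3 * x * y - x * y\<^sup>2)\<bar> \<le> 8"
    by (intro abs_mult_le abs_leI assms) (use assms u in linarith)+
  moreover have "\<bar>h\<^sup>2 * (y\<^sup>2 / 2 - 3 * y / 4 - x / 4 + x * y / 2)\<bar> \<le> 3"
  proof (rule abs_mult_le)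
    show "0 < h\<^sup>2" "h\<^sup>2 < 1" using assms by (auto simp: power_less_one_iff)
    show "\<bar>y\<^sup>2 / 2 - 3 * y / 4 - x / 4 + x * y / 2\<bar> \<le> 3" by (rule abs_leI) (use assms u in linarith)+
  qed
  ultimately show ?thesis using assms(5,6) unfolding Ph2_def by linarith
qed

lemma Ph3_bound:
  assumes "0 < h" "h < 1" "0 < x" "x < 1" "0 < y" "y < 1"
  shows "\<bar>Ph3 h x y\<bar> \<le> 12"
proof -
  note u = unit_products[OF assms(3-6)]
  have w: "0 \<le> y * (1 - y)" "y * (1 - y) \<le> 1" using assms by (auto simp: mult_le_one)
  have v: "\<bar>x * (1 - x)\<bar> \<le> 1" using assms by (auto simp: abs_mult mult_le_one)
  have "\<bar>(x - 1/2) * (2 * y - 1)\<bar> \<le> 1 * 1" unfolding abs_mult using assms by (intro mult_mono) auto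
  then have "\<bar>(x * (1 - x)) * ((x - 1/2) * (2 * y - 1))\<bar> \<le> 1 * 1"
    unfolding abs_mult[of "x * (1 - x)"] using v by (intro mult_mono) auto
  then have "\<bar>x * (1 - x) * xi x + (x * (1 - x)) * ((x - 1/2) * (2 * y - 1))\<bar> \<le> 2"
    using x_xi_bound[OF assms(3,4)] by linarith
  then have "\<bar>y * (1 - y) * (x * (1 - x) * xi x + (x * (1 - x)) * ((x - 1/2) * (2 * y - 1)))\<bar> \<le> 1 * 2"
    unfolding abs_mult[of "y * (1 - y)"] using w by (intro mult_mono) auto
  moreover have "y * (1 - y) * (x * (1 - x) * xi x + (x * (1 - x)) * ((x - 1/2) * (2 * y - 1))) =
      x * (1 - x) * (y * (1 - y)) * (xi x + (x - 1/2) * (2 * y - 1))"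
  proof -
    have "w * (u * X + u * Z) = u * w * (X + Z)" for u w X Z :: real by (simp add: algebra_simps)
    then show ?thesis .
  qed
  moreover have "\<bar>y + y\<^sup>2 / 2 + 2 * x - 3 * x * y - x * y\<^sup>2\<bar> \<le> 8"
    by (intro abs_leI) (use assms u in linarith)+
  ultimately have "\<bar>y + y\<^sup>2 / 2 + 2 * x - 3 * x * y - x * y\<^sup>2 - x * (1 - x) * (y * (1 - y)) * (xi x + (x - 1/2) * (2 * y - 1))\<bar> \<le> 10"
    by linarith
  from abs_mult_le[OF assms(1,2) this] show ?thesis using assms(5,6) unfolding Ph3_def by linarith
qed

lemma Lf_eq: "0 < x \<Longrightarrow> x < 1 \<Longrightarrow> 0 < y \<Longrightarrow> y < 1 \<Longrightarrow> Lf h x y = (1 + h) * ln (x * (1 - x)) + ln (y * (1 - y))"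
  by (simp add: Lf_def ln_mult)

text \<open>Corrections bounded by 12 change the difference of two levels by at most 24. So the
  level curve through \<open>(c, 1/2)\<close> keeps away from the boundary uniformly in
  \<open>h\<close>: \<open>1 + h\<close> is replaced by 2 on one side and by 1 on the other, and
  \<open>1/4\<close> is \<open>y * (1 - y)\<close> on the section.\<close>

lemma level_bound:
  assumes "0 < h" "h < 1" "0 < x" "x < 1" "0 < y" "y < 1" "0 < c" "c < 1"
    "Lf h x y + p = Lf h c (1/2) + q" "\<bar>p\<bar> \<le> 12" "\<bar>q\<bar> \<le> 12"
  shows "exp (2 * ln (c * (1 - c)) + ln (1/4) - 24) \<le> x * (1 - x) * (y * (1 - y))"
proof -
  have n: "ln (z * (1 - z)) \<le> 0" if "0 < z" "z < 1" for z :: real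
    using that mult_le_one[of z "1 - z"] by (subst ln_le_zero_iff) auto
  have p: "0 < z * (1 - z)" if "0 < z" "z < 1" for z :: real using that by simp
  have "2 * ln (c * (1 - c)) \<le> (1 + h) * ln (c * (1 - c))"
    using n[of c] assms by (intro mult_right_mono_neg) auto
  moreover have "(1 + h) * ln (x * (1 - x)) \<le> 1 * ln (x * (1 - x))"
    using n[of x] assms by (intro mult_right_mono_neg) auto
  moreover have "Lf h c (1/2) = (1 + h) * ln (c * (1 - c)) + ln (1/4)" using Lf_eq[of c "1/2" h] assms by simp
  ultimately have "2 * ln (c * (1 - c)) + ln (1/4) - 24 \<le> ln (x * (1 - x)) + ln (y * (1 - y))"
    using assms(9-11) Lf_eq[of x y h] assms(3-6) by linarith
  also have "\<dots> = ln (x * (1 - x) * (y * (1 - y)))" using p[of x] p[of y] assms by (subst ln_mult) auto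
  finally show ?thesis using p[of x] p[of y] assms by (subst ln_ge_iff[symmetric]) auto
qed

lemma Lf_mono: "0 < a \<Longrightarrow> a < b \<Longrightarrow> b < 1/2 \<Longrightarrow> 0 < h \<Longrightarrow> Lf h a (1/2) < Lf h b (1/2)"
proof -
  assume a: "0 < a" "a < b" "b < 1/2" "0 < h"
  have "0 < (b - a) * (1 - a - b)" using a by simp
  then have "a * (1 - a) < b * (1 - b)" by (simp add: algebra_simps)
  then have "ln (a * (1 - a)) < ln (b * (1 - b))" using a by (subst ln_less_cancel_iff) auto
  then show ?thesis using a by (subst (1 2) Lf_eq) auto
qed

text \<open>On the section the modified integral increases with the distance from the edge, so an
  inequality between levels becomes one between \<open>s\<close> and \<open>P s\<close>.\<close>

lemma W2_mono:
  assumes "0 < a" "a < b" "b < 1/2" "0 < h"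
  shows "Lf h a (1/2) + Ph2 h a (1/2) < Lf h b (1/2) + Ph2 h b (1/2)"
proof -
  have "Ph2 h z (1/2) = 1/2 + h * (1/2 + 1/8) - h\<^sup>2 / 4 + h * (z / 4)" for z
    by (simp add: Ph2_def power2_eq_square field_simps)
  moreover have "h * (a / 4) \<le> h * (b / 4)" using assms by (intro mult_left_mono) auto
  ultimately show ?thesis using Lf_mono[OF assms] by simp
qed

lemma W3_mono:
  assumes "0 < a" "a < b" "b < 1/2" "0 < h"
  shows "Lf h a (1/2) + Ph3 h a (1/2) < Lf h b (1/2) + Ph3 h b (1/2)"
proof -
  have e: "Ph3 h z (1/2) = 1/2 + h * (1/2 + 1/8) + h / 4 * (z - z * (1 - z) * xi z)" for z
    by (simp add: Ph3_def power2_eq_square field_simps)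
  \<comment> \<open>The derivative of this expression is \<open>(2 * x - 1) * xi x\<close>, which is
    never negative.\<close>
  have "a - a * (1 - a) * xi a \<le> b - b * (1 - b) * xi b"
  proof (rule DERIV_nonneg_imp_nondecreasing[where f = "\<lambda>z. z - z * (1 - z) * xi z"])
    fix x assume x': "a \<le> x" "x \<le> b"
    then have x: "0 < x" "x < 1" using assms by auto
    have "((\<lambda>z. z - z * (1 - z) * xi z) has_real_derivative - ((1 - 2 * x) * xi x)) (at x)"
      by (rule derivative_eq_intros xi_deriv x refl | simp)+ (use x in \<open>simp add: field_simps\<close>)
    moreover have "0 \<le> - ((1 - 2 * x) * xi x)"
    proof -
      have "0 \<le> (2 * x - 1) * xi x" using xi_lower[OF x] by (rule order.trans[rotated]) simp
      then show ?thesis by (simp add: algebra_simps)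
    qed
    ultimately show "\<exists>y. ((\<lambda>z. z - z * (1 - z) * xi z) has_real_derivative y) (at x) \<and> 0 \<le> y" by blast
  qed (use assms in simp)
  then have "h / 4 * (a - a * (1 - a) * xi a) \<le> h / 4 * (b - b * (1 - b) * xi b)"
    using assms by (intro mult_left_mono) auto
  then show ?thesis unfolding e using Lf_mono[OF assms] by simp
qed

text \<open>With the polynomial part of \<open>Ph3\<close> alone this quantity would be
  \<open>- (u * w * F)\<close>, and \<open>F\<close> changes sign in the square. As
  \<open>xi\<close> has derivative \<open>- F\<close>, subtracting \<open>u * w * xi x\<close>
  cancels this and leaves \<open>u * w\<^sup>2 * (2 * x - 1) * xi x\<close>, which is nonnegative.
  The last summand of \<open>Ph3\<close> makes the sum positive also at
  \<open>x = 1/2\<close>.\<close>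

lemma E3p_pos:
  assumes "0 < x" "x < 1" "0 < y" "y < 1" "x \<le> 1/16 \<or> 15/16 \<le> x \<or> y \<le> 1/16 \<or> 15/16 \<le> y"
  shows "E3p 0 1 x y (xi x) > 0"
proof -
  define u w G F where "u = x * (1 - x)" and "w = y * (1 - y)" and "G = 1 - 2 * x" and "F = y\<^sup>2 + y - 1"
  have uw: "0 < u" "0 < w" using assms by (auto simp: u_def w_def)
  have e: "E3p 0 1 x y (xi x) = u * w * (- (w * G * xi x) + u * F * (2 * y - 1) - w * G\<^sup>2 * (3/2 - y))"
    unfolding E3p_def Let_def Phx_def Phy_def u_def w_def G_def F_def by (simp add: field_simps power2_eq_square)
  \<comment> \<open>This bound exceeds the negative term \<open>w * G\<^sup>2 * (3/2 - y)\<close> by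
    at least \<open>w * G\<^sup>2 / 2\<close>.\<close>
  have "w * (- G * xi x) \<ge> w * (2 * G\<^sup>2)"
    using xi_lower[OF assms(1,2)] uw by (intro mult_left_mono) (auto simp: G_def power2_commute)
  moreover have "w * (1/2 * G\<^sup>2) \<le> w * ((1/2 + y) * G\<^sup>2)" using assms uw by (intro mult_left_mono mult_right_mono) auto
  ultimately have "1/2 * (w * G\<^sup>2) + u * (F * (2 * y - 1)) \<le> - (w * G * xi x) + u * F * (2 * y - 1) - w * G\<^sup>2 * (3/2 - y)"
    by (simp add: algebra_simps)
  moreover have "0 < 1/2 * (w * G\<^sup>2) + u * (F * (2 * y - 1))"
  proof -
    have wG: "0 \<le> w * G\<^sup>2" using uw by simp
    consider "y \<le> 1/2" | "5/8 \<le> y" | "1/2 < y" "y < 5/8" by linarith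
    then show ?thesis
    proof cases
      case 1
      have "y\<^sup>2 \<le> (1/2)\<^sup>2" using 1 assms by (intro power_mono) auto
      then have F: "F < 0" using 1 by (simp add: F_def power2_eq_square)
      show ?thesis
      proof (cases "y = 1/2")
        case True
        then have "G \<noteq> 0" using assms by (auto simp: G_def)
        moreover have "2 * y - 1 = 0" using True by simp
        ultimately show ?thesis using uw by simp
      next
        case False
        then have "0 < F * (2 * y - 1)" using F 1 by (intro mult_neg_neg) auto
        then show ?thesis using uw wG by (simp add: add_nonneg_pos)
      qed
    next
      case 2
      have "(5/8)\<^sup>2 \<le> y\<^sup>2" using 2 by (intro power_mono) auto
      then have "0 < F" using 2 by (simp add: F_def power2_eq_square)
      then have "0 < F * (2 * y - 1)" using 2 by simp
      then show ?thesis using uw wG by (simp add: add_nonneg_pos)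
    next
      \<comment> \<open>Only here can \<open>F * (2 * y - 1)\<close> be negative, since the positive
        zero of \<open>F\<close> lies between 1/2 and 5/8. As \<open>y\<close> is far from the
        edges, \<open>x\<close> is near one, and the term with \<open>G\<^sup>2\<close>
        prevails.\<close>
      case 3
      then have x: "x \<le> 1/16 \<or> 15/16 \<le> x" using assms by auto
      then have "(7/8)\<^sup>2 \<le> \<bar>G\<bar>\<^sup>2" using assms by (intro power_mono) (auto simp: G_def)
      then have G: "49/64 \<le> G\<^sup>2" by (simp add: power2_eq_square)
      have "(3/8) * (1/2) \<le> w" unfolding w_def mult.commute[of y] using 3 by (intro mult_mono) auto
      then have "3/16 * (49/64) \<le> w * G\<^sup>2" using G by (intro mult_mono) auto
      moreover have "u \<le> 1/16"
      proof (cases "x \<le> 1/16")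
        case True
        then show ?thesis using assms mult_mono[of x "1/16" "1 - x" 1] by (simp add: u_def)
      next
        case False
        then show ?thesis using x assms mult_mono[of x 1 "1 - x" "1/16"] by (simp add: u_def)
      qed
      moreover have "\<bar>F * (2 * y - 1)\<bar> \<le> 1 * (1/4)"
      proof -
        have "\<bar>F\<bar> \<le> 1" unfolding F_def by (rule abs_leI) (use 3 power_le_one[of y 2] zero_le_power2[of y] in linarith)+
        then show ?thesis unfolding abs_mult using 3 by (intro mult_mono) auto
      qed
      ultimately have "\<bar>u * (F * (2 * y - 1))\<bar> \<le> 1/16 * (1 * (1/4))"
        unfolding abs_mult[of u] using uw by (intro mult_mono) auto
      then show ?thesis using \<open>3/16 * (49/64) \<le> w * G\<^sup>2\<close> by linarith
    qed
  qed
  ultimately have "0 < - (w * G * xi x) + u * F * (2 * y - 1) - w * G\<^sup>2 * (3/2 - y)" by linarith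
  then show ?thesis unfolding e using uw by simp
qed

section \<open>Signs of the derivatives on level curves\<close>

lemma pos_perturb:
  fixes f g :: "'a::metric_space \<Rightarrow> real"
  assumes "compact S" "continuous_on S f" "continuous_on S g" "\<And>z. z \<in> S \<Longrightarrow> f z > 0"
  shows "\<exists>k0>0. \<forall>k. 0 < k \<and> k < k0 \<longrightarrow> (\<forall>z\<in>S. f z + k * g z > 0)"
proof (cases "S = {}")
  case True then show ?thesis by (auto intro: exI[of _ 1])
next
  case False
  obtain z0 where z0: "z0 \<in> S" "\<And>z. z \<in> S \<Longrightarrow> f z0 \<le> f z"
    using continuous_attains_inf[OF assms(1) False assms(2)] by blast
  have "bounded (g ` S)" by (intro compact_imp_bounded compact_continuous_image assms)
  then obtain B where B: "B > 0" "\<And>z. z \<in> S \<Longrightarrow> \<bar>g z\<bar> \<le> B" by (auto simp: bounded_pos)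
  show ?thesis
  proof (rule exI[of _ "f z0 / B"], intro conjI allI impI ballI)
    show "0 < f z0 / B" using assms(4)[OF z0(1)] B by simp
    fix k z assume k: "0 < k \<and> k < f z0 / B" and z: "z \<in> S"
    have "\<bar>k * g z\<bar> \<le> k * B" using B(2)[OF z] k by (simp add: abs_mult)
    also have "\<dots> < f z0" using k B by (simp add: field_simps)
    finally show "f z + k * g z > 0" using z0(2)[OF z] by linarith
  qed
qed

text \<open>The part of a closed collar that is cut off from the edges by the bound of
  \<open>level_bound\<close>. It is compact and lies in the open square, so functions of
  \<open>x\<close>, \<open>y\<close> and \<open>xi x\<close> attain their minima on it.\<close>

definition core :: "real \<Rightarrow> real \<Rightarrow> (real \<times> real) set" where
  "core \<eta> d = ({0..1} \<times> {0..1}) \<inter> {z. \<eta> \<le> fst z * (1 - fst z) * (snd z * (1 - snd z))} \<inter>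
     {z. fst z \<le> d \<or> 1 - d \<le> fst z \<or> snd z \<le> d \<or> 1 - d \<le> snd z}"

lemma compact_core: "compact (core \<eta> d)"
  unfolding core_def
  by (intro compact_Int_closed compact_Times closed_Collect_disj closed_Collect_le continuous_intros compact_Icc)

lemma coreD:
  assumes "(x, y) \<in> core \<eta> d" "\<eta> > 0"
  shows "0 < x" "x < 1" "0 < y" "y < 1" "x \<le> d \<or> 1 - d \<le> x \<or> y \<le> d \<or> 1 - d \<le> y"
proof -
  have "0 < x * (1 - x) * (y * (1 - y))" and r: "0 \<le> x" "x \<le> 1" "0 \<le> y" "y \<le> 1"
    and c: "x \<le> d \<or> 1 - d \<le> x \<or> y \<le> d \<or> 1 - d \<le> y" using assms by (auto simp: core_def)
  then have "x \<noteq> 0" "x \<noteq> 1" "y \<noteq> 0" "y \<noteq> 1" by auto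
  then show "0 < x" "x < 1" "0 < y" "y < 1" "x \<le> d \<or> 1 - d \<le> x \<or> y \<le> d \<or> 1 - d \<le> y" using r c by auto
qed

lemma coreI:
  assumes "(x, y) \<in> collar d" "\<eta> \<le> x * (1 - x) * (y * (1 - y))"
  shows "(x, y) \<in> core \<eta> d"
  using assms by (auto simp: collar_def core_def usq_def)

lemma continuous_on_xi: "\<eta> > 0 \<Longrightarrow> continuous_on (core \<eta> d) (\<lambda>z. xi (fst z))"
  unfolding xi_def by (intro continuous_intros) (use coreD(1,2) in fastforce)+

text \<open>Here \<open>c\<close> comes first and \<open>h\<close> is small for it: on the compact
  core \<open>E3p\<close> is close to its positive limit at \<open>h = 0\<close>. In
  \<open>E3\<close> this term carries the factor \<open>h\<close>, so the admissible
  \<open>k\<close> depend on \<open>h\<close>.\<close>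

lemma third_level:
  assumes c: "0 < c" "c < 1/2"
  shows "\<exists>h0>0. h0 \<le> 1 \<and> (\<forall>h. 0 < h \<and> h < h0 \<longrightarrow> (\<exists>k0>0. \<forall>k. 0 < k \<and> k < k0 \<longrightarrow>
    (\<forall>x y. (x, y) \<in> collar (1/16) \<longrightarrow> Lf h x y + Ph3 h x y = Lf h c (1/2) + Ph3 h c (1/2) \<longrightarrow> E3 h k x y > 0)))"
proof -
  define \<eta> where "\<eta> = exp (2 * ln (c * (1 - c)) + ln (1/4) - 24)"
  have \<eta>: "\<eta> > 0" by (simp add: \<eta>_def)
  let ?S = "core \<eta> (1/16)"
  \<comment> \<open>With \<open>xi x\<close> as a third coordinate the polynomial \<open>E3p\<close>
    is continuous on the whole space, as \<open>tube\<close> demands.\<close>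
  define K where "K = (\<lambda>z. (fst z, snd z, xi (fst z))) ` ?S"
  have cK: "compact K" unfolding K_def
    by (intro compact_continuous_image compact_core continuous_intros continuous_on_xi \<eta>)
  define g where "g p z = E3p (fst p) (snd p) (fst z) (fst (snd z)) (snd (snd z))" for p :: "real \<times> real" and z :: "real \<times> real \<times> real"
  have cg: "continuous_on UNIV (\<lambda>u. g (fst u) (snd u))"
    unfolding g_def E3p_def Let_def Phx_def Phy_def by (intro continuous_intros)
  have "\<exists>d m. d > 0 \<and> m > 0 \<and> (\<forall>p z. \<forall>k\<in>K. dist p (0, 1) < d \<longrightarrow> dist z k < d \<longrightarrow> g p z > m)"
  proof (rule tube[OF cK cg])
    fix z assume "z \<in> K"
    then obtain x y where z: "z = (x, y, xi x)" "(x, y) \<in> ?S" by (auto simp: K_def)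
    show "g (0, 1) z > 0" using coreD[OF z(2) \<eta>] by (simp add: g_def z(1) E3p_pos)
  qed
  then obtain d m where d: "d > 0" "m > 0" "\<And>p z k. k \<in> K \<Longrightarrow> dist p (0, 1) < d \<Longrightarrow> dist z k < d \<Longrightarrow> g p z > m" by blast
  show ?thesis
  proof (rule exI[of _ "min 1 (d / 2)"], intro conjI allI impI)
    show "0 < min 1 (d / 2)" "min 1 (d / 2) \<le> 1" using d by auto
    fix h assume "0 < h \<and> h < min 1 (d / 2)"
    then have h: "0 < h" "h < 1" "2 * h < d" by auto
    have "\<bar>1 / (1 + h) - 1\<bar> = h / (1 + h)" using h by (simp add: field_simps)
    also have "\<dots> \<le> h / 1" using h by (intro divide_left_mono) auto
    finally have "sqrt (h\<^sup>2 + (1 / (1 + h) - 1)\<^sup>2) < d"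
      using h sqrt_sum_squares_le_sum_abs[of h "1 / (1 + h) - 1"] by linarith
    then have "dist (h, 1 / (1 + h)) (0, 1) < d" unfolding dist_prod_def dist_real_def by simp
    then have gp: "E3p h (1 / (1 + h)) x y (xi x) > 0" if "(x, y) \<in> ?S" for x y
      using d(3)[of "(x, y, xi x)" "(h, 1 / (1 + h))" "(x, y, xi x)"] that d(1,2) by (force simp: K_def g_def)
    have "\<exists>k0>0. \<forall>k. 0 < k \<and> k < k0 \<longrightarrow> (\<forall>z\<in>?S. h * E3p h (1 / (1 + h)) (fst z) (snd z) (xi (fst z)) +
        k * ((1 + h) * fst z * snd z * ((2 * snd z - 1) - snd z * (1 - snd z) * (1 + h * Phy (fst z) (snd z) (xi (fst z))))) > 0)"
    proof (rule pos_perturb[OF compact_core])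
      show "0 < h * E3p h (1 / (1 + h)) (fst z) (snd z) (xi (fst z))" if "z \<in> ?S" for z
        using gp[of "fst z" "snd z"] that h by simp
    qed (unfold E3p_def Let_def Phx_def Phy_def, (intro continuous_intros continuous_on_xi \<eta>)+)
    then obtain k0 where k0: "k0 > 0" "\<And>k z. 0 < k \<Longrightarrow> k < k0 \<Longrightarrow> z \<in> ?S \<Longrightarrow> E3 h k (fst z) (snd z) > 0"
      unfolding E3_def by meson
    show "\<exists>k0>0. \<forall>k. 0 < k \<and> k < k0 \<longrightarrow> (\<forall>x y. (x, y) \<in> collar (1/16) \<longrightarrow>
        Lf h x y + Ph3 h x y = Lf h c (1/2) + Ph3 h c (1/2) \<longrightarrow> E3 h k x y > 0)"
    proof (rule exI[of _ k0], intro conjI allI impI k0(1))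
      fix k x y assume k: "0 < k \<and> k < k0" and xy: "(x, y) \<in> collar (1/16)"
        and l: "Lf h x y + Ph3 h x y = Lf h c (1/2) + Ph3 h c (1/2)"
      have r: "0 < x" "x < 1" "0 < y" "y < 1" using xy by (auto simp: collar_def usq_def)
      have "\<eta> \<le> x * (1 - x) * (y * (1 - y))"
        unfolding \<eta>_def by (rule level_bound[OF h(1,2) r c(1) _ l Ph3_bound[OF h(1,2) r] Ph3_bound[OF h(1,2) c(1)]]) (use c in auto)
      then have "(x, y) \<in> ?S" by (rule coreI[OF xy])
      then show "E3 h k x y > 0" using k0(2)[of k "(x, y)"] k by simp
    qed
  qed
qed

text \<open>Near a corner both terms are negative. Along an edge, away from its corners, one
  prefactor is bounded below and has a negative cofactor, while the other prefactor is as small as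
  the collar is thin.\<close>

lemma collar_neg:
  assumes cf: "continuous_on UNIV (\<lambda>z. f (fst z) (snd z))" and cg: "continuous_on UNIV (\<lambda>z. g (fst z) (snd z))"
    and f: "\<And>x. 0 \<le> x \<Longrightarrow> x \<le> 1 \<Longrightarrow> f x 0 < (0::real)" "\<And>x. 0 \<le> x \<Longrightarrow> x \<le> 1 \<Longrightarrow> f x 1 < 0"
    and g: "\<And>y. 0 \<le> y \<Longrightarrow> y \<le> 1 \<Longrightarrow> g 0 y < (0::real)" "\<And>y. 0 \<le> y \<Longrightarrow> y \<le> 1 \<Longrightarrow> g 1 y < (0::real)"
  shows "\<exists>\<delta>>0. \<delta> \<le> 1/4 \<and> (\<forall>x y. (x, y) \<in> collar \<delta> \<longrightarrow> x * (1 - x) * f x y + y * (1 - y) * g x y < 0)"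
proof -
  have tb: "\<exists>d m. d > 0 \<and> m > 0 \<and> (\<forall>z. \<forall>k\<in>K. dist z k < d \<longrightarrow> F (fst z) (snd z) < - m)"
    if K: "compact K" and F: "continuous_on UNIV (\<lambda>z. F (fst z) (snd z))" and n: "\<And>z. z \<in> K \<Longrightarrow> F (fst z) (snd z) < 0"
    for K and F :: "real \<Rightarrow> real \<Rightarrow> real"
  proof -
    have "\<exists>d m. d > 0 \<and> m > 0 \<and> (\<forall>p z. \<forall>k\<in>K. dist p (0::real) < d \<longrightarrow> dist z k < d \<longrightarrow> - F (fst z) (snd z) > m)"
      by (rule tube[OF K, where g = "\<lambda>p z. - F (fst z) (snd z)"])
        (use n in \<open>auto intro!: continuous_intros continuous_on_compose2[OF F]\<close>)
    then obtain d m where "d > 0" "m > 0" and *: "\<forall>p z. \<forall>k\<in>K. dist p (0::real) < d \<longrightarrow> dist z k < d \<longrightarrow> - F (fst z) (snd z) > m" by blast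
    moreover have "F (fst z) (snd z) < - m" if "k \<in> K" "dist z k < d" for z k
      using *[rule_format, of k 0 z] that \<open>d > 0\<close> by simp
    ultimately show ?thesis by meson
  qed
  have "\<exists>d m. d > 0 \<and> m > 0 \<and> (\<forall>z. \<forall>k\<in>{0..1} \<times> {0, 1}. dist z k < d \<longrightarrow> f (fst z) (snd z) < - m)"
    by (rule tb[OF _ cf]) (use f in \<open>auto intro!: compact_Times\<close>)
  then obtain d1 m1 where 1: "d1 > 0" "m1 > 0" "\<And>z k. k \<in> {0..1} \<times> {0, 1} \<Longrightarrow> dist z k < d1 \<Longrightarrow> f (fst z) (snd z) < - m1" by blast
  have "\<exists>d m. d > 0 \<and> m > 0 \<and> (\<forall>z. \<forall>k\<in>{0, 1} \<times> {0..1}. dist z k < d \<longrightarrow> g (fst z) (snd z) < - m)"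
    by (rule tb[OF _ cg]) (use g in \<open>auto intro!: compact_Times\<close>)
  then obtain d2 m2 where 2: "d2 > 0" "m2 > 0" "\<And>z k. k \<in> {0, 1} \<times> {0..1} \<Longrightarrow> dist z k < d2 \<Longrightarrow> g (fst z) (snd z) < - m2" by blast
  define e m where "e = min (1/4) (min d1 d2)" and "m = min m1 m2"
  have em: "0 < e" "e \<le> 1/4" "e \<le> d1" "e \<le> d2" "0 < m" "m \<le> m1" "m \<le> m2" using 1 2 by (auto simp: e_def m_def)
  have cs: "compact ({0..1::real} \<times> {0..1::real})" by (intro compact_Times compact_Icc)
  have "bounded ((\<lambda>z. f (fst z) (snd z)) ` ({0..1} \<times> {0..1}))" "bounded ((\<lambda>z. g (fst z) (snd z)) ` ({0..1} \<times> {0..1}))"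
    by (intro compact_imp_bounded compact_continuous_image cs continuous_on_subset[OF cf] continuous_on_subset[OF cg] subset_UNIV)+
  then obtain B1 B2 where B: "B1 > 0" "\<And>z. z \<in> {0..1} \<times> {0..1} \<Longrightarrow> \<bar>f (fst z) (snd z)\<bar> \<le> B1"
    "B2 > 0" "\<And>z. z \<in> {0..1} \<times> {0..1} \<Longrightarrow> \<bar>g (fst z) (snd z)\<bar> \<le> B2" unfolding bounded_pos by fastforce
  define B where "B = B1 + B2"
  \<comment> \<open>With this width the term of unknown sign is at most \<open>m * e / 4\<close>,
    while the other one is below \<open>- (m * e / 2)\<close>.\<close>
  define \<delta> where "\<delta> = min e (m * e / (4 * B))"
  have B0: "B > 0" using B by (simp add: B_def)
  have \<delta>: "0 < \<delta>" "\<delta> \<le> e" "\<delta> * B \<le> m * e / 4"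
  proof -
    have "\<delta> \<le> m * e / (4 * B)" by (simp add: \<delta>_def)
    then show "\<delta> * B \<le> m * e / 4" using B0 by (simp add: field_simps)
  qed (use em B0 in \<open>auto simp: \<delta>_def\<close>)
  have mix: "u * a + w * b < 0" if "0 \<le> u" "u \<le> \<delta>" "e / 2 \<le> w" "a \<le> B" "b < - m" for u w a b :: real
  proof -
    have "u * a \<le> u * B" "u * B \<le> \<delta> * B" using that B0 by (auto intro!: mult_left_mono mult_right_mono)
    moreover have "w * m \<ge> e / 2 * m" using that em by (intro mult_right_mono) auto
    moreover have "w * b < w * (- m)" using that em by (intro mult_strict_left_mono) auto
    moreover have "m * e / 4 < e / 2 * m" using em by simp
    moreover have "e / 2 * m = m * e / 2" "w * (- m) = - (w * m)" by simp_all
    ultimately show ?thesis using \<delta>(3) by linarith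
  qed
  have low: "e / 2 \<le> x * (1 - x)" if "e \<le> x" "e \<le> 1 - x" for x
  proof (cases "x \<le> 1/2")
    case True
    then show ?thesis using mult_mono[of e x "1/2" "1 - x"] that em by simp
  next
    case False
    then show ?thesis using mult_mono[of "1/2" x e "1 - x"] that em by simp
  qed
  have up: "x * (1 - x) \<le> \<delta>" if "x < \<delta> \<or> 1 - x < \<delta>" "0 < x" "x < 1" for x
  proof -
    have "x * (1 - x) \<le> x" "x * (1 - x) \<le> 1 - x"
      using that mult_left_le[of "1 - x" x] mult_left_le[of x "1 - x"] by (simp_all add: mult.commute)
    then show ?thesis using that by linarith
  qed
  show ?thesis
  proof (rule exI[of _ \<delta>], intro conjI allI impI)
    show "0 < \<delta>" "\<delta> \<le> 1/4" using \<delta> em by auto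
    fix x y assume xy: "(x, y) \<in> collar \<delta>"
    then have r: "0 < x" "x < 1" "0 < y" "y < 1" and s: "x < \<delta> \<or> 1 - x < \<delta> \<or> y < \<delta> \<or> 1 - y < \<delta>" by (auto simp: collar_def usq_def)
    have fn: "f x y < - m" if "y < e \<or> 1 - y < e"
      using that 1(3)[of "(x, 0)" "(x, y)"] 1(3)[of "(x, 1)" "(x, y)"] r em by (auto simp: dist_prod_def dist_real_def)
    have gn: "g x y < - m" if "x < e \<or> 1 - x < e"
      using that 2(3)[of "(0, y)" "(x, y)"] 2(3)[of "(1, y)" "(x, y)"] r em by (auto simp: dist_prod_def dist_real_def)
    have fB: "f x y \<le> B" "g x y \<le> B" using B(2)[of "(x, y)"] B(4)[of "(x, y)"] B(1,3) r by (auto simp: B_def)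
    have uw: "0 < x * (1 - x)" "0 < y * (1 - y)" using r by auto
    consider "x < e \<or> 1 - x < e" "y < e \<or> 1 - y < e" | "e \<le> x" "e \<le> 1 - x" | "e \<le> y" "e \<le> 1 - y" by linarith
    then show "x * (1 - x) * f x y + y * (1 - y) * g x y < 0"
    proof cases
      case 1
      then have "f x y < 0" "g x y < 0" using fn gn em by linarith+
      then show ?thesis using uw by (simp add: add_neg_neg mult_pos_neg)
    next
      case 2
      then have y: "y < \<delta> \<or> 1 - y < \<delta>" using s \<delta> by auto
      then have "f x y < - m" using fn \<delta> by linarith
      then have "y * (1 - y) * g x y + x * (1 - x) * f x y < 0"
        using mix[of "y * (1 - y)" "x * (1 - x)" "g x y" "f x y"] up[OF y r(3,4)] low[OF 2] fB uw by simp
      then show ?thesis by simp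
    next
      case 3
      then have x: "x < \<delta> \<or> 1 - x < \<delta>" using s \<delta> by auto
      then have "g x y < - m" using gn \<delta> by linarith
      then show ?thesis using mix[of "x * (1 - x)" "y * (1 - y)" "f x y" "g x y"] up[OF x r(1,2)] low[OF 3] fB uw by simp
    qed
  qed
qed

text \<open>The part of \<open>Ph2\<close> that is linear in \<open>h\<close> is chosen so that the
  terms of order h cancel on all four edges, the quadratic part so that the terms of order h^2 are
  negative there.\<close>

lemma J_edges:
  assumes h: "0 < h" "h < 1/3" and z: "0 \<le> z" "z \<le> 1"
  shows "J1 h z 0 < 0" "J1 h z 1 < 0" "J2 h 0 z < 0" "J2 h 1 z < 0"
proof -
  define r where "r = 1 / (1 + h)"
  have r: "0 < r" "r < 1" using h by (auto simp: r_def)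
  have "(1 - r) * z \<le> (1 - r) * 1" "0 \<le> (1 - r) * z" using r z by (auto intro!: mult_left_mono)
  then have b: "0 \<le> (1 - r) * z" "(1 - r) * z \<le> 1 - r" by simp_all
  have p: "0 < h * (2 - h / 4)" using h by simp
  have q: "- (2 * h) + t * (h * (2 - h / 4)) < 0" if "t \<le> 1" for t
  proof -
    have "t * (h * (2 - h / 4)) \<le> 1 * (h * (2 - h / 4))" using that p by (intro mult_right_mono) auto
    moreover have "h * (2 - h / 4) < h * 2" using h by (intro mult_strict_left_mono) auto
    ultimately show ?thesis by simp
  qed
  have "J1 h z 0 = - (2 * h) + (1 - (1 - r) * z) * (h * (2 - h / 4))"
    unfolding J1_def Ft_def px2_def r_def[symmetric] by (simp add: field_simps power2_eq_square)
  then show "J1 h z 0 < 0" using q[of "1 - (1 - r) * z"] b by simp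
  have "J1 h z 1 = - (2 * h) + ((1 - r) * z + r) * (h * (2 - h / 4))"
    unfolding J1_def Ft_def px2_def r_def[symmetric] by (simp add: field_simps power2_eq_square)
  then show "J1 h z 1 < 0" using q[of "(1 - r) * z + r"] b by simp
  have "J2 h 0 z = - (h\<^sup>2 * (1/4 + z * (1 - z) + h * ((1 - z) * (z - 3/4))))"
    unfolding J2_def Gt_def py2_def by (simp add: field_simps power2_eq_square)
  moreover have "0 < 1/4 + z * (1 - z) + h * ((1 - z) * (z - 3/4))"
  proof -
    have "- (3/4) \<le> (1 - z) * (z - 3/4)"
    proof -
      have "(1 - z) * (3/4 - z) \<le> 3/4"
      proof -
        have "(1 - z) * (3/4 - z) = 3/4 - z * (7/4 - z)" by (simp add: field_simps)
        then show ?thesis using z mult_nonneg_nonneg[of z "7/4 - z"] by linarith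
      qed
      moreover have "(1 - z) * (z - 3/4) = - ((1 - z) * (3/4 - z))" by (simp add: field_simps)
      ultimately show ?thesis by linarith
    qed
    then have "h * (- (3/4)) \<le> h * ((1 - z) * (z - 3/4))" using h by (intro mult_left_mono) auto
    then show ?thesis using h z mult_nonneg_nonneg[of z "1 - z"] by linarith
  qed
  ultimately show "J2 h 0 z < 0" using h by simp
  have "J2 h 1 z = - (h\<^sup>2 * (1/4 + z + z\<^sup>2 - h * (z * (z - 1/4))))"
    unfolding J2_def Gt_def py2_def by (simp add: field_simps power2_eq_square)
  moreover have "0 < 1/4 + z + z\<^sup>2 - h * (z * (z - 1/4))"
  proof -
    have "z * (z - 1/4) \<le> 1 * (3/4)"
    proof (cases "z \<le> 1/4")
      case True then show ?thesis using z by (intro order.trans[OF mult_nonneg_nonpos]) auto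
    next
      case False then show ?thesis using z by (intro mult_mono) auto
    qed
    then have "h * (z * (z - 1/4)) \<le> h * (3/4)" using h by (intro mult_left_mono) auto
    then show ?thesis using h z zero_le_power2[of z] by linarith
  qed
  ultimately show "J2 h 1 z < 0" using h by simp
qed

text \<open>Here \<open>h\<close> comes first. Off the edges the derivative has a part of order h,
  so the negative part of order h^2 prevails only in a collar that depends on \<open>h\<close>. The
  level \<open>c\<close> is taken so low that its whole level curve lies in this collar, and then
  \<open>k\<close> so small that its term cannot change the sign.\<close>

lemma second_level:
  assumes h: "0 < h" "h < 1/3"
  shows "\<exists>c0>0. \<forall>c. 0 < c \<and> c < c0 \<and> c < 1/2 \<longrightarrow> (\<exists>k0>0. \<forall>k. 0 < k \<and> k < k0 \<longrightarrow>
    (\<forall>x y. (x, y) \<in> usq \<longrightarrow> Lf h x y + Ph2 h x y = Lf h c (1/2) + Ph2 h c (1/2) \<longrightarrow> E2 h k x y < 0))"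
proof -
  have h1: "h < 1" using h by simp
  have "\<exists>\<delta>>0. \<delta> \<le> 1/4 \<and> (\<forall>x y. (x, y) \<in> collar \<delta> \<longrightarrow> x * (1 - x) * J1 h x y + y * (1 - y) * J2 h x y < 0)"
  proof (rule collar_neg)
    show "continuous_on UNIV (\<lambda>z. J1 h (fst z) (snd z))" "continuous_on UNIV (\<lambda>z. J2 h (fst z) (snd z))"
      unfolding J1_def J2_def Ft_def Gt_def px2_def py2_def by (intro continuous_intros | simp)+
  qed (use J_edges[OF h] in auto)
  then obtain \<delta> where \<delta>: "\<delta> > 0" "\<delta> \<le> 1/4" "\<And>x y. (x, y) \<in> collar \<delta> \<Longrightarrow> x * (1 - x) * J1 h x y + y * (1 - y) * J2 h x y < 0" by blast
  define \<delta>' where "\<delta>' = \<delta> / 2"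
  have \<delta>': "0 < \<delta>'" "\<delta>' < 1" "\<delta>' < \<delta>" using \<delta> by (auto simp: \<delta>'_def)
  show ?thesis
  \<comment> \<open>Outside the collar \<open>Lf\<close> is at least
    \<open>6 * ln \<delta>'\<close>, because its weights add up to
    \<open>2 * (1 + h) + 2 \<le> 6\<close> and the logarithm is negative; 24 absorbs the corrections
    at both points.\<close>
  proof (rule exI[of _ "exp (6 * ln \<delta>' - 24)"], intro conjI allI impI)
    fix c assume "0 < c \<and> c < exp (6 * ln \<delta>' - 24) \<and> c < 1/2"
    then have c: "0 < c" "c < exp (6 * ln \<delta>' - 24)" "c < 1/2" by auto
    have "ln c < ln (exp (6 * ln \<delta>' - 24))" using c by (subst ln_less_cancel_iff) auto
    then have lc: "ln c < 6 * ln \<delta>' - 24" by simp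
    define \<eta> where "\<eta> = exp (2 * ln (c * (1 - c)) + ln (1/4) - 24)"
    have \<eta>: "\<eta> > 0" by (simp add: \<eta>_def)
    let ?S = "core \<eta> \<delta>'"
    have neg: "x * (1 - x) * J1 h x y + y * (1 - y) * J2 h x y < 0" if "(x, y) \<in> ?S" for x y
      by (rule \<delta>(3)) (use coreD[OF that \<eta>] \<delta>' in \<open>auto simp: collar_def usq_def\<close>)
    have "\<exists>k0>0. \<forall>k. 0 < k \<and> k < k0 \<longrightarrow> (\<forall>z\<in>?S.
        - (fst z * (1 - fst z) * J1 h (fst z) (snd z) + snd z * (1 - snd z) * J2 h (fst z) (snd z)) +
        k * (- ((1 + h) * fst z * snd z * ((2 * snd z - 1) - snd z * (1 - snd z) * py2 h (fst z) (snd z)))) > 0)"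
    proof (rule pos_perturb[OF compact_core])
      show "0 < - (fst z * (1 - fst z) * J1 h (fst z) (snd z) + snd z * (1 - snd z) * J2 h (fst z) (snd z))" if "z \<in> ?S" for z
        using neg[of "fst z" "snd z"] that by simp
    qed (unfold J1_def J2_def Ft_def Gt_def px2_def py2_def, (intro continuous_intros | simp)+)
    then obtain k0 where k0: "k0 > 0" "\<And>k z. 0 < k \<Longrightarrow> k < k0 \<Longrightarrow> z \<in> ?S \<Longrightarrow>
        - (fst z * (1 - fst z) * J1 h (fst z) (snd z) + snd z * (1 - snd z) * J2 h (fst z) (snd z)) +
        k * (- ((1 + h) * fst z * snd z * ((2 * snd z - 1) - snd z * (1 - snd z) * py2 h (fst z) (snd z)))) > 0" by meson
    show "\<exists>k0>0. \<forall>k. 0 < k \<and> k < k0 \<longrightarrow>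
      (\<forall>x y. (x, y) \<in> usq \<longrightarrow> Lf h x y + Ph2 h x y = Lf h c (1/2) + Ph2 h c (1/2) \<longrightarrow> E2 h k x y < 0)"
    proof (rule exI[of _ k0], intro conjI allI impI k0(1))
      fix k x y assume k: "0 < k \<and> k < k0" and xy: "(x, y) \<in> usq"
        and l: "Lf h x y + Ph2 h x y = Lf h c (1/2) + Ph2 h c (1/2)"
      have r: "0 < x" "x < 1" "0 < y" "y < 1" using xy by (auto simp: usq_def)
      have c1: "c < 1" using c by simp
      note b = Ph2_bound[OF h(1) h1 r] Ph2_bound[OF h(1) h1 c(1) c1, of "1/2", simplified]
      have "\<eta> \<le> x * (1 - x) * (y * (1 - y))"
        unfolding \<eta>_def by (rule level_bound[OF h(1) h1 r c(1) c1 l b])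
      moreover have "(x, y) \<in> collar \<delta>'"
      proof (rule ccontr)
        assume "(x, y) \<notin> collar \<delta>'"
        then have g: "\<delta>' \<le> x" "\<delta>' \<le> 1 - x" "\<delta>' \<le> y" "\<delta>' \<le> 1 - y" using r by (auto simp: collar_def usq_def)
        then have "ln \<delta>' \<le> ln x" "ln \<delta>' \<le> ln (1 - x)" and ly: "ln \<delta>' \<le> ln y" "ln \<delta>' \<le> ln (1 - y)" using \<delta>' by auto
        then have "(1 + h) * (2 * ln \<delta>') \<le> (1 + h) * (ln x + ln (1 - x))" using h by (intro mult_left_mono) auto
        moreover have "2 * (2 * ln \<delta>') \<le> (1 + h) * (2 * ln \<delta>')" using h \<delta>' by (intro mult_right_mono_neg) auto
        ultimately have "6 * ln \<delta>' \<le> Lf h x y" using ly unfolding Lf_def by linarith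
        moreover have "Lf h c (1/2) \<le> ln c"
        proof -
          have n: "ln c \<le> 0" "ln (1 - c) \<le> 0" using c c1 by auto
          then have "(1 + h) * (ln c + ln (1 - c)) \<le> 1 * (ln c + ln (1 - c))" using h by (intro mult_right_mono_neg) auto
          moreover have "ln (1/2::real) \<le> 0" by simp
          moreover have "Lf h c (1/2) = (1 + h) * (ln c + ln (1 - c)) + 2 * ln (1/2)" by (simp add: Lf_def)
          moreover have "X + 2 * L \<le> a" if "X \<le> 1 * (a + b)" "L \<le> 0" "b \<le> 0" for X L a b :: real using that by simp
          ultimately show ?thesis using n(2) by metis
        qed
        ultimately show False using b l lc by linarith
      qed
      ultimately have "(x, y) \<in> ?S" by (intro coreI)
      then show "E2 h k x y < 0" using k0(2)[of k "(x, y)"] k by (simp add: E2_def)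
    qed
  qed simp
qed

section \<open>Choice of the parameters and the two cycles\<close>

lemma mup_origin: "mup 0 0 = (1, 1, 1, 1, 1)"
  by (simp add: mup_def)

lemma mup_near:
  assumes "\<delta> > 0" "\<forall>\<^sub>F c in nhds (coef (mup 0 0)). Q c"
  shows "\<exists>e>0. \<forall>h k. 0 < h \<and> h < e \<and> 0 < k \<and> k < e \<longrightarrow> norm (mup h k - mup 0 0) < \<delta> \<and> Q (coef (mup h k))"
proof -
  let ?m = "\<lambda>p. mup (fst p) (snd p)"
  have fs: "(fst \<longlongrightarrow> 0) (at (0::real, 0::real))" "(snd \<longlongrightarrow> 0) (at (0::real, 0::real))"
    using tendsto_fst[OF tendsto_ident_at[of "(0::real, 0::real)" UNIV]]
      tendsto_snd[OF tendsto_ident_at[of "(0::real, 0::real)" UNIV]] by simp_all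
  have m: "(?m \<longlongrightarrow> mup (fst (0, 0)) (snd (0, 0))) (at (0, 0))"
    unfolding mup_def by (intro tendsto_intros) (auto intro: fs)
  have "((\<lambda>p. coef (?m p)) \<longlongrightarrow> coef (mup (fst (0, 0)) (snd (0, 0)))) (at (0, 0))"
    unfolding mup_def coef_def prod.case by (intro tendsto_intros) (auto intro: fs)
  then have "filterlim (\<lambda>p. coef (?m p)) (nhds (coef (mup 0 0))) (nhds (0, 0))"
    using tendsto_at_iff_tendsto_nhds[of "\<lambda>p. coef (?m p)" "(0, 0)"] by simp
  then have "\<forall>\<^sub>F p in nhds (0, 0). Q (coef (?m p))" using assms(2) by (rule eventually_compose_filterlim[rotated])
  moreover have "filterlim ?m (nhds (mup 0 0)) (nhds (0, 0))"
    using m tendsto_at_iff_tendsto_nhds[of ?m "(0, 0)"] by simp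
  then have "\<forall>\<^sub>F p in nhds (0, 0). dist (?m p) (mup 0 0) < \<delta>" using assms(1) by (rule tendstoD)
  ultimately have "\<forall>\<^sub>F p in nhds (0, 0). dist (?m p) (mup 0 0) < \<delta> \<and> Q (coef (?m p))" by (simp add: eventually_conj_iff)
  then obtain e where e: "e > 0" "\<And>p. dist p (0, 0) < e \<Longrightarrow> dist (?m p) (mup 0 0) < \<delta> \<and> Q (coef (?m p))"
    unfolding eventually_nhds_metric by blast
  show ?thesis
  proof (rule exI[of _ "e / 2"], intro conjI allI impI)
    show "0 < e / 2" using e by simp
    fix h k assume a: "0 < h \<and> h < e / 2 \<and> 0 < k \<and> k < e / 2"
    have "dist (h, k) (0, 0) < e"
      unfolding dist_prod_def dist_real_def using sqrt_sum_squares_le_sum_abs[of h k] a by simp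
    from e(2)[OF this] show "norm (mup h k - mup 0 0) < \<delta>" "Q (coef (mup h k))" by (simp_all add: dist_norm)
  qed
qed

lemma mup_param_set: "0 < h \<Longrightarrow> 0 \<le> k \<Longrightarrow> k < 1 \<Longrightarrow> mup h k \<in> param_set"
  by (simp add: mup_def param_set_def)

lemma collar_mono: "d \<le> d' \<Longrightarrow> collar d \<subseteq> collar d'"
  by (auto simp: collar_def)

lemma return_increases:
  assumes r: "rets 4 (coef (mup h k)) d c c'" and d: "0 < d" "d \<le> 1/16" and h: "0 < h"
    and E: "\<And>x y. (x, y) \<in> collar (1/16) \<Longrightarrow> Lf h x y + Ph3 h x y = Lf h c (1/2) + Ph3 h c (1/2) \<Longrightarrow> E3 h k x y > 0"
  shows "c < c'"
proof -
  have p: "0 < c" "c < 1/2" "0 < c'" "c' < 1/2" using rets_pos[of 3 "coef (mup h k)" d c c'] r by (simp_all add: numeral_eq_Suc)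
  have "Lf h c (1/2) + Ph3 h c (1/2) < Lf h c' (1/2) + Ph3 h c' (1/2)"
  proof (rule level_increase[OF r d(1), where W = "\<lambda>x y. Lf h x y + Ph3 h x y" and E = "E3 h k"])
    show "d \<le> 1/4" using d by simp
    show "((\<lambda>t. Lf h (fst (\<phi> t)) (snd (\<phi> t)) + Ph3 h (fst (\<phi> t)) (snd (\<phi> t))) has_real_derivative
        E3 h k (fst (\<phi> t)) (snd (\<phi> t))) (at t)" if "orbit (coef (mup h k)) \<phi>" for \<phi> t
      by (rule W3_deriv[OF that]) (use h in simp)
    show "0 < E3 h k x y" if "(x, y) \<in> collar d" "Lf h x y + Ph3 h x y = Lf h c (1/2) + Ph3 h c (1/2)" for x y
      using E[OF subsetD[OF collar_mono[OF d(2)] that(1)] that(2)] .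
  qed
  then show ?thesis using W3_mono[of c' c h] p h by (cases c c' rule: linorder_cases) auto
qed

lemma return_decreases:
  assumes r: "rets 4 (coef (mup h k)) d c c'" and d: "0 < d" "d \<le> 1/4" and h: "0 < h"
    and E: "\<And>x y. (x, y) \<in> usq \<Longrightarrow> Lf h x y + Ph2 h x y = Lf h c (1/2) + Ph2 h c (1/2) \<Longrightarrow> E2 h k x y < 0"
  shows "c' < c"
proof -
  have p: "0 < c" "c < 1/2" "0 < c'" "c' < 1/2" using rets_pos[of 3 "coef (mup h k)" d c c'] r by (simp_all add: numeral_eq_Suc)
  have "- (Lf h c (1/2) + Ph2 h c (1/2)) < - (Lf h c' (1/2) + Ph2 h c' (1/2))"
  proof (rule level_increase[OF r d, where W = "\<lambda>x y. - (Lf h x y + Ph2 h x y)" and E = "\<lambda>x y. - E2 h k x y"])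
    show "((\<lambda>t. - (Lf h (fst (\<phi> t)) (snd (\<phi> t)) + Ph2 h (fst (\<phi> t)) (snd (\<phi> t)))) has_real_derivative
        - E2 h k (fst (\<phi> t)) (snd (\<phi> t))) (at t)" if "orbit (coef (mup h k)) \<phi>" for \<phi> t
      by (rule DERIV_minus[OF W2_deriv[OF that]]) (use h in simp)
    show "0 < - E2 h k x y" if "(x, y) \<in> collar d" "- (Lf h x y + Ph2 h x y) = - (Lf h c (1/2) + Ph2 h c (1/2))" for x y
      using E[of x y] that by (simp add: collar_def)
  qed
  then show ?thesis using W2_mono[of c c' h] p h by (cases c c' rule: linorder_cases) auto
qed

text \<open>An exponent strictly between the product \<open>1 - k\<close> of the ratios and 1 leaves
  room for the constant of \<open>rets_lower\<close>: \<open>C * s powr (1 - k / 2)\<close> exceeds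
  \<open>s\<close> near 0.\<close>

lemma expanding_near_cycle:
  assumes g: "good c" and k: "0 < k" "ratios n c = 1 - k" and d: "0 < d" and e: "0 < e"
  shows "\<exists>s s'. 0 < s \<and> s < e \<and> rets n c d s s' \<and> s < s'"
proof -
  have "ratios n c < 1 - k / 2" using k by simp
  from rets_lower[OF g this] obtain d1 where d1: "d1 > 0" "\<And>d. 0 < d \<Longrightarrow> d \<le> d1 \<Longrightarrow>
    (\<exists>C>0. \<forall>s s'. 0 < s \<and> s < 1 \<and> rets n c d s s' \<longrightarrow> C * s powr (1 - k / 2) \<le> s')" by blast
  from rets_exists[OF g, of n] obtain d2 where d2: "d2 > 0" "\<And>d. 0 < d \<Longrightarrow> d \<le> d2 \<Longrightarrow>
    (\<forall>e>0. \<exists>\<sigma>>0. \<forall>\<^sub>F c in nhds c. \<forall>s. 0 < s \<and> s < \<sigma> \<longrightarrow> (\<exists>s'. s' < e \<and> rets n c d s s'))" by blast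
  \<comment> \<open>The lower bound may require a thinner collar; by \<open>rets_mono\<close> a
    return inside it is also a return for \<open>d\<close>.\<close>
  define d' where "d' = min d (min d1 d2)"
  have d': "0 < d'" "d' \<le> d" "d' \<le> d1" "d' \<le> d2" using d d1 d2 by (auto simp: d'_def)
  obtain C where C: "C > 0" "\<And>s s'. 0 < s \<Longrightarrow> s < 1 \<Longrightarrow> rets n c d' s s' \<Longrightarrow> C * s powr (1 - k / 2) \<le> s'"
    using d1(2)[OF d'(1,3)] by blast
  obtain \<sigma> where \<sigma>: "\<sigma> > 0" "\<forall>\<^sub>F c in nhds c. \<forall>s. 0 < s \<and> s < \<sigma> \<longrightarrow> (\<exists>s'. s' < 1 \<and> rets n c d' s s')"
    using d2(2)[OF d'(1,4)] zero_less_one by blast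
  have ex: "\<exists>s'. rets n c d' s s'" if "0 < s" "s < \<sigma>" for s
    using eventually_nhds_x_imp_x[OF \<sigma>(2)] that by blast
  \<comment> \<open>The bound \<open>C powr (2 / k)\<close> amounts to
    \<open>s powr (k / 2) < C\<close>, that is \<open>s < C * s powr (1 - k / 2)\<close>.\<close>
  define s where "s = min (min e \<sigma>) (min 1 (C powr (2 / k))) / 2"
  have s: "0 < s" "s < e" "s < \<sigma>" "s < 1" "s < C powr (2 / k)" using e \<sigma>(1) C(1) powr_gt_zero[of C "2 / k"] unfolding s_def by linarith+
  obtain s' where s': "rets n c d' s s'" using ex[OF s(1,3)] by blast
  have "s powr (k / 2) < (C powr (2 / k)) powr (k / 2)" using s k by (intro powr_less_mono2) auto
  also have "\<dots> = C" using k C by (simp add: powr_powr)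
  finally have "s powr (k / 2) * s powr (1 - k / 2) < C * s powr (1 - k / 2)" using s by (intro mult_strict_right_mono) auto
  then have "s < C * s powr (1 - k / 2)" using s by (simp add: powr_add[symmetric])
  also have "\<dots> \<le> s'" by (rule C(2)[OF s(1,4) s'])
  finally show ?thesis using s(1,2) rets_mono[OF s' d'(2)] by (intro exI conjI)
qed

text \<open>The order of the choices is essential: \<open>d\<close> and \<open>\<sigma>\<close> for
  all parameters near \<open>mup 0 0\<close>, then \<open>c3\<close>, then \<open>h\<close> small
  for \<open>c3\<close>, \<open>c2\<close> small for \<open>h\<close>, \<open>k\<close> small for
  both levels, and \<open>c1\<close> small for \<open>k\<close>.\<close>

lemma two_limit_cycles:
  assumes \<epsilon>: "\<epsilon> > 0" and \<delta>: "\<delta> > 0"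
  shows "\<exists>\<mu>\<in>param_set. norm (\<mu> - mup 0 0) < \<delta> \<and>
    (\<exists>C1 C2. C1 \<noteq> C2 \<and> limit_cycle (vfield \<mu>) C1 \<and> hausdorff_distance C1 square_boundary < \<epsilon> \<and>
       limit_cycle (vfield \<mu>) C2 \<and> hausdorff_distance C2 square_boundary < \<epsilon>)"
proof -
  have "mup 0 0 \<in> param_set" by (simp add: mup_origin param_set_def)
  from rets_exists[OF good_coef[OF this], of 4]
  obtain d0 where d0: "d0 > 0" "d0 \<le> 1/4" "\<And>d. 0 < d \<Longrightarrow> d \<le> d0 \<Longrightarrow> (\<forall>\<^sub>F c in nhds (coef (mup 0 0)). stats 4 c d)"
    "\<And>d. 0 < d \<Longrightarrow> d \<le> d0 \<Longrightarrow> (\<forall>e>0. \<exists>\<sigma>>0. \<forall>\<^sub>F c in nhds (coef (mup 0 0)). \<forall>s. 0 < s \<and> s < \<sigma> \<longrightarrow> (\<exists>s'. s' < e \<and> rets 4 c d s s'))"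
    by blast
  \<comment> \<open>\<open>1/16\<close> is the width of the collar in \<open>third_level\<close>,
    and \<open>2 * d\<close> bounds the Hausdorff distance.\<close>
  define d where "d = min d0 (min (1/16) (\<epsilon> / 4))"
  have d: "0 < d" "d \<le> d0" "d \<le> 1/16" "d \<le> 1/4" "2 * d < \<epsilon>" using d0 \<epsilon> by (auto simp: d_def)
  obtain \<sigma> where \<sigma>: "\<sigma> > 0" "\<forall>\<^sub>F c in nhds (coef (mup 0 0)). \<forall>s. 0 < s \<and> s < \<sigma> \<longrightarrow> (\<exists>s'. s' < 1 \<and> rets 4 c d s s')"
    using d0(4)[OF d(1,2)] zero_less_one by blast
  from mup_near[OF \<delta> eventually_conj[OF d0(3)[OF d(1,2)] \<sigma>(2)]]
  obtain e where e': "e > 0 \<and> (\<forall>h k. 0 < h \<and> h < e \<and> 0 < k \<and> k < e \<longrightarrow> norm (mup h k - mup 0 0) < \<delta> \<and>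
    stats 4 (coef (mup h k)) d \<and> (\<forall>s. 0 < s \<and> s < \<sigma> \<longrightarrow> (\<exists>s'. s' < 1 \<and> rets 4 (coef (mup h k)) d s s')))" by (rule exE)
  have e: "e > 0" using e' by (rule conjunct1)
  have near: "norm (mup h k - mup 0 0) < \<delta>" "stats 4 (coef (mup h k)) d"
    "0 < s \<Longrightarrow> s < \<sigma> \<Longrightarrow> \<exists>s'. rets 4 (coef (mup h k)) d s s'" if "0 < h" "h < e" "0 < k" "k < e" for h k s
    using e'[THEN conjunct2, rule_format, of h k] that by (simp, simp, metis)
  define c3 where "c3 = min \<sigma> (1/2) / 2"
  have c3: "0 < c3" "c3 < 1/2" "c3 < \<sigma>" using \<sigma>(1) by (auto simp: c3_def)
  from third_level[OF c3(1,2)] obtain h0 where h0: "h0 > 0" "\<And>h. 0 < h \<Longrightarrow> h < h0 \<Longrightarrow> (\<exists>k0>0. \<forall>k. 0 < k \<and> k < k0 \<longrightarrow>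
    (\<forall>x y. (x, y) \<in> collar (1/16) \<longrightarrow> Lf h x y + Ph3 h x y = Lf h c3 (1/2) + Ph3 h c3 (1/2) \<longrightarrow> E3 h k x y > 0))" by blast
  define h where "h = min h0 (min e (1/3)) / 2"
  have h: "0 < h" "h < h0" "h < e" "h < 1/3" using h0(1) e by (auto simp: h_def)
  obtain k3 where k3: "k3 > 0" "\<And>k x y. 0 < k \<Longrightarrow> k < k3 \<Longrightarrow> (x, y) \<in> collar (1/16) \<Longrightarrow>
      Lf h x y + Ph3 h x y = Lf h c3 (1/2) + Ph3 h c3 (1/2) \<Longrightarrow> E3 h k x y > 0" using h0(2)[OF h(1,2)] by blast
  from second_level[OF h(1,4)] obtain c0 where c0: "c0 > 0" "\<And>c. 0 < c \<Longrightarrow> c < c0 \<Longrightarrow> c < 1/2 \<Longrightarrow> (\<exists>k0>0. \<forall>k. 0 < k \<and> k < k0 \<longrightarrow>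
    (\<forall>x y. (x, y) \<in> usq \<longrightarrow> Lf h x y + Ph2 h x y = Lf h c (1/2) + Ph2 h c (1/2) \<longrightarrow> E2 h k x y < 0))" by blast
  define c2 where "c2 = min c0 c3 / 2"
  have c2: "0 < c2" "c2 < c0" "c2 < c3" using c0(1) c3 by (auto simp: c2_def)
  then have c2': "c2 < 1/2" "c2 < \<sigma>" using c3 by auto
  obtain k2 where k2: "k2 > 0" "\<And>k x y. 0 < k \<Longrightarrow> k < k2 \<Longrightarrow> (x, y) \<in> usq \<Longrightarrow>
      Lf h x y + Ph2 h x y = Lf h c2 (1/2) + Ph2 h c2 (1/2) \<Longrightarrow> E2 h k x y < 0" using c0(2)[OF c2(1,2) c2'(1)] by blast
  define k where "k = min (min k2 k3) (min e 1) / 2"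
  have k: "0 < k" "k < k2" "k < k3" "k < e" "k < 1" using k2(1) k3(1) e by (auto simp: k_def)
  have \<mu>: "mup h k \<in> param_set" using mup_param_set[of h k] h k by simp
  define c where "c = coef (mup h k)"
  have g: "good c" unfolding c_def by (rule good_coef[OF \<mu>])
  have st: "stats 4 c d" unfolding c_def by (rule near(2)[OF h(1,3) k(1,4)])
  define P where "P s = (SOME s'. rets 4 c d s s')" for s
  have P: "rets 4 c d s (P s)" if "0 < s" "s < \<sigma>" for s
    unfolding P_def by (rule someI_ex) (unfold c_def, rule near(3)[OF h(1,3) k(1,4) that])
  interpret R: return_map c d \<sigma> P by unfold_locales (use d st P in auto)
  have P3: "c3 < P c3"
    by (rule return_increases[OF P[OF c3(1,3), unfolded c_def] d(1,3) h(1)]) (rule k3(2)[OF k(1,3)])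
  have P2: "P c2 < c2"
    by (rule return_decreases[OF P[OF c2(1) c2'(2), unfolded c_def] d(1,4) h(1)]) (rule k2(2)[OF k(1,2)])
  have "ratios 4 c = 1 - k" unfolding c_def mup_def ratios_coef using h by (simp add: field_simps)
  from expanding_near_cycle[OF g k(1) this d(1) c2(1)]
  obtain c1 s' where c1: "0 < c1" "c1 < c2" "rets 4 c d c1 s'" "c1 < s'" by blast
  have P1: "c1 < P c1" using R.P_eq[OF c1(3,1)] c1 c2' by simp
  obtain a where a: "c1 < a" "a < c2" "P a = a" by (rule R.fixed_point_between[OF c1(1,2) c2'(2)]) (use P1 P2 in auto)
  obtain b where b: "c2 < b" "b < c3" "P b = b" by (rule R.fixed_point_between[OF c2(1,3) c3(3)]) (use P2 P3 in auto)
  have "(a, 1/2) \<in> usq" "(b, 1/2) \<in> usq" using a b c1 c2 c3 by (auto simp: usq_def)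
  then obtain \<phi> \<psi> where o: "orbit c \<phi>" "\<phi> 0 = (a, 1/2)" "orbit c \<psi>" "\<psi> 0 = (b, 1/2)" by (meson orbit_exists)
  have ab: "0 < a" "a < \<sigma>" "0 < b" "b < \<sigma>" using a b c1 c2 c3 by auto
  have ne: "P c2 \<noteq> c2" using P2 by simp
  note A = R.limit_cycle_of_fixed_point[OF ab(1,2) a(3) c2(1) c2'(2) ne o(1,2)]
  note B = R.limit_cycle_of_fixed_point[OF ab(3,4) b(3) c2(1) c2'(2) ne o(3,4)]
  have "range \<phi> \<noteq> range \<psi>"
  proof
    assume eq: "range \<phi> = range \<psi>"
    have "(b, 1/2) \<in> range \<psi>" by (rule range_eqI[of _ _ 0]) (simp add: o(4))
    then have "(b, 1/2) \<in> range \<phi>" unfolding eq .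
    moreover have "b < 1/2" using b c3 by simp
    ultimately have "b = a" using A by blast
    then show False using a b by simp
  qed
  moreover have "hausdorff_distance (range \<phi>) square_boundary < \<epsilon>" "hausdorff_distance (range \<psi>) square_boundary < \<epsilon>"
    using A B d(5) by linarith+
  moreover have "limit_cycle (vfield (mup h k)) (range \<phi>)" "limit_cycle (vfield (mup h k)) (range \<psi>)"
    using A B unfolding vfield_eq c_def[symmetric] by blast+
  moreover have "norm (mup h k - mup 0 0) < \<delta>" by (rule near(1)[OF h(1,3) k(1,4)])
  ultimately show ?thesis using \<mu> by blast
qed

theorem theorem2:
  shows "(\<forall>\<mu>\<in>param_set.
            polycycle (vfield \<mu>) [(0, 1), (0, 0), (1, 0), (1, 1)]
              ({0<..<1} \<times> {0<..<1}) square_boundary) \<and>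
         (\<exists>\<mu>0\<in>param_set. \<forall>\<epsilon>>0. \<forall>\<delta>>0. \<exists>\<mu>\<in>param_set. norm (\<mu> - \<mu>0) < \<delta> \<and>
            (\<exists>C1 C2. C1 \<noteq> C2 \<and>
               limit_cycle (vfield \<mu>) C1 \<and> hausdorff_distance C1 square_boundary < \<epsilon> \<and>
               limit_cycle (vfield \<mu>) C2 \<and> hausdorff_distance C2 square_boundary < \<epsilon>))"
proof (rule conjI)
  show "\<exists>\<mu>0\<in>param_set. \<forall>\<epsilon>>0. \<forall>\<delta>>0. \<exists>\<mu>\<in>param_set. norm (\<mu> - \<mu>0) < \<delta> \<and>
      (\<exists>C1 C2. C1 \<noteq> C2 \<and>
         limit_cycle (vfield \<mu>) C1 \<and> hausdorff_distance C1 square_boundary < \<epsilon> \<and>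
         limit_cycle (vfield \<mu>) C2 \<and> hausdorff_distance C2 square_boundary < \<epsilon>)"
  proof (rule bexI[of _ "mup 0 0"])
    show "mup 0 0 \<in> param_set" by (simp add: mup_origin param_set_def)
  qed (use two_limit_cycles in meson)
qed (intro ballI polycycle_vfield)

end
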